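(* Let $R=\mathbb Z_{(3)}$. The localisation $\Lambda_{(3)}\subseteq A_R$ of $\Lambda$ at $3$ is the set of all $$\begin{bmatrix} s_{1,1}&s_{1,2}&s_{1,3}&0&0&t_1\\ s_{2,1}&s_{2,2}&s_{2,3}&0&0&t_2\\ s_{3,1}&s_{3,2}&s_{3,3}&0&0&t_3\\ 0&0&0&u&0&v\\ 0&0&0&0&w&0\\ x_1&x_2&x_3&y&0&z_1+z_2\bar\eta+z_3\bar\xi\end{bmatrix}\in A_R$$ (all of $s_{i,j},t_i,u,v,w,x_i,y,z_i$ in $R$) satisfying $x_1\equiv x_2\equiv x_3\equiv z_2\equiv 0\pmod 3$ in $R$. In particular, $\mathrm{B}_R(S_3,S_3)\cong\Lambda_{(3)}$ as $R$-algebras.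
   Context: **Double Burnside algebra.** For a finite group $G$ and a commutative ring $R$, $\mathrm{B}_R(G,G)$ is the $R$-module generated by the isomorphism classes $[M]$ of finite $(G,G)$-bisets (finite sets with commuting left and right $G$-actions) modulo $[M\sqcup N]=[M]+[N]$, with multiplication induced by $[M]\cdot[N]=[M\times_G N]$, where $M\times_G N$ is the set of $G$-orbits on $M\times N$ under $g(m,n)=(mg^{-1},gn)$, with biset structure induced by $h(m,n)p=(hm,np)$. **The algebra $A$.** Let $\mathbb Q[\bar\eta,\bar\xi]=\mathbb Q[\eta,\xi]/(\eta^2,\eta\xi,\xi^2)$, with $\mathbb Q$-basis $1,\bar\eta,\bar\xi$. $A$ consists of arrays $[a_{i,j}]_{i,j\in\{1,2,3,4\}}$ with $a_{i,j}\in A_{i,j}$, where $A_{1,1}=\mathbb Q^{3\times3}$, $A_{1,4}=\mathbb Q^{3\times1}$, $A_{4,1}=\mathbb Q^{1\times3}$, $A_{2,2}=A_{2,4}=A_{3,3}=A_{4,2}=\mathbb Q$, $A_{4,4}=\mathbb Q[\bar\eta,\bar\xi]$, and all other $A_{i,j}=0$. Addition is entrywise; the product of $[a_{i,j}]$ and $[a'_{i,j}]$ has $(i,j)$ entry $\sum_r\alpha_{i,r,j}(a_{i,r},a'_{r,j})$, where the bilinear maps $\alpha_{i,j,k}:A_{i,j}\times A_{j,k}\to A_{i,k}$ are: zero whenever one of $A_{i,j},A_{j,k},A_{i,k}$ is zero; $\alpha_{1,4,1}=0$, $\alpha_{2,4,2}=0$; $\alpha_{4,1,4}(x,y)=(xy)\bar\eta$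 (row times column); $\alpha_{4,2,4}(x,y)=xy(\bar\xi-12\bar\eta)$; $\alpha_{4,4,4}$ is multiplication in $\mathbb Q[\bar\eta,\bar\xi]$; in $\alpha_{1,4,4},\alpha_{2,4,4},\alpha_{4,4,1},\alpha_{4,4,2}$ an element $a+b\bar\eta+c\bar\xi\in A_{4,4}$ acts as multiplication by its constant term $a$; and $\alpha_{1,1,1},\alpha_{1,1,4},\alpha_{4,1,1},\alpha_{2,2,2},\alpha_{2,2,4},\alpha_{4,2,2},\alpha_{3,3,3}$ are the usual (matrix) products. Elements of $A$ are written as $6\times6$ arrays with block sizes $3,1,1,1$. For a subring $R\subseteq\mathbb Q$, $A_R\subseteq A$ is the subring of arrays all of whose entries lie in $R$, except that the $(6,6)$ entry lies in $R[\bar\eta,\bar\xi]=R+R\bar\eta+R\bar\xi$. **The order $\Lambda$.** $\Lambda\subseteq A_{\mathbb Z}$ is the subring (isomorphic to $\mathrm{B}_{\mathbb Z}(S_3,S_3)$) of all arrays of the shape displayed in the claim, with integer $s_{i,j},t_i,u,v,w,x_i,y,z_i$, satisfying $2w-2z_1\equiv z_2\pmod 8$, $z_2\equiv z_3\pmod4$, $z_3\equiv0\pmod 4$; $x_1\equiv x_2\equiv x_3\equiv0\pmod 4$; $y\equiv t_1\equiv t_2\equiv t_3\equiv v\equiv0\pmod2$; and $x_1\equiv x_2\equiv x_3\equiv z_2\equiv0\pmod 3$. For a prime $p$, $\Lambda_{(p)}$ denotes the localisation of $\Lambda$ at $p$, viewed as the $\mathbb Z_{(p)}$-submodule of $A$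 generated by $\Lambda$. *)

theory Defs
  imports
    "HOL-Analysis.Finite_Cartesian_Product"
    "HOL-Computational_Algebra.Polynomial"
    "HOL-Algebra.QuotRing"
    "HOL-Algebra.Module"
    "HOL-Algebra.Group_Action"
    "HOL-Algebra.Sym_Groups"
begin

section \<open>Algebras over a commutative ring\<close>

text \<open>The library locale \<^locale>\<open>algebra\<close> only covers commutative algebras.\<close>

definition is_algebra :: "('r, 's) ring_scheme \<Rightarrow> ('r, 'a, 'm) module_scheme \<Rightarrow> bool" where
  "is_algebra R M \<longleftrightarrow> Module.module R M \<and> Ring.ring M \<and>
     (\<forall>r\<in>carrier R. \<forall>x\<in>carrier M. \<forall>y\<in>carrier M.
        (r \<odot>\<^bsub>M\<^esub> x) \<otimes>\<^bsub>M\<^esub> y = r \<odot>\<^bsub>M\<^esub> (x \<otimes>\<^bsub>M\<^esub> y) \<and>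
        x \<otimes>\<^bsub>M\<^esub> (r \<odot>\<^bsub>M\<^esub> y) = r \<odot>\<^bsub>M\<^esub> (x \<otimes>\<^bsub>M\<^esub> y))"

definition algebras_isomorphic ::
  "('r, 's) ring_scheme \<Rightarrow> ('r, 'a, 'm) module_scheme \<Rightarrow> ('r, 'b, 'n) module_scheme \<Rightarrow> bool" where
  "algebras_isomorphic R M N \<longleftrightarrow> is_algebra R M \<and> is_algebra R N \<and>
     (\<exists>h\<in>ring_iso M N. \<forall>r\<in>carrier R. \<forall>x\<in>carrier M. h (r \<odot>\<^bsub>M\<^esub> x) = r \<odot>\<^bsub>N\<^esub> h x)"

definition generated_submodule ::
  "('r, 's) ring_scheme \<Rightarrow> ('r, 'a, 'm) module_scheme \<Rightarrow> 'a set \<Rightarrow> 'a set" where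
  "generated_submodule R M X = \<Inter>{N. submodule N R M \<and> X \<subseteq> N}"


section \<open>The double Burnside algebra\<close>

record ('g, 'm) biset =
  pts :: "'m set"
  lact :: "'g \<Rightarrow> 'm \<Rightarrow> 'm"
  ract :: "'m \<Rightarrow> 'g \<Rightarrow> 'm"

definition finite_biset :: "('g, 'k) monoid_scheme \<Rightarrow> ('g, 'm) biset \<Rightarrow> bool" where
  "finite_biset G M \<longleftrightarrow> finite (pts M) \<and>
     (\<forall>m\<in>pts M. lact M \<one>\<^bsub>G\<^esub> m = m \<and> ract M m \<one>\<^bsub>G\<^esub> = m) \<and>
     (\<forall>g\<in>carrier G. \<forall>m\<in>pts M. lact M g m \<in> pts M \<and> ract M m g \<in> pts M) \<and>
     (\<forall>g\<in>carrier G. \<forall>h\<in>carrier G. \<forall>m\<in>pts M.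
        lact M (g \<otimes>\<^bsub>G\<^esub> h) m = lact M g (lact M h m) \<and>
        ract M m (g \<otimes>\<^bsub>G\<^esub> h) = ract M (ract M m g) h \<and>
        ract M (lact M g m) h = lact M g (ract M m h))"

definition biset_iso ::
  "('g, 'k) monoid_scheme \<Rightarrow> ('g, 'm) biset \<Rightarrow> ('g, 'n) biset \<Rightarrow> bool" where
  "biset_iso G M N \<longleftrightarrow> (\<exists>f. bij_betw f (pts M) (pts N) \<and>
     (\<forall>g\<in>carrier G. \<forall>m\<in>pts M.
        f (lact M g m) = lact N g (f m) \<and> f (ract M m g) = ract N (f m) g))"

definition biset_sum :: "('g, 'm) biset \<Rightarrow> ('g, 'n) biset \<Rightarrow> ('g, 'm + 'n) biset" where
  "biset_sum M N = \<lparr>pts = pts M <+> pts N,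
     lact = (\<lambda>g. map_sum (lact M g) (lact N g)),
     ract = (\<lambda>p g. map_sum (\<lambda>m. ract M m g) (\<lambda>n. ract N n g) p)\<rparr>"

definition biset_tensor ::
  "('g, 'k) monoid_scheme \<Rightarrow> ('g, 'm) biset \<Rightarrow> ('g, 'n) biset \<Rightarrow> ('g, ('m \<times> 'n) set) biset" where
  "biset_tensor G M N =
     \<lparr>pts = orbits G (pts M \<times> pts N) (\<lambda>g (m, n). (ract M m (inv\<^bsub>G\<^esub> g), lact N g n)),
      lact = (\<lambda>h. (`) (\<lambda>(m, n). (lact M h m, n))),
      ract = (\<lambda>X p. (\<lambda>(m, n). (m, ract N n p)) ` X)\<rparr>"

definition regular_biset :: "('g, 'k) monoid_scheme \<Rightarrow> ('g, 'g) biset" where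
  "regular_biset G = \<lparr>pts = carrier G, lact = (\<otimes>\<^bsub>G\<^esub>), ract = (\<otimes>\<^bsub>G\<^esub>)\<rparr>"

text \<open>
  The isomorphism class of a finite biset on an arbitrary carrier type is represented by the
  set of its isomorphic copies living on finite sets of natural numbers. Every finite biset has
  such copies, so no isomorphism class is lost.
\<close>

type_synonym 'g biset_class = "('g, nat) biset set"

definition biset_class ::
  "('g, 'k) monoid_scheme \<Rightarrow> ('g, 'm) biset \<Rightarrow> 'g biset_class" where
  "biset_class G M = {N. finite_biset G N \<and> biset_iso G M N}"

definition biset_classes :: "('g, 'k) monoid_scheme \<Rightarrow> 'g biset_class set" where
  "biset_classes G = {biset_class G M | M :: ('g, nat) biset. finite_biset G M}"

definition class_tensor ::
  "('g, 'k) monoid_scheme \<Rightarrow> 'g biset_class \<Rightarrow> 'g biset_class \<Rightarrow> 'g biset_class" where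
  "class_tensor G X Y = (\<Union>M\<in>X. \<Union>N\<in>Y. biset_class G (biset_tensor G M N))"

definition basis_vector :: "('r, 's) ring_scheme \<Rightarrow> 'c \<Rightarrow> 'c \<Rightarrow> 'r" where
  "basis_vector R c = (\<lambda>d. if d = c then \<one>\<^bsub>R\<^esub> else \<zero>\<^bsub>R\<^esub>)"

text \<open>
  The free module on the isomorphism classes of finite bisets (finitely supported coefficient
  functions), with the bilinear extension of the product of classes.
\<close>

definition free_biset_algebra ::
  "('r, 's) ring_scheme \<Rightarrow> ('g, 'k) monoid_scheme \<Rightarrow> ('r, 'g biset_class \<Rightarrow> 'r) module" where
  "free_biset_algebra R G =
     \<lparr>carrier = {f. (\<forall>c. f c \<in> carrier R) \<and> finite {c. f c \<noteq> \<zero>\<^bsub>R\<^esub>} \<and>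
                    {c. f c \<noteq> \<zero>\<^bsub>R\<^esub>} \<subseteq> biset_classes G},
      mult = (\<lambda>f f' c. \<Oplus>\<^bsub>R\<^esub>p\<in>{(a, b). f a \<noteq> \<zero>\<^bsub>R\<^esub> \<and> f' b \<noteq> \<zero>\<^bsub>R\<^esub> \<and> class_tensor G a b = c}.
                         f (fst p) \<otimes>\<^bsub>R\<^esub> f' (snd p)),
      one = basis_vector R (biset_class G (regular_biset G)),
      zero = (\<lambda>c. \<zero>\<^bsub>R\<^esub>),
      add = (\<lambda>f f' c. f c \<oplus>\<^bsub>R\<^esub> f' c),
      smult = (\<lambda>r f c. r \<otimes>\<^bsub>R\<^esub> f c)\<rparr>"

definition burnside_relations ::
  "('r, 's) ring_scheme \<Rightarrow> ('g, 'k) monoid_scheme \<Rightarrow> ('g biset_class \<Rightarrow> 'r) set" where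
  "burnside_relations R G =
     {basis_vector R (biset_class G (biset_sum M N)) \<ominus>\<^bsub>free_biset_algebra R G\<^esub>
        (basis_vector R (biset_class G M) \<oplus>\<^bsub>free_biset_algebra R G\<^esub>
         basis_vector R (biset_class G N))
      | (M :: ('g, nat) biset) (N :: ('g, nat) biset). finite_biset G M \<and> finite_biset G N}"

definition double_burnside ::
  "('r, 's) ring_scheme \<Rightarrow> ('g, 'k) monoid_scheme \<Rightarrow> ('r, ('g biset_class \<Rightarrow> 'r) set) module" where
  "double_burnside R G =
     (let F = free_biset_algebra R G;
          I = generated_submodule R F (burnside_relations R G)
      in \<lparr>carrier = carrier (F Quot I), mult = mult (F Quot I), one = one (F Quot I),
          zero = zero (F Quot I), add = add (F Quot I),
          smult = (\<lambda>r X. \<Union>x\<in>X. I +>\<^bsub>F\<^esub> (r \<odot>\<^bsub>F\<^esub> x))\<rparr>)"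


section \<open>The ring $\mathbb{Q}[\eta,\xi]/(\eta^2,\eta\xi,\xi^2)$\<close>

text \<open>Bivariate polynomials are polynomials in $\xi$ whose coefficients are polynomials in $\eta$.\<close>

definition poly_eta :: "rat poly poly" where "poly_eta = [:[:0, 1:]:]"

definition poly_xi :: "rat poly poly" where "poly_xi = [:0, 1:]"

definition eta_xi_ideal :: "rat poly poly set" where
  "eta_xi_ideal = {a * poly_eta\<^sup>2 + b * (poly_eta * poly_xi) + c * poly_xi\<^sup>2 | a b c. True}"

lemma eta_xi_ideal_0: "0 \<in> eta_xi_ideal"
  unfolding eta_xi_ideal_def by (intro CollectI exI[of _ 0]) simp

lemma eta_xi_ideal_add:
  assumes "p \<in> eta_xi_ideal" "q \<in> eta_xi_ideal" shows "p + q \<in> eta_xi_ideal"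
proof -
  from assms obtain a b c a' b' c' where
    "p = a * poly_eta\<^sup>2 + b * (poly_eta * poly_xi) + c * poly_xi\<^sup>2"
    "q = a' * poly_eta\<^sup>2 + b' * (poly_eta * poly_xi) + c' * poly_xi\<^sup>2"
    unfolding eta_xi_ideal_def by blast
  then have "p + q = (a + a') * poly_eta\<^sup>2 + (b + b') * (poly_eta * poly_xi) + (c + c') * poly_xi\<^sup>2"
    by (simp add: algebra_simps)
  then show ?thesis unfolding eta_xi_ideal_def by blast
qed

lemma eta_xi_ideal_mult:
  assumes "p \<in> eta_xi_ideal" shows "r * p \<in> eta_xi_ideal"
proof -
  from assms obtain a b c where
    "p = a * poly_eta\<^sup>2 + b * (poly_eta * poly_xi) + c * poly_xi\<^sup>2"
    unfolding eta_xi_ideal_def by blast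
  then have "r * p = (r * a) * poly_eta\<^sup>2 + (r * b) * (poly_eta * poly_xi) + (r * c) * poly_xi\<^sup>2"
    by (simp add: algebra_simps)
  then show ?thesis unfolding eta_xi_ideal_def by blast
qed

lemma eta_xi_ideal_uminus: "p \<in> eta_xi_ideal \<Longrightarrow> - p \<in> eta_xi_ideal"
  using eta_xi_ideal_mult[of p "- 1"] by simp

lemma eta_xi_ideal_coeffs:
  assumes "p \<in> eta_xi_ideal"
  shows "coeff (coeff p 0) 0 = 0" "coeff (coeff p 0) 1 = 0" "coeff (coeff p 1) 0 = 0"
proof -
  from assms obtain a b c where
    p: "p = a * poly_eta\<^sup>2 + b * (poly_eta * poly_xi) + c * poly_xi\<^sup>2"
    unfolding eta_xi_ideal_def by blast
  have eqs: "poly_eta\<^sup>2 = [:[:0, 0, 1:]:]" "poly_eta * poly_xi = [:0, [:0, 1:]:]"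
    "poly_xi\<^sup>2 = [:0, 0, 1:]"
    by (simp_all add: poly_eta_def poly_xi_def power2_eq_square)
  show "coeff (coeff p 0) 0 = 0" "coeff (coeff p 0) 1 = 0" "coeff (coeff p 1) 0 = 0"
    unfolding p eqs by simp_all
qed

quotient_type qex = "rat poly poly" / "\<lambda>p q. p - q \<in> eta_xi_ideal"
proof (rule equivpI)
  show "reflp (\<lambda>p q. p - q \<in> eta_xi_ideal)"
    by (rule reflpI) (simp add: eta_xi_ideal_0)
  show "symp (\<lambda>p q. p - q \<in> eta_xi_ideal)"
  proof (rule sympI)
    fix p q assume "p - q \<in> eta_xi_ideal"
    from eta_xi_ideal_uminus[OF this] show "q - p \<in> eta_xi_ideal" by simp
  qed
  show "transp (\<lambda>p q. p - q \<in> eta_xi_ideal)"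
  proof (rule transpI)
    fix p q r assume "p - q \<in> eta_xi_ideal" "q - r \<in> eta_xi_ideal"
    from eta_xi_ideal_add[OF this] show "p - r \<in> eta_xi_ideal" by simp
  qed
qed

instantiation qex :: comm_ring_1
begin

lift_definition zero_qex :: qex is 0 .
lift_definition one_qex :: qex is 1 .
lift_definition plus_qex :: "qex \<Rightarrow> qex \<Rightarrow> qex" is "(+)"
  by (metis eta_xi_ideal_add add_diff_add)
lift_definition uminus_qex :: "qex \<Rightarrow> qex" is uminus
  by (metis eta_xi_ideal_uminus minus_diff_minus)
lift_definition minus_qex :: "qex \<Rightarrow> qex \<Rightarrow> qex" is "(-)"
proof -
  fix p p' q q' :: "rat poly poly"
  assume "p - p' \<in> eta_xi_ideal" "q - q' \<in> eta_xi_ideal"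
  then have "(p - p') + - (q - q') \<in> eta_xi_ideal"
    by (intro eta_xi_ideal_add eta_xi_ideal_uminus)
  then show "p - q - (p' - q') \<in> eta_xi_ideal" by (simp add: algebra_simps)
qed
lift_definition times_qex :: "qex \<Rightarrow> qex \<Rightarrow> qex" is "(*)"
proof -
  fix p p' q q' :: "rat poly poly"
  assume "p - p' \<in> eta_xi_ideal" "q - q' \<in> eta_xi_ideal"
  then have "q * (p - p') + p' * (q - q') \<in> eta_xi_ideal"
    by (intro eta_xi_ideal_add eta_xi_ideal_mult)
  then show "p * q - p' * q' \<in> eta_xi_ideal" by (simp add: algebra_simps)
qed

instance
proof
  show "(0::qex) \<noteq> 1"
  proof (transfer, rule notI)
    assume "(0::rat poly poly) - 1 \<in> eta_xi_ideal"
    from eta_xi_ideal_coeffs(1)[OF this] show False by simp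
  qed
qed (transfer, simp add: algebra_simps eta_xi_ideal_0)+

end

lift_definition eta_bar :: qex is poly_eta .
lift_definition xi_bar :: qex is poly_xi .
lift_definition const_qex :: "rat \<Rightarrow> qex" is "\<lambda>a. [:[:a:]:]" .

lift_definition const_term :: "qex \<Rightarrow> rat" is "\<lambda>p. coeff (coeff p 0) 0"
  using eta_xi_ideal_coeffs(1) by (metis coeff_diff eq_iff_diff_eq_0)

definition qelt :: "rat \<Rightarrow> rat \<Rightarrow> rat \<Rightarrow> qex" where
  "qelt a b c = const_qex a + const_qex b * eta_bar + const_qex c * xi_bar"

lemma qex_products: "eta_bar * eta_bar = 0" "eta_bar * xi_bar = 0" "xi_bar * xi_bar = 0"
proof -
  have "a * poly_eta\<^sup>2 + b * (poly_eta * poly_xi) + c * poly_xi\<^sup>2 \<in> eta_xi_ideal" for a b c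
    unfolding eta_xi_ideal_def by blast
  from this[of 1 0 0] this[of 0 1 0] this[of 0 0 1]
  have "poly_eta * poly_eta \<in> eta_xi_ideal" "poly_eta * poly_xi \<in> eta_xi_ideal"
    "poly_xi * poly_xi \<in> eta_xi_ideal" by (simp_all add: power2_eq_square)
  then show "eta_bar * eta_bar = 0" "eta_bar * xi_bar = 0" "xi_bar * xi_bar = 0"
    by (transfer, simp)+
qed

lemma const_qex_hom:
  "const_qex 0 = 0" "const_qex 1 = 1" "const_qex (a + b) = const_qex a + const_qex b"
  "const_qex (a * b) = const_qex a * const_qex b"
  by (transfer, simp add: eta_xi_ideal_0 one_pCons)+

lemma qelt_const_term: "const_term (qelt a b c) = a"
  unfolding qelt_def by transfer (simp add: poly_eta_def poly_xi_def)

lemma qelt_mult: "qelt a b c * qelt a' b' c' = qelt (a * a') (a * b' + b * a') (a * c' + c * a')"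
proof -
  have "(p + q * e + r * x) * (p' + q' * e + r' * x) =
      p * p' + (p * q' + q * p') * e + (p * r' + r * p') * x
      + q * q' * (e * e) + (q * r' + r * q') * (e * x) + r * r' * (x * x)"
    for p q r p' q' r' e x :: qex
    by (simp add: algebra_simps)
  then show ?thesis
    by (simp only: qelt_def const_qex_hom qex_products mult_zero_right add_0_right)
qed

lemma qelt_abs: "qelt a b c = abs_qex [:[:a, b:], [:c:]:]"
  by (simp add: qelt_def const_qex_def eta_bar_def xi_bar_def plus_qex.abs_eq times_qex.abs_eq
      poly_eta_def poly_xi_def)

lemma qelt_eq_iff: "qelt a b c = qelt a' b' c' \<longleftrightarrow> a = a' \<and> b = b' \<and> c = c'"
proof
  assume "qelt a b c = qelt a' b' c'"
  then have "[:[:a, b:], [:c:]:] - [:[:a', b':], [:c':]:] \<in> eta_xi_ideal"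
    by (simp only: qelt_abs qex.abs_eq_iff)
  from eta_xi_ideal_coeffs[OF this] show "a = a' \<and> b = b' \<and> c = c'" by simp
qed simp

lemma qelt_exhaust: "\<exists>a b c. q = qelt a b c"
proof -
  obtain p where q: "q = abs_qex p" using qex.abs_induct[of "\<lambda>q. \<exists>p. q = abs_qex p" q] by blast
  obtain p1 r where p: "p = pCons p1 r" by (cases p)
  obtain a p2 where p1: "p1 = pCons a p2" by (cases p1)
  obtain b p3 where p2: "p2 = pCons b p3" by (cases p2)
  obtain p4 s where r: "r = pCons p4 s" by (cases r)
  obtain c p5 where p4: "p4 = pCons c p5" by (cases p4)
  have "p - [:[:a, b:], [:c:]:]
      = [:p3:] * poly_eta\<^sup>2 + [:p5:] * (poly_eta * poly_xi) + s * poly_xi\<^sup>2"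
    by (simp add: p p1 p2 r p4 poly_eta_def poly_xi_def power2_eq_square)
  then have "p - [:[:a, b:], [:c:]:] \<in> eta_xi_ideal"
    unfolding eta_xi_ideal_def by blast
  then have "q = qelt a b c" by (simp only: q qelt_abs qex.abs_eq_iff)
  then show ?thesis by blast
qed


section \<open>The algebra $A$\<close>

text \<open>
  Only the blocks $A_{i,j}$ that are not zero by definition are recorded, so that the
  constructor arguments read off the array row by row.
\<close>

datatype arr = Arr
  (blk11: "rat^3^3") (blk14: "rat^3")
  (blk22: rat) (blk24: rat)
  (blk33: rat)
  (blk41: "rat^3") (blk42: rat) (blk44: qex)

text \<open>
  Each block of the product is $\sum_r \alpha_{i,r,j}(a_{i,r}, a'_{r,j})$ with the vanishing
  summands left out; these include $\alpha_{1,4,1} = 0$ and $\alpha_{2,4,2} = 0$.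
\<close>

definition arr_mult :: "arr \<Rightarrow> arr \<Rightarrow> arr" where
  "arr_mult a b = Arr
     (blk11 a ** blk11 b)
     (blk11 a *v blk14 b + const_term (blk44 b) *s blk14 a)
     (blk22 a * blk22 b)
     (blk22 a * blk24 b + blk24 a * const_term (blk44 b))
     (blk33 a * blk33 b)
     (blk41 a v* blk11 b + const_term (blk44 a) *s blk41 b)
     (blk42 a * blk22 b + const_term (blk44 a) * blk42 b)
     (const_qex (\<Sum>i\<in>UNIV. blk41 a $ i * blk14 b $ i) * eta_bar
      + const_qex (blk42 a * blk24 b) * (xi_bar - const_qex 12 * eta_bar)
      + blk44 a * blk44 b)"

definition arr_add :: "arr \<Rightarrow> arr \<Rightarrow> arr" where
  "arr_add a b = Arr (blk11 a + blk11 b) (blk14 a + blk14 b) (blk22 a + blk22 b)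
     (blk24 a + blk24 b) (blk33 a + blk33 b) (blk41 a + blk41 b) (blk42 a + blk42 b)
     (blk44 a + blk44 b)"

definition arr_scale :: "rat \<Rightarrow> arr \<Rightarrow> arr" where
  "arr_scale r a = Arr (\<chi> i j. r * blk11 a $ i $ j) (r *s blk14 a) (r * blk22 a)
     (r * blk24 a) (r * blk33 a) (r *s blk41 a) (r * blk42 a) (const_qex r * blk44 a)"

definition A_alg :: "(rat, arr) module" where
  "A_alg = \<lparr>carrier = UNIV, mult = arr_mult, one = Arr (mat 1) 0 1 0 1 0 0 1,
     zero = Arr 0 0 0 0 0 0 0 0, add = arr_add, smult = arr_scale\<rparr>"

definition A_over :: "rat set \<Rightarrow> arr set" where
  "A_over R = {Arr s t u v w x y (qelt z1 z2 z3) | s t u v w x y z1 z2 z3.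
     (\<forall>i j. s $ i $ j \<in> R) \<and> (\<forall>i. t $ i \<in> R) \<and> u \<in> R \<and> v \<in> R \<and> w \<in> R \<and>
     (\<forall>i. x $ i \<in> R) \<and> y \<in> R \<and> z1 \<in> R \<and> z2 \<in> R \<and> z3 \<in> R}"


section \<open>The order $\Lambda$ and its localisations\<close>

text \<open>
  Congruence modulo \<open>m\<close> inside a subring of the rationals; the library relation
  \<open>cong\<close> would be congruence in the field of all rationals.
\<close>

definition cong_in :: "rat set \<Rightarrow> rat \<Rightarrow> rat \<Rightarrow> rat \<Rightarrow> bool" where
  "cong_in R m a b \<longleftrightarrow> (\<exists>k\<in>R. a - b = m * k)"

definition Lambda :: "arr set" where
  "Lambda = {Arr s t u v w x y (qelt z1 z2 z3) | s t u v w x y z1 z2 z3.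
     Arr s t u v w x y (qelt z1 z2 z3) \<in> A_over \<int> \<and>
     cong_in \<int> 8 (2 * w - 2 * z1) z2 \<and> cong_in \<int> 4 z2 z3 \<and> cong_in \<int> 4 z3 0 \<and>
     (\<forall>i. cong_in \<int> 4 (x $ i) 0) \<and>
     cong_in \<int> 2 y 0 \<and> (\<forall>i. cong_in \<int> 2 (t $ i) 0) \<and> cong_in \<int> 2 v 0 \<and>
     (\<forall>i. cong_in \<int> 3 (x $ i) 0) \<and> cong_in \<int> 3 z2 0}"

definition Z_loc_set :: "nat \<Rightarrow> rat set" where
  "Z_loc_set p = {of_int a / of_int b | a b. \<not> int p dvd b}"

definition Z_loc :: "nat \<Rightarrow> rat ring" where
  "Z_loc p = \<lparr>carrier = Z_loc_set p, mult = (*), one = 1, zero = 0, add = (+)\<rparr>"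

definition Lambda_loc :: "nat \<Rightarrow> arr set" where
  "Lambda_loc p = generated_submodule (Z_loc p) A_alg Lambda"

end

theory Submission
  imports Defs "HOL-Analysis.Cartesian_Space"
begin

text \<open>
  A biset is sent to the sum, over its points, of a weight in $A$ that depends only on the
  stabiliser of the point in $S_3 \times S_3$. Stabilisers of points of a tensor product are
  relational composites of stabilisers, so this map is multiplicative as soon as the weights
  satisfy a Mackey identity. Both sides of it are invariant under conjugation, which leaves a finite
  computation with the 22 standard subgroups of $S_3 \times S_3$. The images of the corresponding 22
  transitive bisets are a basis of $\Lambda_{(3)}$, and modulo the relations every biset is a
  combination of these. Hence the kernel of the map on the free module is the module of relations,
  and the algebra structure of the quotient is that of $\Lambda_{(3)}$.
\<close>

section \<open>Coordinates on the algebra $A$\<close>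

text \<open>Values are attached to points rather than to transitive bisets so that no tensor product
  has to be decomposed into orbits: the double cosets of the Mackey formula are replaced by a sum
  over all of S_3, corrected by the sizes of the stabilisers of the middle action. The price is that
  weights must be controlled on every subgroup that occurs as a stabiliser or as a composite of
  stabilisers, hence the classification up to conjugacy.

  The images are fitted to the prime 3. They need not satisfy the 2-adic congruences of Lambda
  (\<open>coords (Q1, P1)\<close> has the odd entry t_1 = 1), but the inverse of the base change to
  coordinates has only the denominators 2 and 4, which are units at 3.

  The blocks of \<open>arr\<close> are vectors and elements of a quotient type and do not evaluate;
  the flat type \<open>tab\<close> does. It is polymorphic so that the finite checks run over the
  integers while the algebra is rational.\<close>

text \<open>
  The coordinates are the entries $s_{i,j}$ (row by row), $t_i$, $u$, $v$, $w$, $x_i$, $y$, $z_i$.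
\<close>

datatype 'a tab = Tab 'a 'a 'a 'a 'a 'a 'a 'a 'a 'a 'a 'a 'a 'a 'a 'a 'a 'a 'a 'a 'a 'a

fun tab_add :: "'a::comm_ring_1 tab \<Rightarrow> 'a tab \<Rightarrow> 'a tab" where
  "tab_add
     (Tab a0 a1 a2 a3 a4 a5 a6 a7 a8 a9 a10 a11 a12 a13 a14 a15 a16 a17 a18 a19 a20 a21)
     (Tab b0 b1 b2 b3 b4 b5 b6 b7 b8 b9 b10 b11 b12 b13 b14 b15 b16 b17 b18 b19 b20 b21) =
   Tab
      (a0 + b0) (a1 + b1) (a2 + b2) (a3 + b3) (a4 + b4) (a5 + b5) (a6 + b6) (a7 + b7) (a8 + b8)
      (a9 + b9) (a10 + b10) (a11 + b11) (a12 + b12) (a13 + b13) (a14 + b14) (a15 + b15)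
      (a16 + b16) (a17 + b17) (a18 + b18) (a19 + b19) (a20 + b20) (a21 + b21)"

fun tab_scale :: "'a::comm_ring_1 \<Rightarrow> 'a tab \<Rightarrow> 'a tab" where
  "tab_scale k (Tab a0 a1 a2 a3 a4 a5 a6 a7 a8 a9 a10 a11 a12 a13 a14 a15 a16 a17 a18 a19 a20 a21) =
   Tab
      (k * a0) (k * a1) (k * a2) (k * a3) (k * a4) (k * a5) (k * a6) (k * a7) (k * a8) (k * a9)
      (k * a10) (k * a11) (k * a12) (k * a13) (k * a14) (k * a15) (k * a16) (k * a17) (k * a18)
      (k * a19) (k * a20) (k * a21)"

text \<open>The array product written out. The two maps that vanish by definition leave no products
  of t with x in the first nine entries and none of v with y in the entry u. The 12 in the
  coefficient of eta stems from the factor xi - 12 eta of the product of y with v.\<close>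

fun tab_mult :: "'a::comm_ring_1 tab \<Rightarrow> 'a tab \<Rightarrow> 'a tab" where
  "tab_mult
     (Tab a0 a1 a2 a3 a4 a5 a6 a7 a8 a9 a10 a11 a12 a13 a14 a15 a16 a17 a18 a19 a20 a21)
     (Tab b0 b1 b2 b3 b4 b5 b6 b7 b8 b9 b10 b11 b12 b13 b14 b15 b16 b17 b18 b19 b20 b21) =
   Tab
      (a0 * b0 + a1 * b3 + a2 * b6) (a0 * b1 + a1 * b4 + a2 * b7) (a0 * b2 + a1 * b5 + a2 * b8)
      (a3 * b0 + a4 * b3 + a5 * b6) (a3 * b1 + a4 * b4 + a5 * b7) (a3 * b2 + a4 * b5 + a5 * b8)
      (a6 * b0 + a7 * b3 + a8 * b6) (a6 * b1 + a7 * b4 + a8 * b7) (a6 * b2 + a7 * b5 + a8 * b8)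
      (a0 * b9 + a1 * b10 + a2 * b11 + a9 * b19) (a3 * b9 + a4 * b10 + a5 * b11 + a10 * b19)
      (a6 * b9 + a7 * b10 + a8 * b11 + a11 * b19) (a12 * b12) (a12 * b13 + a13 * b19) (a14 * b14)
      (a15 * b0 + a16 * b3 + a17 * b6 + a19 * b15) (a15 * b1 + a16 * b4 + a17 * b7 + a19 * b16)
      (a15 * b2 + a16 * b5 + a17 * b8 + a19 * b17) (a18 * b12 + a19 * b18) (a19 * b19)
      (a15 * b9 + a16 * b10 + a17 * b11 - 12 * (a18 * b13) + a19 * b20 + a20 * b19)
      (a18 * b13 + a19 * b21 + a21 * b19)"

fun arr_of_tab :: "rat tab \<Rightarrow> arr" where
  "arr_of_tab (Tab a0 a1 a2 a3 a4 a5 a6 a7 a8 a9 a10 a11 a12 a13 a14 a15 a16 a17 a18 a19 a20 a21) =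
   Arr (vector [vector [a0, a1, a2], vector [a3, a4, a5], vector [a6, a7, a8]])
     (vector [a9, a10, a11]) a12 a13 a14 (vector [a15, a16, a17]) a18 (qelt a19 a20 a21)"

section \<open>The operations of A in coordinates\<close>

lemma vector_3_collapse: "vector [x $ 1, x $ 2, x $ 3] = (x :: 'a::zero ^ 3)"
  by (simp add: vec_eq_iff forall_3)

lemma vector_3_eq_iff:
  "vector [a, b, c] = (vector [a', b', c'] :: 'a::zero ^ 3) \<longleftrightarrow> a = a' \<and> b = b' \<and> c = c'"
  by (simp add: vec_eq_iff forall_3)

lemma qelt_add: "qelt a b c + qelt a' b' c' = qelt (a + a') (b + b') (c + c')"
  by (simp add: qelt_def const_qex_hom algebra_simps)

lemma const_qex_eq_qelt: "const_qex a = qelt a 0 0"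
  by (simp add: qelt_def const_qex_hom)

lemma eta_bar_eq_qelt: "eta_bar = qelt 0 1 0"
  by (simp add: qelt_def const_qex_hom)

lemma xi_bar_eq_qelt: "xi_bar = qelt 0 0 1"
  by (simp add: qelt_def const_qex_hom)

lemma qelt_0: "0 = qelt 0 0 0" and qelt_1: "1 = qelt 1 0 0"
  by (simp_all add: qelt_def const_qex_hom)

lemma qelt_uminus: "- qelt a b c = qelt (- a) (- b) (- c)"
  by (simp add: minus_unique qelt_add qelt_0[symmetric])

lemma qelt_diff: "qelt a b c - qelt a' b' c' = qelt (a - a') (b - b') (c - c')"
  by (simp only: diff_conv_add_uminus qelt_uminus qelt_add)

lemma arr_of_tab_surj: "\<exists>T. a = arr_of_tab T"
proof -
  obtain s t u v w x y z where a: "a = Arr s t u v w x y z" by (cases a)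
  obtain z1 z2 z3 where z: "z = qelt z1 z2 z3" using qelt_exhaust by blast
  have "a = arr_of_tab (Tab (s $ 1 $ 1) (s $ 1 $ 2) (s $ 1 $ 3) (s $ 2 $ 1) (s $ 2 $ 2) (s $ 2 $ 3)
     (s $ 3 $ 1) (s $ 3 $ 2) (s $ 3 $ 3) (t $ 1) (t $ 2) (t $ 3) u v w (x $ 1) (x $ 2) (x $ 3) y
     z1 z2 z3)"
    by (simp add: a z vector_3_collapse)
  then show ?thesis ..
qed

lemma arr_of_tab_inject: "arr_of_tab S = arr_of_tab T \<longleftrightarrow> S = T"
  by (cases S; cases T) (auto simp: vector_3_eq_iff qelt_eq_iff)

lemma arr_add_tab: "arr_add (arr_of_tab S) (arr_of_tab T) = arr_of_tab (tab_add S T)"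
  by (cases S; cases T) (simp add: arr_add_def qelt_add vec_eq_iff forall_3)

lemma arr_scale_tab: "arr_scale k (arr_of_tab T) = arr_of_tab (tab_scale k T)"
  by (cases T)
    (simp add: arr_scale_def const_qex_eq_qelt qelt_mult vec_eq_iff forall_3)

lemma arr_mult_tab: "arr_mult (arr_of_tab S) (arr_of_tab T) = arr_of_tab (tab_mult S T)"
  by (cases S; cases T)
    (simp add: arr_mult_def const_qex_eq_qelt eta_bar_eq_qelt xi_bar_eq_qelt qelt_mult qelt_add
      qelt_diff qelt_const_term vec_eq_iff forall_3 sum_3 matrix_matrix_mult_def
      matrix_vector_mult_def vector_matrix_mult_def qelt_eq_iff mult.commute algebra_simps)

lemma arr_zero_tab: "Arr 0 0 0 0 0 0 0 0 = arr_of_tab (Tab 0 0 0 0 0 0 0 0 0 0 0 0 0 0 0 0 0 0 0 0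
  0 0)"
  by (simp add: vec_eq_iff forall_3 qelt_0)

lemma arr_one_tab: "Arr (mat 1) 0 1 0 1 0 0 1 = arr_of_tab (Tab 1 0 0 0 1 0 0 0 1 0 0 0 1 0 1 0 0
  0 0 1 0 0)"
  by (simp add: vec_eq_iff forall_3 mat_def qelt_1)

text \<open>In coordinates the ring laws become polynomial identities, one for each of the 22
  entries. The instance makes ordinary finite sums over points and simplification in rings available
  for values in A.\<close>

instantiation arr :: ring_1
begin

definition "0 = Arr 0 0 0 0 0 0 0 0"
definition "1 = Arr (mat 1) 0 1 0 1 0 0 1"
definition "a + b = arr_add a b" for a b :: arr
definition "a * b = arr_mult a b" for a b :: arr
definition "- a = arr_scale (- 1) a" for a :: arr
definition "a - b = a + - b" for a b :: arr

lemmas arr_tab = zero_arr_def one_arr_def plus_arr_def times_arr_def uminus_arr_def minus_arr_def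
  arr_add_tab arr_mult_tab arr_scale_tab arr_zero_tab arr_one_tab arr_of_tab_inject

instance
proof
  fix a b c :: arr
  obtain R S T where abc: "a = arr_of_tab R" "b = arr_of_tab S" "c = arr_of_tab T"
    using arr_of_tab_surj by meson
  show "a + b + c = a + (b + c)" unfolding abc arr_tab
    by (cases R; cases S; cases T) simp
  show "a + b = b + a" unfolding abc arr_tab
    by (cases R; cases S) simp
  show "0 + a = a" unfolding abc arr_tab
    by (cases R) simp
  show "- a + a = 0" unfolding abc arr_tab
    by (cases R) simp
  show "a - b = a + - b" by (fact minus_arr_def)
  show "a * b * c = a * (b * c)" unfolding abc arr_tab
    by (cases R; cases S; cases T) (simp add: algebra_simps)
  show "1 * a = a" "a * 1 = a" unfolding abc arr_tab
    by (cases R; simp)+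
  show "(a + b) * c = a * c + b * c" "a * (b + c) = a * b + a * c" unfolding abc arr_tab
    by (cases R; cases S; cases T; simp add: algebra_simps)+
  show "(0::arr) \<noteq> 1" unfolding arr_tab by simp
qed

end

lemma arr_scale_add_right: "arr_scale k (a + b) = arr_scale k a + arr_scale k b"
  and arr_scale_add_left: "arr_scale (k + l) a = arr_scale k a + arr_scale l a"
  and arr_scale_scale: "arr_scale k (arr_scale l a) = arr_scale (k * l) a"
  and arr_scale_one: "arr_scale 1 a = a"
  and arr_scale_zero_left: "arr_scale 0 a = 0"
  and arr_scale_zero_right: "arr_scale k 0 = 0"
  and arr_scale_mult_left: "arr_scale k a * b = arr_scale k (a * b)"
  and arr_scale_mult_right: "a * arr_scale k b = arr_scale k (a * b)"
proof -
  obtain S T where ab: "a = arr_of_tab S" "b = arr_of_tab T"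
    using arr_of_tab_surj by meson
  show "arr_scale k (a + b) = arr_scale k a + arr_scale k b"
    "arr_scale (k + l) a = arr_scale k a + arr_scale l a"
    "arr_scale k (arr_scale l a) = arr_scale (k * l) a"
    "arr_scale 1 a = a" "arr_scale 0 a = 0" "arr_scale k 0 = 0"
    "arr_scale k a * b = arr_scale k (a * b)" "a * arr_scale k b = arr_scale k (a * b)"
    unfolding ab arr_tab by (cases S; cases T; simp add: algebra_simps)+
qed

lemma arr_scale_sum: "arr_scale k (sum f A) = (\<Sum>x\<in>A. arr_scale k (f x))"
  by (induction A rule: infinite_finite_induct)
    (simp_all add: arr_scale_add_right arr_scale_zero_right)


section \<open>Finite bisets\<close>

lemma finite_bisetD:
  assumes "finite_biset G M"
  shows "finite (pts M)"
    and "m \<in> pts M \<Longrightarrow> lact M \<one>\<^bsub>G\<^esub> m = m" "m \<in> pts M \<Longrightarrow> ract M m \<one>\<^bsub>G\<^esub> = m"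
    and "g \<in> carrier G \<Longrightarrow> m \<in> pts M \<Longrightarrow> lact M g m \<in> pts M"
    and "g \<in> carrier G \<Longrightarrow> m \<in> pts M \<Longrightarrow> ract M m g \<in> pts M"
    and "g \<in> carrier G \<Longrightarrow> h \<in> carrier G \<Longrightarrow> m \<in> pts M \<Longrightarrow>
      lact M (g \<otimes>\<^bsub>G\<^esub> h) m = lact M g (lact M h m)"
    and "g \<in> carrier G \<Longrightarrow> h \<in> carrier G \<Longrightarrow> m \<in> pts M \<Longrightarrow>
      ract M m (g \<otimes>\<^bsub>G\<^esub> h) = ract M (ract M m g) h"
    and "g \<in> carrier G \<Longrightarrow> h \<in> carrier G \<Longrightarrow> m \<in> pts M \<Longrightarrow>
      ract M (lact M g m) h = lact M g (ract M m h)"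
  using assms unfolding finite_biset_def by blast+

lemma biset_isoI:
  assumes "bij_betw f (pts M) (pts N)"
    and "\<And>g m. g \<in> carrier G \<Longrightarrow> m \<in> pts M \<Longrightarrow> f (lact M g m) = lact N g (f m)"
    and "\<And>g m. g \<in> carrier G \<Longrightarrow> m \<in> pts M \<Longrightarrow> f (ract M m g) = ract N (f m) g"
  shows "biset_iso G M N"
  using assms unfolding biset_iso_def by blast

lemma biset_iso_refl: "biset_iso G M M"
  by (rule biset_isoI[where f = id]) auto

lemma biset_iso_sym:
  assumes "finite_biset G M" "biset_iso G M N"
  shows "biset_iso G N M"
proof -
  note M = finite_bisetD[OF assms(1)]
  obtain f where bij: "bij_betw f (pts M) (pts N)"
    and l: "\<And>g m. g \<in> carrier G \<Longrightarrow> m \<in> pts M \<Longrightarrow> f (lact M g m) = lact N g (f m)"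
    and r: "\<And>g m. g \<in> carrier G \<Longrightarrow> m \<in> pts M \<Longrightarrow> f (ract M m g) = ract N (f m) g"
    using assms(2) unfolding biset_iso_def by blast
  let ?f' = "inv_into (pts M) f"
  have mem: "?f' n \<in> pts M" and ff': "f (?f' n) = n" if "n \<in> pts N" for n
    using that bij by (auto simp: bij_betw_def inv_into_into f_inv_into_f)
  have f'f: "?f' (f m) = m" if "m \<in> pts M" for m
    using that bij by (auto simp: bij_betw_def)
  show ?thesis
  proof (rule biset_isoI)
    show "bij_betw ?f' (pts N) (pts M)" by (rule bij_betw_inv_into[OF bij])
    fix g n assume g: "g \<in> carrier G" and n: "n \<in> pts N"
    have "?f' (lact N g n) = ?f' (f (lact M g (?f' n)))"
      using l[OF g mem[OF n]] ff'[OF n] by simp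
    then show "?f' (lact N g n) = lact M g (?f' n)" using f'f M(4)[OF g mem[OF n]] by simp
    have "?f' (ract N n g) = ?f' (f (ract M (?f' n) g))"
      using r[OF g mem[OF n]] ff'[OF n] by simp
    then show "?f' (ract N n g) = ract M (?f' n) g" using f'f M(5)[OF g mem[OF n]] by simp
  qed
qed

lemma biset_iso_trans:
  assumes "biset_iso G L M" "biset_iso G M N"
  shows "biset_iso G L N"
proof -
  obtain f where bij: "bij_betw f (pts L) (pts M)"
    and f: "\<And>g m. g \<in> carrier G \<Longrightarrow> m \<in> pts L \<Longrightarrow> f (lact L g m) = lact M g (f m)"
      "\<And>g m. g \<in> carrier G \<Longrightarrow> m \<in> pts L \<Longrightarrow> f (ract L m g) = ract M (f m) g"
    using assms(1) unfolding biset_iso_def by blast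
  obtain f' where bij': "bij_betw f' (pts M) (pts N)"
    and f': "\<And>g m. g \<in> carrier G \<Longrightarrow> m \<in> pts M \<Longrightarrow> f' (lact M g m) = lact N g (f' m)"
      "\<And>g m. g \<in> carrier G \<Longrightarrow> m \<in> pts M \<Longrightarrow> f' (ract M m g) = ract N (f' m) g"
    using assms(2) unfolding biset_iso_def by blast
  show ?thesis
    by (rule biset_isoI[where f = "f' \<circ> f"])
      (use bij bij' f f' in \<open>auto intro: bij_betw_trans simp: bij_betwE\<close>)
qed

text \<open>Transport of structure along an enumeration of the points. Isomorphism classes contain
  only bisets on natural numbers, whereas tensor products and coset bisets live on other
  types.\<close>

lemma exists_nat_copy:
  assumes "finite_biset G M"
  shows "\<exists>N :: ('g, nat) biset. finite_biset G N \<and> biset_iso G M N"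
proof -
  note M = finite_bisetD[OF assms]
  obtain f :: "_ \<Rightarrow> nat" where bij: "bij_betw f (pts M) {0..<card (pts M)}"
    using ex_bij_betw_finite_nat[OF M(1)] by blast
  let ?f' = "inv_into (pts M) f"
  define N :: "('g, nat) biset" where
    "N = \<lparr>pts = {0..<card (pts M)}, lact = (\<lambda>g k. f (lact M g (?f' k))),
      ract = (\<lambda>k g. f (ract M (?f' k) g))\<rparr>"
  have f'f: "?f' (f m) = m" if "m \<in> pts M" for m
    using that bij by (auto simp: bij_betw_def)
  have pts: "pts N = f ` pts M" using bij by (simp add: N_def bij_betw_def)
  have act: "lact N g (f m) = f (lact M g m)" "ract N (f m) g = f (ract M m g)"
    if "m \<in> pts M" for g m
    using f'f[OF that] by (simp_all add: N_def)
  have "finite_biset G N"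
    unfolding finite_biset_def pts using M by (auto simp: act)
  moreover have "biset_iso G M N"
    by (rule biset_isoI[where f = f]) (use bij act in \<open>auto simp: N_def\<close>)
  ultimately show ?thesis by blast
qed

lemma biset_class_eqI:
  assumes "finite_biset G M" "biset_iso G M N"
  shows "biset_class G M = biset_class G N"
  unfolding biset_class_def
  by (auto intro: biset_iso_trans[OF assms(2)] biset_iso_trans[OF biset_iso_sym[OF assms]])

lemma biset_class_in_classes:
  assumes "finite_biset G M"
  shows "biset_class G M \<in> biset_classes G"
proof -
  obtain N :: "('a, nat) biset" where "finite_biset G N" "biset_iso G M N"
    using exists_nat_copy[OF assms] by blast
  with biset_class_eqI[OF assms] show ?thesis unfolding biset_classes_def by blast
qed

lemma biset_classesE:
  fixes c :: "'g biset_class"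
  assumes "c \<in> biset_classes G"
  obtains M :: "('g, nat) biset" where "finite_biset G M" "c = biset_class G M"
  using assms unfolding biset_classes_def by blast

lemma finite_biset_sum:
  assumes "finite_biset G M" "finite_biset G N"
  shows "finite_biset G (biset_sum M N)"
  using finite_bisetD[OF assms(1)] finite_bisetD[OF assms(2)]
  unfolding finite_biset_def biset_sum_def by auto

lemma finite_biset_restrict:
  assumes "finite_biset G M" "X \<subseteq> pts M"
    and "\<And>g m. g \<in> carrier G \<Longrightarrow> m \<in> X \<Longrightarrow> lact M g m \<in> X \<and> ract M m g \<in> X"
  shows "finite_biset G (M\<lparr>pts := X\<rparr>)"
proof -
  have "finite X" using finite_subset[OF assms(2) finite_bisetD(1)[OF assms(1)]] .
  moreover have "m \<in> pts M" if "m \<in> X" for m using assms(2) that by blast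
  ultimately show ?thesis
    using finite_bisetD[OF assms(1)] assms(3) unfolding finite_biset_def by simp
qed

text \<open>With an orbit for \<open>X\<close> this splits a transitive biset off from
  \<open>M\<close>.\<close>

lemma biset_iso_sum_restrict:
  assumes "X \<subseteq> pts M"
  shows "biset_iso G (biset_sum (M\<lparr>pts := X\<rparr>) (M\<lparr>pts := pts M - X\<rparr>)) M"
proof (rule biset_isoI[where f = "case_sum id id"])
  show "bij_betw (case_sum id id) (pts (biset_sum (M\<lparr>pts := X\<rparr>) (M\<lparr>pts := pts M - X\<rparr>))) (pts M)"
    using assms by (auto simp: bij_betw_def inj_on_def biset_sum_def image_Un Plus_def image_image)
qed (auto simp: biset_sum_def)


subsection \<open>Point stabilisers\<close>

text \<open>The stabiliser of m under the action of G x G by (g, h) m = g m h^-1. In the form g m =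
  m h it is a relation on G, so that two stabilisers can be composed.\<close>

definition point_stab ::
  "('g, 'k) monoid_scheme \<Rightarrow> ('g, 'm) biset \<Rightarrow> 'm \<Rightarrow> ('g \<times> 'g) set" where
  "point_stab G M m = {(g, h). g \<in> carrier G \<and> h \<in> carrier G \<and> lact M g m = ract M m h}"

text \<open>Summation over points makes this additive on disjoint unions for every \<phi>. Only
  multiplicativity puts a condition on \<phi>.\<close>

definition stab_sum ::
  "('g, 'k) monoid_scheme \<Rightarrow> (('g \<times> 'g) set \<Rightarrow> 'v::comm_monoid_add) \<Rightarrow> ('g, 'm) biset \<Rightarrow> 'v" where
  "stab_sum G \<phi> M = (\<Sum>m\<in>pts M. \<phi> (point_stab G M m))"

lemma point_stab_image:
  assumes "finite_biset G M" "bij_betw f (pts M) (pts N)"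
    and "\<And>g m. g \<in> carrier G \<Longrightarrow> m \<in> pts M \<Longrightarrow> f (lact M g m) = lact N g (f m)"
    and "\<And>g m. g \<in> carrier G \<Longrightarrow> m \<in> pts M \<Longrightarrow> f (ract M m g) = ract N (f m) g"
    and m: "m \<in> pts M"
  shows "point_stab G N (f m) = point_stab G M m"
proof -
  have "lact N g (f m) = ract N (f m) h \<longleftrightarrow> lact M g m = ract M m h"
    if "g \<in> carrier G" "h \<in> carrier G" for g h
    using that m finite_bisetD(4,5)[OF assms(1)] assms(3,4) assms(2)
    by (metis bij_betw_def inj_on_eq_iff)
  then show ?thesis unfolding point_stab_def by auto
qed

lemma stab_sum_iso:
  assumes "finite_biset G M" "biset_iso G M N"
  shows "stab_sum G \<phi> M = stab_sum G \<phi> N"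
proof -
  obtain f where f: "bij_betw f (pts M) (pts N)"
     "\<And>g m. g \<in> carrier G \<Longrightarrow> m \<in> pts M \<Longrightarrow> f (lact M g m) = lact N g (f m)"
     "\<And>g m. g \<in> carrier G \<Longrightarrow> m \<in> pts M \<Longrightarrow> f (ract M m g) = ract N (f m) g"
    using assms(2) unfolding biset_iso_def by blast
  show ?thesis unfolding stab_sum_def sum.reindex_bij_betw[OF f(1), symmetric]
    using point_stab_image[OF assms(1) f] by (auto intro: sum.cong)
qed

lemma stab_sum_biset_sum:
  assumes "finite_biset G M" "finite_biset G N"
  shows "stab_sum G \<phi> (biset_sum M N) = stab_sum G \<phi> M + stab_sum G \<phi> N"
proof -
  have "point_stab G (biset_sum M N) (Inl m) = point_stab G M m" for m
    unfolding point_stab_def biset_sum_def by auto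
  moreover have "point_stab G (biset_sum M N) (Inr n) = point_stab G N n" for n
    unfolding point_stab_def biset_sum_def by auto
  ultimately show ?thesis
    using finite_bisetD(1)[OF assms(1)] finite_bisetD(1)[OF assms(2)]
    unfolding stab_sum_def by (simp add: biset_sum_def sum.Plus)
qed

context group
begin

lemma lact_inv_lact:
  assumes "finite_biset G M" "g \<in> carrier G" "m \<in> pts M"
  shows "lact M (inv g) (lact M g m) = m" "lact M g (lact M (inv g) m) = m"
  using finite_bisetD(2,6)[OF assms(1)] assms(2,3)
    by (metis inv_closed l_inv, metis inv_closed r_inv)

lemma ract_inv_ract:
  assumes "finite_biset G M" "g \<in> carrier G" "m \<in> pts M"
  shows "ract M (ract M m g) (inv g) = m" "ract M (ract M m (inv g)) g = m"
  using finite_bisetD(3,7)[OF assms(1)] assms(2,3)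
    by (metis inv_closed r_inv, metis inv_closed l_inv)

lemma subgroup_point_stab:
  assumes M: "finite_biset G M" and m: "m \<in> pts M"
  shows "subgroup (point_stab G M m) (G \<times>\<times> G)"
proof -
  note D = finite_bisetD[OF M]
  interpret GG: group "G \<times>\<times> G" by (rule DirProd_group) (rule is_group)+
  show ?thesis
  proof (rule GG.subgroupI)
    show "point_stab G M m \<subseteq> carrier (G \<times>\<times> G)" by (auto simp: point_stab_def)
    show "point_stab G M m \<noteq> {}"
      using D(2,3)[OF m] by (auto simp: point_stab_def intro!: exI[of _ \<one>])
  next
    fix x assume "x \<in> point_stab G M m"
    then obtain g h where x: "x = (g, h)" and gh: "g \<in> carrier G" "h \<in> carrier G"
      and e: "lact M g m = ract M m h" by (auto simp: point_stab_def)
    have "lact M (inv g) (ract M (ract M m h) (inv h)) = lact M (inv g) (lact M g (ract M m (inv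
      h)))"
      using D(8)[of g "inv h" m] e gh m by simp
    then have "lact M (inv g) m = ract M m (inv h)"
      using lact_inv_lact(1)[OF M gh(1)] ract_inv_ract(1)[OF M gh(2)] D(5) gh m by simp
    then show "inv\<^bsub>G \<times>\<times> G\<^esub> x \<in> point_stab G M m"
      using gh by (auto simp: x point_stab_def inv_DirProd[OF is_group is_group])
  next
    fix x y assume "x \<in> point_stab G M m" "y \<in> point_stab G M m"
    then obtain g h g' h' where x: "x = (g, h)" "y = (g', h')"
      and gh: "g \<in> carrier G" "h \<in> carrier G" "g' \<in> carrier G" "h' \<in> carrier G"
      and e: "lact M g m = ract M m h" "lact M g' m = ract M m h'" by (auto simp: point_stab_def)
    have "lact M (g \<otimes> g') m = ract M m (h \<otimes> h')"
      using D(6,7,8) gh m e by (metis)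
    then show "x \<otimes>\<^bsub>G \<times>\<times> G\<^esub> y \<in> point_stab G M m"
      using gh by (auto simp: x point_stab_def)
  qed
qed

text \<open>The conjugate of \<open>U\<close> by (g, 1).\<close>

definition left_conj :: "'a \<Rightarrow> ('a \<times> 'a) set \<Rightarrow> ('a \<times> 'a) set" where
  "left_conj g U = {(a, b). a \<in> carrier G \<and> (inv g \<otimes> a \<otimes> g, b) \<in> U}"

lemma point_stab_lact:
  assumes M: "finite_biset G M" and m: "m \<in> pts M" and g: "g \<in> carrier G"
  shows "point_stab G M (lact M g m) = left_conj g (point_stab G M m)"
proof -
  note D = finite_bisetD[OF M]
  have "lact M a (lact M g m) = ract M (lact M g m) b \<longleftrightarrow> lact M (inv g \<otimes> a \<otimes> g) m = ract M m b"
    if a: "a \<in> carrier G" and b: "b \<in> carrier G" for a b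
  proof -
    have 1: "ract M (lact M g m) b = lact M g (ract M m b)" using D(8) g m b by simp
    have 2: "lact M (inv g \<otimes> a \<otimes> g) m = lact M (inv g) (lact M a (lact M g m))"
      using D(4,6) a g m by simp
    show ?thesis unfolding 1 2
      using lact_inv_lact[OF M g] D(4,5) a b g m by metis
  qed
  then show ?thesis using g by (auto simp: point_stab_def left_conj_def)
qed

end


subsection \<open>Tensor products\<close>

definition tensor_orbit ::
  "('g, 'k) monoid_scheme \<Rightarrow> ('g, 'm) biset \<Rightarrow> ('g, 'n) biset \<Rightarrow> 'm \<times> 'n \<Rightarrow> ('m \<times> 'n) set" where
  "tensor_orbit G M N p = (\<lambda>g. (ract M (fst p) (inv\<^bsub>G\<^esub> g), lact N g (snd p))) ` carrier G"

lemma pts_biset_tensor: "pts (biset_tensor G M N) = tensor_orbit G M N ` (pts M \<times> pts N)"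
  by (force simp: biset_tensor_def orbits_def orbit_def tensor_orbit_def)

text \<open>If \<open>U\<close> and \<open>V\<close> are the stabilisers of m and n, this is the
  stabiliser of the pair (m, n) under the action (m h^-1, h n) whose orbits form the tensor
  product.\<close>

definition mid_kernel ::
  "('g, 'k) monoid_scheme \<Rightarrow> ('g \<times> 'g) set \<Rightarrow> ('g \<times> 'g) set \<Rightarrow> 'g set" where
  "mid_kernel G U V = {h \<in> carrier G. (\<one>\<^bsub>G\<^esub>, h) \<in> U \<and> (h, \<one>\<^bsub>G\<^esub>) \<in> V}"

locale biset_pair = group G for G (structure) +
  fixes M :: "('a, 'm) biset" and N :: "('a, 'n) biset"
  assumes finite_carrier: "finite (carrier G)"
    and finite_M: "finite_biset G M" and finite_N: "finite_biset G N"
begin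

lemmas M = finite_bisetD[OF finite_M] and N = finite_bisetD[OF finite_N]

definition act :: "'a \<Rightarrow> 'm \<times> 'n \<Rightarrow> 'm \<times> 'n" where
  "act g p = (ract M (fst p) (inv g), lact N g (snd p))"

abbreviation "P \<equiv> pts M \<times> pts N"
abbreviation "orb \<equiv> tensor_orbit G M N"

lemma orb_def: "orb p = (\<lambda>g. act g p) ` carrier G"
  by (simp add: tensor_orbit_def act_def)

lemma act_closed: "g \<in> carrier G \<Longrightarrow> p \<in> P \<Longrightarrow> act g p \<in> P"
  using M(5) N(4) by (auto simp: act_def)

lemma act_one: "p \<in> P \<Longrightarrow> act \<one> p = p"
  using M(3) N(2) by (auto simp: act_def)

lemma act_mult: "g \<in> carrier G \<Longrightarrow> h \<in> carrier G \<Longrightarrow> p \<in> P \<Longrightarrow> act (g \<otimes> h) p = act g (act h p)"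
  using M(7) N(6) by (auto simp: act_def inv_mult_group)

lemma act_inv_act: "g \<in> carrier G \<Longrightarrow> p \<in> P \<Longrightarrow> act (inv g) (act g p) = p"
  using act_mult[of "inv g" g p] act_one by simp

lemma orb_self: "p \<in> P \<Longrightarrow> p \<in> orb p"
  unfolding orb_def using act_one[of p] by (metis imageI one_closed)

lemma orb_subset: "p \<in> P \<Longrightarrow> orb p \<subseteq> P"
  unfolding orb_def using act_closed by blast

lemma orb_act:
  assumes g: "g \<in> carrier G" and p: "p \<in> P"
  shows "orb (act g p) = orb p"
proof
  show "orb (act g p) \<subseteq> orb p"
  proof
    fix q assume "q \<in> orb (act g p)"
    then obtain h where h: "h \<in> carrier G" "q = act h (act g p)" unfolding orb_def by blast
    then have "q = act (h \<otimes> g) p" using act_mult[OF h(1) g p] by simp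
    then show "q \<in> orb p" unfolding orb_def using h g by blast
  qed
  show "orb p \<subseteq> orb (act g p)"
  proof
    fix q assume "q \<in> orb p"
    then obtain h where h: "h \<in> carrier G" "q = act h p" unfolding orb_def by blast
    have "q = act (h \<otimes> inv g) (act g p)"
      using h g p act_mult[of h "inv g" "act g p"] act_inv_act act_closed by simp
    then show "q \<in> orb (act g p)" unfolding orb_def using h g by blast
  qed
qed

lemma orb_eqI:
  assumes "q \<in> orb p" "p \<in> P"
  shows "orb q = orb p"
proof -
  obtain g where "g \<in> carrier G" "q = act g p" using assms(1) unfolding orb_def by blast
  then show ?thesis using orb_act assms(2) by simp
qed

lemma orb_eq_iff:
  assumes "p \<in> P" "q \<in> P"
  shows "orb q = orb p \<longleftrightarrow> (\<exists>g\<in>carrier G. q = act g p)"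
proof
  assume "orb q = orb p"
  then have "q \<in> orb p" using orb_self[OF assms(2)] by simp
  then show "\<exists>g\<in>carrier G. q = act g p" unfolding orb_def by blast
qed (use orb_act assms(1) in auto)

abbreviation "T \<equiv> biset_tensor G M N"

lemma pts_T: "pts T = orb ` P" by (rule pts_biset_tensor)

text \<open>The outer left action commutes with the middle action, so an orbit is moved by moving
  any representative; \<open>ract_T\<close> is the mirror image.\<close>

lemma lact_T:
  assumes "h \<in> carrier G" "p \<in> P"
  shows "lact T h (orb p) = orb (lact M h (fst p), snd p)"
  using assms M(5,8) by (auto simp: biset_tensor_def orb_def act_def image_image intro!: image_cong)

lemma ract_T:
  assumes "h \<in> carrier G" "p \<in> P"
  shows "ract T (orb p) h = orb (fst p, ract N (snd p) h)"
  using assms N(4,8) by (auto simp: biset_tensor_def orb_def act_def image_image intro!: image_cong)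

lemma finite_biset_T: "finite_biset G T"
  unfolding finite_biset_def pts_T
  using M N by (auto simp: lact_T ract_T)

text \<open>The orbit of (m, n) satisfies a [m, n] = [m, n] b exactly if some element of the middle
  action carries (m, n b) to (a m, n). After inverting that element h this says a m = m h and h n =
  n b, which is relational composition through h.\<close>

lemma point_stab_T:
  assumes p: "p \<in> P"
  shows "point_stab G T (orb p) = point_stab G M (fst p) O point_stab G N (snd p)"
proof -
  obtain m n where mn: "p = (m, n)" "m \<in> pts M" "n \<in> pts N" using p by auto
  have "lact T a (orb p) = ract T (orb p) b \<longleftrightarrow>
      (\<exists>h\<in>carrier G. lact M a m = ract M m h \<and> lact N h n = ract N n b)" (is "?L \<longleftrightarrow> ?R")
    if a: "a \<in> carrier G" and b: "b \<in> carrier G" for a b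
  proof -
    have "?L \<longleftrightarrow> (\<exists>h\<in>carrier G. (lact M a m, n) = act h (m, ract N n b))"
      using orb_eq_iff[of "(m, ract N n b)" "(lact M a m, n)"] a b M(4) N(5) p
      by (simp add: lact_T ract_T mn)
    also have "\<dots> \<longleftrightarrow> (\<exists>h\<in>carrier G. lact M a m = ract M m (inv h) \<and> n = lact N h (ract N n b))"
      by (simp add: act_def)
    also have "\<dots> \<longleftrightarrow> (\<exists>h\<in>carrier G. lact M a m = ract M m h \<and> n = lact N (inv h) (ract N n b))"
      by (metis inv_closed inv_inv)
    also have "\<dots> \<longleftrightarrow> ?R"
      using lact_inv_lact[OF finite_N] N(5)[OF b mn(3)] mn(3) by metis
    finally show ?thesis .
  qed
  then show ?thesis by (auto simp: point_stab_def mn)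
qed

text \<open>Orbit-stabiliser theorem for the middle action.\<close>

lemma card_orb:
  assumes p: "p \<in> P"
  shows "card (orb p) * card (mid_kernel G (point_stab G M (fst p)) (point_stab G N (snd p)))
    = order G"
proof -
  \<comment> \<open>All nonempty fibres of the map from h to h p are left translates of the
    stabiliser of p.\<close>
  have fib: "bij_betw (\<lambda>h. g \<otimes> h) {h \<in> carrier G. act h p = p} {h \<in> carrier G. act h p = act g p}"
    if g: "g \<in> carrier G" for g
  proof (rule bij_betwI[where g = "\<lambda>h. inv g \<otimes> h"])
    show "(\<lambda>h. g \<otimes> h) \<in> {h \<in> carrier G. act h p = p} \<rightarrow> {h \<in> carrier G. act h p = act g p}"
      using g act_mult[OF g _ p] by auto
    show "(\<lambda>h. inv g \<otimes> h) \<in> {h \<in> carrier G. act h p = act g p} \<rightarrow> {h \<in> carrier G. act h p = p}"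
      using g act_mult[OF inv_closed[OF g] _ p] act_inv_act[OF g p] by auto
  qed (use g in \<open>auto simp: m_assoc[symmetric]\<close>)
  have ker: "mid_kernel G (point_stab G M (fst p)) (point_stab G N (snd p))
      = {h \<in> carrier G. act h p = p}"
  proof -
    have "act h p = p \<longleftrightarrow> fst p = ract M (fst p) h \<and> lact N h (snd p) = snd p"
      if "h \<in> carrier G" for h
      using ract_inv_ract[OF finite_M that, of "fst p"] p
      by (auto simp: act_def prod_eq_iff)
    then show ?thesis using M(2) N(3) p
      by (auto simp: mid_kernel_def point_stab_def)
  qed
  have "order G = (\<Sum>q\<in>orb p. card {h \<in> carrier G. act h p = q})"
    unfolding order_def orb_def
    by (subst card_eq_sum, subst sum.image_gen[OF finite_carrier, of _ "\<lambda>h. act h p"]) simp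
  also have "\<dots> = (\<Sum>q\<in>orb p. card {h \<in> carrier G. act h p = p})"
  proof (rule sum.cong[OF refl])
    fix q assume "q \<in> orb p"
    then obtain g where "g \<in> carrier G" "q = act g p" unfolding orb_def by blast
    then show "card {h \<in> carrier G. act h p = q} = card {h \<in> carrier G. act h p = p}"
      using bij_betw_same_card[OF fib] by simp
  qed
  finally show ?thesis by (simp add: ker)
qed

end

section \<open>Multiplicativity of stabiliser sums\<close>

lemma sum_arr_scale_const: "(\<Sum>x\<in>A. arr_scale k a) = arr_scale (of_nat (card A) * k) a"
  by (induction A rule: infinite_finite_induct)
    (simp_all add: arr_scale_zero_left arr_scale_add_left[symmetric] algebra_simps)

text \<open>
  The factor \<open>card (mid_kernel G U V) / order G\<close> is the reciprocal of the length of a \<open>G\<close>-orbit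
  on pairs of points with stabilisers \<open>U\<close> and \<open>V\<close>. Averaging over the left action on the second
  point turns the compatibility required of \<open>\<phi>\<close> into the Mackey formula.
\<close>

lemma (in biset_pair) stab_sum_tensor:
  fixes \<phi> :: "('a \<times> 'a) set \<Rightarrow> arr"
  assumes \<phi>: "\<And>U V. subgroup U (G \<times>\<times> G) \<Longrightarrow> subgroup V (G \<times>\<times> G) \<Longrightarrow>
    (\<Sum>g\<in>carrier G. arr_scale (of_nat (card (mid_kernel G U (left_conj g V))))
       (\<phi> (U O left_conj g V))) = arr_scale (of_nat (order G) ^ 2) (\<phi> U * \<phi> V)"
  shows "stab_sum G \<phi> (biset_tensor G M N) = stab_sum G \<phi> M * stab_sum G \<phi> N"
proof -
  let ?S = "point_stab G M" and ?S' = "point_stab G N"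
  define F where "F m n = arr_scale (of_nat (card (mid_kernel G (?S m) (?S' n))) / of_nat (order G))
    (\<phi> (?S m O ?S' n))" for m n
  have ord: "order G > 0" using finite_carrier order_gt_0_iff_finite by blast
  have fin: "finite P" using M(1) N(1) by simp
  \<comment> \<open>All pairs in one orbit have the same composite stabiliser, and \<open>F\<close>
    divides its weight equally among them.\<close>
  have "(\<Sum>q\<in>{q \<in> P. orb q = X}. F (fst q) (snd q)) = \<phi> (point_stab G T X)" if X: "X \<in> pts T" for X
  proof -
    obtain p where p: "p \<in> P" "X = orb p" using X pts_T by auto
    have mem: "q \<in> P \<and> orb q = X \<longleftrightarrow> q \<in> X" for q
      using p orb_self orb_eqI orb_subset by blast
    have cX: "card X > 0" using card_orb[OF p(1)] ord p(2) by (metis mult_0 neq0_conv)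
    have "F (fst q) (snd q) = arr_scale (1 / of_nat (card X)) (\<phi> (point_stab G T X))"
      if "q \<in> X" for q
    proof -
      have q: "q \<in> P" "orb q = X" using mem[of q] that by blast+
      have "of_nat (card X) * of_nat (card (mid_kernel G (?S (fst q)) (?S' (snd q))))
          = (of_nat (order G) :: rat)"
        using card_orb[OF q(1)] q(2) by (metis of_nat_mult)
      then have "of_nat (card (mid_kernel G (?S (fst q)) (?S' (snd q)))) / of_nat (order G)
          = (1 / of_nat (card X) :: rat)"
        using cX ord by (simp add: field_simps)
      then show ?thesis using point_stab_T[OF q(1)] q(2) by (simp add: F_def)
    qed
    then have "(\<Sum>q\<in>{q \<in> P. orb q = X}. F (fst q) (snd q))
        = (\<Sum>q\<in>X. arr_scale (1 / of_nat (card X)) (\<phi> (point_stab G T X)))"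
      by (intro sum.cong) (use mem in auto)
    also have "\<dots> = \<phi> (point_stab G T X)"
      using cX by (simp add: sum_arr_scale_const arr_scale_one del: sum_constant)
    finally show ?thesis .
  qed
  then have "stab_sum G \<phi> T = (\<Sum>X\<in>orb ` P. \<Sum>q\<in>{q \<in> P. orb q = X}. F (fst q) (snd q))"
    unfolding stab_sum_def pts_T by simp
  also have "\<dots> = (\<Sum>q\<in>P. F (fst q) (snd q))"
    by (rule sum.image_gen[OF fin, symmetric])
  also have "\<dots> = (\<Sum>m\<in>pts M. \<Sum>n\<in>pts N. F m n)"
    by (simp add: sum.cartesian_product split_def)
  also have "\<dots> = (\<Sum>m\<in>pts M. \<Sum>n\<in>pts N. \<phi> (?S m) * \<phi> (?S' n))"
  proof (rule sum.cong[OF refl])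
    fix m assume m: "m \<in> pts M"
    \<comment> \<open>Left translation permutes the points of \<open>N\<close>, so replacing n by g
      n and averaging over g does not change the sum over n.\<close>
    have bij: "bij_betw (lact N g) (pts N) (pts N)" if g: "g \<in> carrier G" for g
      by (rule bij_betwI[where g = "lact N (inv g)"])
        (use g N(4) lact_inv_lact[OF finite_N g] in auto)
    have "(\<Sum>n\<in>pts N. F m n) = (\<Sum>n\<in>pts N. \<Sum>g\<in>carrier G. arr_scale (1 / of_nat (order G)) (F m (lact
      N g n)))"
    proof -
      have "(\<Sum>n\<in>pts N. \<Sum>g\<in>carrier G. arr_scale (1 / of_nat (order G)) (F m (lact N g n)))
        = (\<Sum>g\<in>carrier G. arr_scale (1 / of_nat (order G)) (\<Sum>n\<in>pts N. F m (lact N g n)))"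
        by (subst sum.swap) (simp add: arr_scale_sum)
      also have "\<dots> = (\<Sum>g\<in>carrier G. arr_scale (1 / of_nat (order G)) (\<Sum>n\<in>pts N. F m n))"
        by (intro sum.cong refl arg_cong[of _ _ "arr_scale _"] sum.reindex_bij_betw bij)
      also have "\<dots> = (\<Sum>n\<in>pts N. F m n)"
        using ord by (simp add: sum_arr_scale_const arr_scale_one order_def del: sum_constant)
      finally show ?thesis by simp
    qed
    also have "\<dots> = (\<Sum>n\<in>pts N. \<phi> (?S m) * \<phi> (?S' n))"
    proof (rule sum.cong[OF refl])
      fix n assume n: "n \<in> pts N"
      \<comment> \<open>One factor 1/|G| comes from the averaging, the other from \<open>F\<close>;
        together they cancel the square of the group order in the hypothesis on \<phi>.\<close>
      have "(\<Sum>g\<in>carrier G. arr_scale (1 / of_nat (order G)) (F m (lact N g n)))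
        = arr_scale (1 / of_nat (order G) ^ 2)
            (\<Sum>g\<in>carrier G. arr_scale (of_nat (card (mid_kernel G (?S m) (left_conj g (?S' n)))))
              (\<phi> (?S m O left_conj g (?S' n))))"
        by (simp add: arr_scale_sum F_def arr_scale_scale point_stab_lact[OF finite_N n]
          power2_eq_square cong: sum.cong)
      also have "\<dots> = \<phi> (?S m) * \<phi> (?S' n)"
        using ord
        by (simp add: \<phi>[OF subgroup_point_stab[OF finite_M m] subgroup_point_stab[OF finite_N n]]
          arr_scale_scale arr_scale_one)
      finally show "(\<Sum>g\<in>carrier G. arr_scale (1 / of_nat (order G)) (F m (lact N g n)))
        = \<phi> (?S m) * \<phi> (?S' n)" .
    qed
    finally show "(\<Sum>n\<in>pts N. F m n) = (\<Sum>n\<in>pts N. \<phi> (?S m) * \<phi> (?S' n))" .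
  qed
  also have "\<dots> = stab_sum G \<phi> M * stab_sum G \<phi> N"
    by (simp add: stab_sum_def sum_product)
  finally show ?thesis .
qed


section \<open>Tensor products of isomorphism classes\<close>

context group
begin

text \<open>The product of the two isomorphisms commutes with the middle action, so its direct image
  maps orbits to orbits. It is injective there because direct images under an injection are
  injective on subsets.\<close>

lemma biset_iso_tensor:
  assumes fin: "finite (carrier G)"
    and M: "finite_biset G M" "finite_biset G M'" "biset_iso G M M'"
    and N: "finite_biset G N" "finite_biset G N'" "biset_iso G N N'"
  shows "biset_iso G (biset_tensor G M N) (biset_tensor G M' N')"
proof -
  interpret A: biset_pair G M N by unfold_locales (fact fin M(1) N(1))+
  interpret B: biset_pair G M' N' by unfold_locales (fact fin M(2) N(2))+
  obtain f where f: "bij_betw f (pts M) (pts M')"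
      "\<And>g m. g \<in> carrier G \<Longrightarrow> m \<in> pts M \<Longrightarrow> f (lact M g m) = lact M' g (f m)"
      "\<And>g m. g \<in> carrier G \<Longrightarrow> m \<in> pts M \<Longrightarrow> f (ract M m g) = ract M' (f m) g"
    using M(3) unfolding biset_iso_def by blast
  obtain f' where f': "bij_betw f' (pts N) (pts N')"
      "\<And>g m. g \<in> carrier G \<Longrightarrow> m \<in> pts N \<Longrightarrow> f' (lact N g m) = lact N' g (f' m)"
      "\<And>g m. g \<in> carrier G \<Longrightarrow> m \<in> pts N \<Longrightarrow> f' (ract N m g) = ract N' (f' m) g"
    using N(3) unfolding biset_iso_def by blast
  let ?F = "map_prod f f'"
  have bij: "bij_betw ?F A.P B.P" using f(1) f'(1) by (rule bij_betw_map_prod)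
  have FP: "?F p \<in> B.P" if "p \<in> A.P" for p using bij_betwE[OF bij] that by blast
  have F_orb: "?F ` A.orb p = B.orb (?F p)" if "p \<in> A.P" for p
    using that f(3) f'(2) by (auto simp: A.orb_def B.orb_def A.act_def B.act_def image_image
        intro!: image_cong)
  show ?thesis
  proof (rule biset_isoI[where f = "(`) ?F"])
    show "bij_betw ((`) ?F) (pts A.T) (pts B.T)"
      unfolding bij_betw_def A.pts_T B.pts_T
    proof
      show "inj_on ((`) ?F) (A.orb ` A.P)"
      proof (rule inj_on_subset[OF inj_on_image_Pow])
        show "inj_on ?F A.P" using bij by (simp add: bij_betw_def)
        show "A.orb ` A.P \<subseteq> Pow A.P" using A.orb_subset by blast
      qed
      have "(`) ?F ` A.orb ` A.P = (\<lambda>p. B.orb (?F p)) ` A.P"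
        unfolding image_image[of "(`) ?F"] by (rule image_cong[OF refl F_orb])
      also have "\<dots> = B.orb ` ?F ` A.P" by (simp only: image_image)
      finally show "(`) ?F ` A.orb ` A.P = B.orb ` B.P"
        using bij by (simp only: bij_betw_def)
    qed
    fix g X assume g: "g \<in> carrier G" and "X \<in> pts A.T"
    then obtain p where p: "p \<in> A.P" "X = A.orb p" using A.pts_T by auto
    note Fp = FP[OF p(1)]
    have mem: "(lact M g (fst p), snd p) \<in> A.P" "(fst p, ract N (snd p) g) \<in> A.P"
      using p(1) A.M(4)[OF g] A.N(5)[OF g] by auto
    show "?F ` lact A.T g X = lact B.T g (?F ` X)"
      unfolding p(2) A.lact_T[OF g p(1)] F_orb[OF p(1)] B.lact_T[OF g Fp] F_orb[OF mem(1)]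
      using p(1) f(2)[OF g, of "fst p"] by auto
    show "?F ` ract A.T X g = ract B.T (?F ` X) g"
      unfolding p(2) A.ract_T[OF g p(1)] F_orb[OF p(1)] B.ract_T[OF g Fp] F_orb[OF mem(2)]
      using p(1) f'(3)[OF g, of "snd p"] by auto
  qed
qed

text \<open>\<open>class_tensor\<close> is a union over all pairs of representatives. By isomorphism
  invariance every pair contributes the same class, and the pair \<open>M\<close>, \<open>N\<close>
  itself occurs.\<close>

lemma class_tensor_class:
  fixes M N :: "('a, nat) biset"
  assumes fin: "finite (carrier G)" and M: "finite_biset G M" and N: "finite_biset G N"
  shows "class_tensor G (biset_class G M) (biset_class G N) = biset_class G (biset_tensor G M N)"
proof -
  have "biset_class G (biset_tensor G M' N') = biset_class G (biset_tensor G M N)"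
    if "M' \<in> biset_class G M" "N' \<in> biset_class G N" for M' N'
  proof -
    have *: "finite_biset G M'" "biset_iso G M M'" "finite_biset G N'" "biset_iso G N N'"
      using that by (auto simp: biset_class_def)
    interpret A: biset_pair G M N by unfold_locales (fact fin M N)+
    show ?thesis
      using biset_class_eqI[OF A.finite_biset_T biset_iso_tensor[OF fin M *(1,2) N *(3,4)]] by simp
  qed
  moreover have "M \<in> biset_class G M" "N \<in> biset_class G N"
    using M N by (auto simp: biset_class_def biset_iso_refl)
  ultimately show ?thesis unfolding class_tensor_def by blast
qed

lemma class_tensor_closed:
  assumes "finite (carrier G)" "a \<in> biset_classes G" "b \<in> biset_classes G"
  shows "class_tensor G a b \<in> biset_classes G"
proof -
  obtain M N :: "('a, nat) biset" where MN: "finite_biset G M" "a = biset_class G M"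
    "finite_biset G N" "b = biset_class G N" using assms(2,3) by (elim biset_classesE) blast
  interpret A: biset_pair G M N by unfold_locales (fact assms(1) MN)+
  show ?thesis
    using class_tensor_class[OF assms(1) MN(1,3)] biset_class_in_classes[OF A.finite_biset_T] MN
    by simp
qed

end


subsection \<open>Transitive bisets\<close>

definition two_sided_orbit :: "('g, 'k) monoid_scheme \<Rightarrow> ('g, 'm) biset \<Rightarrow> 'm \<Rightarrow> 'm set" where
  "two_sided_orbit G M m = {ract M (lact M g m) h | g h. g \<in> carrier G \<and> h \<in> carrier G}"

text \<open>The pair \<open>(g, h)\<close> acts on a right coset by multiplication with \<open>(g\<inverse>, h)\<close> from the right.\<close>

definition coset_biset ::
  "('g, 'k) monoid_scheme \<Rightarrow> ('g \<times> 'g) set \<Rightarrow> ('g, ('g \<times> 'g) set) biset" where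
  "coset_biset G U = \<lparr>pts = rcosets\<^bsub>G \<times>\<times> G\<^esub> U,
     lact = (\<lambda>g X. X #>\<^bsub>G \<times>\<times> G\<^esub> (inv\<^bsub>G\<^esub> g, \<one>\<^bsub>G\<^esub>)),
     ract = (\<lambda>X h. X #>\<^bsub>G \<times>\<times> G\<^esub> (\<one>\<^bsub>G\<^esub>, h))\<rparr>"

context group
begin

lemma group_square: "group (G \<times>\<times> G)"
  by (rule DirProd_group) (rule is_group)+

lemma coset_biset_simps:
  assumes U: "subgroup U (G \<times>\<times> G)" and x: "x \<in> carrier (G \<times>\<times> G)"
  shows "g \<in> carrier G \<Longrightarrow>
      lact (coset_biset G U) g (U #>\<^bsub>G \<times>\<times> G\<^esub> x) = U #>\<^bsub>G \<times>\<times> G\<^esub> (x \<otimes>\<^bsub>G \<times>\<times> G\<^esub> (inv g, \<one>))"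
    and "h \<in> carrier G \<Longrightarrow>
      ract (coset_biset G U) (U #>\<^bsub>G \<times>\<times> G\<^esub> x) h = U #>\<^bsub>G \<times>\<times> G\<^esub> (x \<otimes>\<^bsub>G \<times>\<times> G\<^esub> (\<one>, h))"
  using group.coset_mult_assoc[OF group_square subgroup.subset[OF U] x]
  by (auto simp: coset_biset_def)

lemma finite_coset_biset:
  assumes fin: "finite (carrier G)" and U: "subgroup U (G \<times>\<times> G)"
  shows "finite_biset G (coset_biset G U)"
proof -
  have pts: "pts (coset_biset G U) = (\<lambda>x. U #>\<^bsub>G \<times>\<times> G\<^esub> x) ` carrier (G \<times>\<times> G)"
    by (auto simp: coset_biset_def RCOSETS_def)
  show ?thesis unfolding finite_biset_def pts
    using fin by (auto simp: coset_biset_simps[OF U] inv_mult_group m_assoc)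
qed

text \<open>The stabiliser of the coset U x is x^-1 U x. The two actions use different factors of G
  x G, so the cosets of x (a^-1, 1) and x (1, b) agree exactly if x (1, b) (a, 1) x^-1 = x (a, b)
  x^-1 lies in U.\<close>

lemma point_stab_coset_biset:
  assumes U: "subgroup U (G \<times>\<times> G)" and x: "x \<in> carrier (G \<times>\<times> G)"
  shows "point_stab G (coset_biset G U) (U #>\<^bsub>G \<times>\<times> G\<^esub> x) =
    {z \<in> carrier (G \<times>\<times> G). x \<otimes>\<^bsub>G \<times>\<times> G\<^esub> z \<otimes>\<^bsub>G \<times>\<times> G\<^esub> inv\<^bsub>G \<times>\<times> G\<^esub> x \<in> U}"
proof -
  interpret GG: group "G \<times>\<times> G" by (rule group_square)
  have "lact (coset_biset G U) a (U #>\<^bsub>G \<times>\<times> G\<^esub> x) = ract (coset_biset G U) (U #>\<^bsub>G \<times>\<times> G\<^esub> x) b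
      \<longleftrightarrow> x \<otimes>\<^bsub>G \<times>\<times> G\<^esub> (a, b) \<otimes>\<^bsub>G \<times>\<times> G\<^esub> inv\<^bsub>G \<times>\<times> G\<^esub> x \<in> U"
    if ab: "a \<in> carrier G" "b \<in> carrier G" for a b
  proof -
    let ?p = "x \<otimes>\<^bsub>G \<times>\<times> G\<^esub> (inv a, \<one>)" and ?q = "x \<otimes>\<^bsub>G \<times>\<times> G\<^esub> (\<one>, b)"
    have pq: "?p \<in> carrier (G \<times>\<times> G)" "?q \<in> carrier (G \<times>\<times> G)" using x ab by auto
    have "U #>\<^bsub>G \<times>\<times> G\<^esub> ?p = U #>\<^bsub>G \<times>\<times> G\<^esub> ?q \<longleftrightarrow> ?q \<otimes>\<^bsub>G \<times>\<times> G\<^esub> inv\<^bsub>G \<times>\<times> G\<^esub> ?p \<in> U"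
      using subgroup.rcos_module[OF U GG.is_group pq] GG.repr_independence[OF _ pq(1) U]
        GG.repr_independenceD[OF U pq(2)] by blast
    also have "?q \<otimes>\<^bsub>G \<times>\<times> G\<^esub> inv\<^bsub>G \<times>\<times> G\<^esub> ?p = x \<otimes>\<^bsub>G \<times>\<times> G\<^esub> (a, b) \<otimes>\<^bsub>G \<times>\<times> G\<^esub> inv\<^bsub>G \<times>\<times> G\<^esub> x"
      using x ab by (auto simp: inv_DirProd[OF is_group is_group] inv_mult_group m_assoc)
    finally show ?thesis using ab by (simp add: coset_biset_simps[OF U x])
  qed
  then show ?thesis by (auto simp: point_stab_def)
qed

text \<open>All |G|^2 / |U| cosets have conjugates of U as stabilisers, and \<phi> does not
  distinguish these. The resulting factor dictates how the weights have to be normalised.\<close>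

lemma stab_sum_coset_biset:
  fixes \<phi> :: "('a \<times> 'a) set \<Rightarrow> arr"
  assumes fin: "finite (carrier G)" and U: "subgroup U (G \<times>\<times> G)"
    and \<phi>: "\<And>x. x \<in> carrier (G \<times>\<times> G) \<Longrightarrow>
      \<phi> {z \<in> carrier (G \<times>\<times> G). x \<otimes>\<^bsub>G \<times>\<times> G\<^esub> z \<otimes>\<^bsub>G \<times>\<times> G\<^esub> inv\<^bsub>G \<times>\<times> G\<^esub> x \<in> U} = \<phi> U"
  shows "stab_sum G \<phi> (coset_biset G U) = arr_scale (of_nat (order G) ^ 2 / of_nat (card U)) (\<phi> U)"
proof -
  interpret GG: group "G \<times>\<times> G" by (rule group_square)
  have "stab_sum G \<phi> (coset_biset G U) = (\<Sum>X\<in>rcosets\<^bsub>G \<times>\<times> G\<^esub> U. arr_scale 1 (\<phi> U))"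
    unfolding stab_sum_def
  proof (rule sum.cong)
    show "pts (coset_biset G U) = rcosets\<^bsub>G \<times>\<times> G\<^esub> U" by (simp add: coset_biset_def)
    fix X assume "X \<in> rcosets\<^bsub>G \<times>\<times> G\<^esub> U"
    then obtain x where "x \<in> carrier (G \<times>\<times> G)" "X = U #>\<^bsub>G \<times>\<times> G\<^esub> x" unfolding RCOSETS_def by blast
    then show "\<phi> (point_stab G (coset_biset G U) X) = arr_scale 1 (\<phi> U)"
      using \<phi> by (simp only: point_stab_coset_biset[OF U] arr_scale_one)
  qed
  also have "\<dots> = arr_scale (of_nat (card (rcosets\<^bsub>G \<times>\<times> G\<^esub> U))) (\<phi> U)"
    by (simp add: sum_arr_scale_const del: sum_constant)
  also have "of_nat (card (rcosets\<^bsub>G \<times>\<times> G\<^esub> U)) = (of_nat (order G) ^ 2 / of_nat (card U) :: rat)"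
  proof -
    have "card (rcosets\<^bsub>G \<times>\<times> G\<^esub> U) * card U = order G ^ 2"
      using GG.lagrange[OF U] by (simp add: order_def card_cartesian_product power2_eq_square)
    moreover have "card U > 0"
      using subgroup.one_closed[OF U] finite_subset[OF subgroup.subset[OF U]] fin
      by (auto simp: card_gt_0_iff)
    ultimately show ?thesis by (simp add: field_simps flip: of_nat_mult of_nat_power)
  qed
  finally show ?thesis .
qed

lemma two_sided_orbit_act:
  assumes M: "finite_biset G M" and m: "m \<in> pts M" and g: "g \<in> carrier G"
    and n: "n \<in> two_sided_orbit G M m"
  shows "lact M g n \<in> two_sided_orbit G M m" "ract M n g \<in> two_sided_orbit G M m"
proof -
  note D = finite_bisetD[OF M]
  obtain a b where ab: "a \<in> carrier G" "b \<in> carrier G" "n = ract M (lact M a m) b"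
    using n unfolding two_sided_orbit_def by blast
  have "lact M g n = ract M (lact M (g \<otimes> a) m) b" "ract M n g = ract M (lact M a m) (b \<otimes> g)"
    using ab g m D(4-8) by auto
  then show "lact M g n \<in> two_sided_orbit G M m" "ract M n g \<in> two_sided_orbit G M m"
    using ab g unfolding two_sided_orbit_def by blast+
qed

lemma two_sided_orbit_subset:
  assumes "finite_biset G M" "m \<in> pts M"
  shows "two_sided_orbit G M m \<subseteq> pts M" "m \<in> two_sided_orbit G M m"
  using finite_bisetD[OF assms(1)] assms(2) unfolding two_sided_orbit_def
  by (auto intro!: exI[of _ \<one>])

text \<open>Orbit-stabiliser theorem for bisets: the coset of (a, b) goes to a^-1 m b. The
  equivalence \<open>stab\<close> gives both that the value does not depend on the representative,
  as \<open>THE\<close> requires, and that the map is injective.\<close>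

lemma coset_biset_iso_orbit:
  assumes M: "finite_biset G M" and m: "m \<in> pts M"
  shows "biset_iso G (coset_biset G (point_stab G M m)) (M\<lparr>pts := two_sided_orbit G M m\<rparr>)"
proof -
  note D = finite_bisetD[OF M]
  interpret GG: group "G \<times>\<times> G" by (rule group_square)
  let ?U = "point_stab G M m"
  note U = subgroup_point_stab[OF M m]
  define f where "f X = (THE n. \<exists>x\<in>X. n = ract M (lact M (inv (fst x)) m) (snd x))" for X
  have stab: "ract M (lact M (inv (fst y)) m) (snd y) = ract M (lact M (inv (fst x)) m) (snd x)
      \<longleftrightarrow> y \<in> ?U #>\<^bsub>G \<times>\<times> G\<^esub> x"
    if x: "x \<in> carrier (G \<times>\<times> G)" and y: "y \<in> carrier (G \<times>\<times> G)" for x y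
  proof -
    obtain a b c d where ab: "x = (a, b)" "y = (c, d)" "a \<in> carrier G" "b \<in> carrier G"
      "c \<in> carrier G" "d \<in> carrier G" using x y by auto
    have "y \<in> ?U #>\<^bsub>G \<times>\<times> G\<^esub> x \<longleftrightarrow> y \<otimes>\<^bsub>G \<times>\<times> G\<^esub> inv\<^bsub>G \<times>\<times> G\<^esub> x \<in> ?U"
      using subgroup.rcos_module[OF U GG.is_group x y] .
    also have "\<dots> \<longleftrightarrow> lact M (c \<otimes> inv a) m = ract M m (d \<otimes> inv b)"
      using ab by (auto simp: inv_DirProd[OF is_group is_group] point_stab_def)
    also have "\<dots> \<longleftrightarrow> lact M c (lact M (inv a) m) = ract M (ract M m d) (inv b)"
      using ab D(6,7) m by simp
    also have "\<dots> \<longleftrightarrow> lact M (inv a) m = lact M (inv c) (ract M (ract M m d) (inv b))"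
      using lact_inv_lact[OF M ab(5)] ab D(4,5) m by (metis inv_closed)
    also have "\<dots> \<longleftrightarrow> lact M (inv a) m = ract M (ract M (lact M (inv c) m) d) (inv b)"
      using ab D(4,5,8) m by simp
    also have "\<dots> \<longleftrightarrow> ract M (lact M (inv a) m) b = ract M (lact M (inv c) m) d"
      using ract_inv_ract[OF M ab(4)] ab D(4,5) m by (metis inv_closed)
    finally show ?thesis using ab by auto
  qed
  have f: "f (?U #>\<^bsub>G \<times>\<times> G\<^esub> x) = ract M (lact M (inv (fst x)) m) (snd x)"
    if x: "x \<in> carrier (G \<times>\<times> G)" for x
    unfolding f_def
  proof (rule the_equality)
    show "\<exists>y\<in>?U #>\<^bsub>G \<times>\<times> G\<^esub> x. ract M (lact M (inv (fst x)) m) (snd x)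
        = ract M (lact M (inv (fst y)) m) (snd y)"
      using GG.rcos_self[OF x U] by blast
    fix n assume "\<exists>y\<in>?U #>\<^bsub>G \<times>\<times> G\<^esub> x. n = ract M (lact M (inv (fst y)) m) (snd y)"
    then obtain y where y: "y \<in> ?U #>\<^bsub>G \<times>\<times> G\<^esub> x" "n = ract M (lact M (inv (fst y)) m) (snd y)"
      by blast
    then have "y \<in> carrier (G \<times>\<times> G)"
      using GG.r_coset_subset_G[OF subgroup.subset[OF U] x] by blast
    then show "n = ract M (lact M (inv (fst x)) m) (snd x)" using stab[OF x] y by simp
  qed
  have pts: "pts (coset_biset G ?U) = (\<lambda>x. ?U #>\<^bsub>G \<times>\<times> G\<^esub> x) ` carrier (G \<times>\<times> G)"
    by (auto simp: coset_biset_def RCOSETS_def)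
  show ?thesis
  proof (rule biset_isoI[where f = f])
    show "bij_betw f (pts (coset_biset G ?U)) (pts (M\<lparr>pts := two_sided_orbit G M m\<rparr>))"
      unfolding bij_betw_def
    proof
      show "inj_on f (pts (coset_biset G ?U))"
      proof (rule inj_onI)
        fix X Y assume "X \<in> pts (coset_biset G ?U)" "Y \<in> pts (coset_biset G ?U)" and e: "f X = f Y"
        then obtain x y where x: "x \<in> carrier (G \<times>\<times> G)" "X = ?U #>\<^bsub>G \<times>\<times> G\<^esub> x"
          and y: "y \<in> carrier (G \<times>\<times> G)" "Y = ?U #>\<^bsub>G \<times>\<times> G\<^esub> y" unfolding pts by blast
        have "x \<in> ?U #>\<^bsub>G \<times>\<times> G\<^esub> y" using stab[OF y(1) x(1)] e x y f by simp
        then show "X = Y" using GG.repr_independence[OF _ y(1) U] x y by simp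
      qed
      have "f ` pts (coset_biset G ?U)
          = (\<lambda>x. ract M (lact M (inv (fst x)) m) (snd x)) ` carrier (G \<times>\<times> G)"
        unfolding pts image_image using f by simp
      also have "\<dots> = two_sided_orbit G M m"
      proof -
        have "ract M (lact M g m) h \<in> (\<lambda>x. ract M (lact M (inv (fst x)) m) (snd x)) ` carrier (G
          \<times>\<times> G)"
          if "g \<in> carrier G" "h \<in> carrier G" for g h
          using that by (auto intro!: image_eqI[of _ _ "(inv g, h)"])
        then show ?thesis unfolding two_sided_orbit_def by fastforce
      qed
      finally show "f ` pts (coset_biset G ?U) = pts (M\<lparr>pts := two_sided_orbit G M m\<rparr>)" by simp
    qed
    fix g X assume g: "g \<in> carrier G" and "X \<in> pts (coset_biset G ?U)"
    then obtain a b where x: "a \<in> carrier G" "b \<in> carrier G" "X = ?U #>\<^bsub>G \<times>\<times> G\<^esub> (a, b)"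
      unfolding pts by auto
    show "f (lact (coset_biset G ?U) g X) = lact (M\<lparr>pts := two_sided_orbit G M m\<rparr>) g (f X)"
      using g x D(4,6,8) m by (simp add: coset_biset_simps[OF U] f inv_mult_group)
    show "f (ract (coset_biset G ?U) X g) = ract (M\<lparr>pts := two_sided_orbit G M m\<rparr>) (f X) g"
      using g x D(4,7) m by (simp add: coset_biset_simps[OF U] f)
  qed
qed

lemma two_sided_orbit_coset_biset:
  assumes U: "subgroup U (G \<times>\<times> G)" and x: "x \<in> carrier (G \<times>\<times> G)"
  shows "two_sided_orbit G (coset_biset G U) (U #>\<^bsub>G \<times>\<times> G\<^esub> x) = pts (coset_biset G U)"
proof -
  interpret GG: group "G \<times>\<times> G" by (rule group_square)
  have "two_sided_orbit G (coset_biset G U) (U #>\<^bsub>G \<times>\<times> G\<^esub> x)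
      = {U #>\<^bsub>G \<times>\<times> G\<^esub> (x \<otimes>\<^bsub>G \<times>\<times> G\<^esub> (inv g, h)) | g h. g \<in> carrier G \<and> h \<in> carrier G}"
  proof -
    have "ract (coset_biset G U) (lact (coset_biset G U) g (U #>\<^bsub>G \<times>\<times> G\<^esub> x)) h
        = U #>\<^bsub>G \<times>\<times> G\<^esub> (x \<otimes>\<^bsub>G \<times>\<times> G\<^esub> (inv g, h))" if g: "g \<in> carrier G" and h: "h \<in> carrier G" for
          g h
    proof -
      have "x \<otimes>\<^bsub>G \<times>\<times> G\<^esub> (inv g, \<one>) \<in> carrier (G \<times>\<times> G)" using x g by auto
      moreover have "x \<otimes>\<^bsub>G \<times>\<times> G\<^esub> (inv g, \<one>) \<otimes>\<^bsub>G \<times>\<times> G\<^esub> (\<one>, h) = x \<otimes>\<^bsub>G \<times>\<times> G\<^esub> (inv g, h)"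
        using x g h by auto
      ultimately show ?thesis using g h by (simp only: coset_biset_simps[OF U] x)
    qed
    then show ?thesis unfolding two_sided_orbit_def
      by (intro Collect_cong iff_exI) (simp only: cong: rev_conj_cong)
  qed
  also have "\<dots> = {U #>\<^bsub>G \<times>\<times> G\<^esub> y | y. y \<in> carrier (G \<times>\<times> G)}"
  proof -
    have "\<exists>g h. g \<in> carrier G \<and> h \<in> carrier G \<and> y = x \<otimes>\<^bsub>G \<times>\<times> G\<^esub> (inv g, h)"
      if "y \<in> carrier (G \<times>\<times> G)" for y
    proof -
      obtain a b where ab: "inv\<^bsub>G \<times>\<times> G\<^esub> x \<otimes>\<^bsub>G \<times>\<times> G\<^esub> y = (a, b)"
        by (cases "inv\<^bsub>G \<times>\<times> G\<^esub> x \<otimes>\<^bsub>G \<times>\<times> G\<^esub> y")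
      then have "a \<in> carrier G" "b \<in> carrier G"
        using GG.m_closed[OF GG.inv_closed[OF x] that] by auto
      moreover have "y = x \<otimes>\<^bsub>G \<times>\<times> G\<^esub> (a, b)"
        unfolding ab[symmetric] using x that
        by (simp only: GG.m_assoc[symmetric] GG.inv_closed GG.r_inv GG.l_one)
      ultimately show ?thesis by (intro exI[of _ "inv a"] exI[of _ b]) simp
    qed
    moreover have "x \<otimes>\<^bsub>G \<times>\<times> G\<^esub> (inv g, h) \<in> carrier (G \<times>\<times> G)"
      if "g \<in> carrier G" "h \<in> carrier G" for g h
      using x that by auto
    ultimately show ?thesis by blast
  qed
  also have "\<dots> = pts (coset_biset G U)" by (auto simp: coset_biset_def RCOSETS_def)
  finally show ?thesis .
qed

text \<open>The conjugate is the stabiliser of the point U x of \<open>coset_biset G U\<close>, and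
  the orbit of that point is everything. So this is the orbit-stabiliser theorem applied to a second
  base point.\<close>

lemma coset_biset_conj_iso:
  assumes fin: "finite (carrier G)" and U: "subgroup U (G \<times>\<times> G)" and x: "x \<in> carrier (G \<times>\<times> G)"
  shows "biset_iso G
    (coset_biset G {z \<in> carrier (G \<times>\<times> G). x \<otimes>\<^bsub>G \<times>\<times> G\<^esub> z \<otimes>\<^bsub>G \<times>\<times> G\<^esub> inv\<^bsub>G \<times>\<times> G\<^esub> x \<in> U})
    (coset_biset G U)"
proof -
  have "U #>\<^bsub>G \<times>\<times> G\<^esub> x \<in> pts (coset_biset G U)" using x by (auto simp: coset_biset_def RCOSETS_def)
  from coset_biset_iso_orbit[OF finite_coset_biset[OF fin U] this] show ?thesis
    by (simp add: point_stab_coset_biset[OF U x] two_sided_orbit_coset_biset[OF U x])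
qed

text \<open>The point x of the regular biset has the stabiliser of all (a, x^-1 a x), a conjugate of
  the diagonal by an element of the left factor.\<close>

lemma stab_sum_regular:
  fixes \<phi> :: "('a \<times> 'a) set \<Rightarrow> arr"
  assumes fin: "finite (carrier G)"
    and \<phi>: "\<And>x. x \<in> carrier G \<Longrightarrow> \<phi> (left_conj x (Id_on (carrier G))) = \<phi> (Id_on (carrier G))"
  shows "stab_sum G \<phi> (regular_biset G) = arr_scale (of_nat (order G)) (\<phi> (Id_on (carrier G)))"
proof -
  have "point_stab G (regular_biset G) x = left_conj x (Id_on (carrier G))"
    if x: "x \<in> carrier G" for x
  proof -
    have "a \<otimes> x = x \<otimes> b \<longleftrightarrow> inv x \<otimes> a \<otimes> x = b" if "a \<in> carrier G" "b \<in> carrier G" for a b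
      using that x by (metis inv_solve_left' m_assoc m_closed inv_closed)
    then show ?thesis using x by (auto simp: point_stab_def regular_biset_def left_conj_def
      Id_on_def)
  qed
  then have "stab_sum G \<phi> (regular_biset G) = (\<Sum>x\<in>carrier G. arr_scale 1 (\<phi> (Id_on (carrier G))))"
    unfolding stab_sum_def by (intro sum.cong) (auto simp: regular_biset_def \<phi> arr_scale_one)
  then show ?thesis by (simp add: sum_arr_scale_const order_def del: sum_constant)
qed

lemma finite_regular_biset:
  assumes "finite (carrier G)"
  shows "finite_biset G (regular_biset G)"
  using assms by (auto simp: finite_biset_def regular_biset_def m_assoc)

end


section \<open>Subgroups of $S_3 \times S_3$\<close>

text \<open>A pair \<open>(r, s)\<close> stands for the rotation $c^r$ if \<open>s\<close> is false, and for $c^r t$ otherwise.\<close>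

datatype z3 = Z0 | Z1 | Z2

fun add3 :: "z3 \<Rightarrow> z3 \<Rightarrow> z3" where
  "add3 Z0 r = r"
| "add3 Z1 Z0 = Z1" | "add3 Z1 Z1 = Z2" | "add3 Z1 Z2 = Z0"
| "add3 Z2 Z0 = Z2" | "add3 Z2 Z1 = Z0" | "add3 Z2 Z2 = Z1"

fun neg3 :: "z3 \<Rightarrow> z3" where
  "neg3 Z0 = Z0" | "neg3 Z1 = Z2" | "neg3 Z2 = Z1"

type_synonym s3 = "z3 \<times> bool"

fun smul :: "s3 \<Rightarrow> s3 \<Rightarrow> s3" where
  "smul (r, s) (r', s') = (add3 r (if s then neg3 r' else r'), s \<noteq> s')"

fun sinv :: "s3 \<Rightarrow> s3" where
  "sinv (r, s) = ((if s then r else neg3 r), s)"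

text \<open>Quantifiers and sums over the group are expressed through this list so that they can be
  evaluated.\<close>

definition s3_list :: "s3 list" where
  "s3_list = [(Z0, False), (Z1, False), (Z2, False), (Z0, True), (Z1, True), (Z2, True)]"

lemma add3_assoc: "add3 (add3 a b) c = add3 a (add3 b c)"
  by (cases a; cases b; cases c) simp_all

lemma add3_commute: "add3 a b = add3 b a"
  by (cases a; cases b) simp_all

lemma add3_simps [simp]: "add3 r Z0 = r" "add3 (neg3 r) r = Z0" "add3 r (neg3 r) = Z0"
  "neg3 (neg3 r) = r" "neg3 (add3 r r') = add3 (neg3 r) (neg3 r')"
  by (cases r; cases r'; simp)+

lemma smul_assoc: "smul (smul a b) c = smul a (smul b c)"
  by (cases a; cases b; cases c) (auto simp: add3_assoc)

lemma smul_one: "smul (Z0, False) a = a" "smul a (Z0, False) = a"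
  by (cases a; simp)+

lemma smul_sinv: "smul (sinv a) a = (Z0, False)" "smul a (sinv a) = (Z0, False)"
  by (cases a; simp)+

lemma smul_sinv_smul: "smul (sinv a) (smul a b) = b" "smul a (smul (sinv a) b) = b"
  by (simp_all only: smul_assoc[symmetric] smul_sinv smul_one)

lemma sinv_smul: "sinv (smul a b) = smul (sinv b) (sinv a)"
  by (cases a; cases b) (auto simp: add3_commute)

lemma sinv_sinv: "sinv (sinv a) = a"
  by (cases a) simp

lemmas s3_group_simps = smul_assoc smul_one smul_sinv smul_sinv_smul sinv_smul sinv_sinv

lemma set_s3_list: "set s3_list = UNIV"
proof -
  have "(r, s) \<in> set s3_list" for r s by (cases r; cases s) (simp_all add: s3_list_def)
  then show ?thesis by auto
qed

lemma distinct_s3_list: "distinct s3_list"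
  by (simp add: s3_list_def)

lemma finite_UNIV_s3: "finite (UNIV :: s3 set)"
  using set_s3_list by (metis List.finite_set)

type_synonym srel = "s3 \<Rightarrow> s3 \<Rightarrow> bool"

definition subgroup_rel :: "srel \<Rightarrow> bool" where
  "subgroup_rel X \<longleftrightarrow> X (Z0, False) (Z0, False) \<and>
     (\<forall>a b c d. X a b \<longrightarrow> X c d \<longrightarrow> X (smul a c) (smul b d)) \<and>
     (\<forall>a b. X a b \<longrightarrow> X (sinv a) (sinv b))"

definition srel_comp :: "srel \<Rightarrow> srel \<Rightarrow> srel" where
  "srel_comp U V a d \<longleftrightarrow> list_ex (\<lambda>b. U a b \<and> V b d) s3_list"

definition srel_conj :: "s3 \<Rightarrow> srel \<Rightarrow> srel" where
  "srel_conj g V a b \<longleftrightarrow> V (smul (sinv g) (smul a g)) b"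

definition srel_biconj :: "s3 \<Rightarrow> s3 \<Rightarrow> srel \<Rightarrow> srel" where
  "srel_biconj g h X a b \<longleftrightarrow> X (smul (sinv g) (smul a g)) (smul (sinv h) (smul b h))"

lemma srel_comp_iff: "srel_comp U V a d \<longleftrightarrow> (\<exists>b. U a b \<and> V b d)"
  by (simp add: srel_comp_def list_ex_iff set_s3_list)

lemma subgroup_relD:
  assumes "subgroup_rel X"
  shows "X (Z0, False) (Z0, False)" "X a b \<Longrightarrow> X c d \<Longrightarrow> X (smul a c) (smul b d)"
    "X a b \<Longrightarrow> X (sinv a) (sinv b)"
  using assms unfolding subgroup_rel_def by blast+

lemma subgroup_rel_comp:
  assumes "subgroup_rel X" "subgroup_rel Y"
  shows "subgroup_rel (srel_comp X Y)"
  using subgroup_relD[OF assms(1)] subgroup_relD[OF assms(2)]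
  unfolding subgroup_rel_def srel_comp_iff by metis

lemma subgroup_rel_biconj:
  assumes "subgroup_rel X"
  shows "subgroup_rel (srel_biconj g h X)"
proof -
  have "X (smul (sinv g) (smul (smul a c) g)) (smul (sinv h) (smul (smul b d) h))"
    if "X (smul (sinv g) (smul a g)) (smul (sinv h) (smul b h))"
      "X (smul (sinv g) (smul c g)) (smul (sinv h) (smul d h))" for a b c d
    using subgroup_relD(2)[OF assms that] by (simp only: s3_group_simps)
  moreover have "X (smul (sinv g) (smul (sinv a) g)) (smul (sinv h) (smul (sinv b) h))"
    if "X (smul (sinv g) (smul a g)) (smul (sinv h) (smul b h))" for a b
    using subgroup_relD(3)[OF assms that] by (simp only: s3_group_simps)
  ultimately show ?thesis using subgroup_relD(1)[OF assms]
    unfolding subgroup_rel_def srel_biconj_def by (simp only: s3_group_simps) blast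
qed

lemma srel_conj_eq_biconj: "srel_conj g X = srel_biconj g (Z0, False) X"
  by (intro ext) (simp add: srel_conj_def srel_biconj_def smul_one del: smul.simps)

lemma srel_biconj_biconj: "srel_biconj g h (srel_biconj g' h' X) = srel_biconj (smul g g') (smul h
  h') X"
  by (intro ext) (simp only: srel_biconj_def s3_group_simps)

lemma srel_biconj_one: "srel_biconj (Z0, False) (Z0, False) X = X"
  by (intro ext) (simp add: srel_biconj_def smul_one del: smul.simps)


subsection \<open>Standard subgroups\<close>

text \<open>
  The standard subgroups are semidirect products $P \rtimes Q$ with $P \le C_3 \times C_3$ and
  $Q \le \langle t\rangle \times \langle t\rangle$. In both types \<open>1\<close>, \<open>L\<close>, \<open>R\<close>, \<open>D\<close>, \<open>F\<close> mean
    trivial, left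
  factor, right factor, diagonal and full.
\<close>

datatype rot_type = P1 | PL | PR | PD | PF
datatype sgn_type = Q1 | QL | QR | QD | QF

fun in_rot :: "rot_type \<Rightarrow> z3 \<Rightarrow> z3 \<Rightarrow> bool" where
  "in_rot P1 r r' \<longleftrightarrow> r = Z0 \<and> r' = Z0"
| "in_rot PL r r' \<longleftrightarrow> r' = Z0"
| "in_rot PR r r' \<longleftrightarrow> r = Z0"
| "in_rot PD r r' \<longleftrightarrow> r = r'"
| "in_rot PF r r' \<longleftrightarrow> True"

fun in_sgn :: "sgn_type \<Rightarrow> bool \<Rightarrow> bool \<Rightarrow> bool" where
  "in_sgn Q1 s s' \<longleftrightarrow> \<not> s \<and> \<not> s'"
| "in_sgn QL s s' \<longleftrightarrow> \<not> s'"
| "in_sgn QR s s' \<longleftrightarrow> \<not> s"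
| "in_sgn QD s s' \<longleftrightarrow> s = s'"
| "in_sgn QF s s' \<longleftrightarrow> True"

fun std_rel :: "sgn_type \<times> rot_type \<Rightarrow> srel" where
  "std_rel (q, p) (r, s) (r', s') \<longleftrightarrow> in_sgn q s s' \<and> in_rot p r r'"

text \<open>Of the 25 combinations, \<open>PD\<close> with \<open>QL\<close>, \<open>QR\<close> or
  \<open>QF\<close> is missing: a reflection in one factor alone inverts one of the two rotation
  coordinates and does not normalise the diagonal of C_3 x C_3.\<close>

definition std_types :: "(sgn_type \<times> rot_type) list" where
  "std_types =
    [(Q1, P1), (Q1, PL), (Q1, PR), (Q1, PD), (Q1, PF), (QL, P1), (QL, PL), (QL, PR), (QL, PF),
     (QR, P1), (QR, PL), (QR, PR), (QR, PF), (QD, P1), (QD, PL), (QD, PR), (QD, PD), (QD, PF),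
       (QF, P1), (QF, PL), (QF, PR), (QF, PF)]"

lemma std_types_iff: "(q, p) \<in> set std_types \<longleftrightarrow> p \<noteq> PD \<or> q = Q1 \<or> q = QD"
  by (cases q; cases p) (simp_all add: std_types_def)

lemma subgroup_rel_std:
  assumes "i \<in> set std_types"
  shows "subgroup_rel (std_rel i)"
proof -
  obtain q p where i: "i = (q, p)" by (cases i)
  show ?thesis unfolding subgroup_rel_def i
    using assms unfolding i std_types_iff by (cases q; cases p) auto
qed

section \<open>Conjugacy classes of subgroups: invariants and classification\<close>

definition s3_refls :: "s3 list" where "s3_refls = [(Z0, True), (Z1, True), (Z2, True)]"

text \<open>Conjugation permutes the three reflections, so all of them are tried. Testing
  reflections against the identity is enough: if a subgroup contains a pair (reflection, rotation),
  the cube of that pair is (reflection, 1).\<close>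

definition sgn_of :: "srel \<Rightarrow> sgn_type" where
  "sgn_of X =
    (let l = list_ex (\<lambda>x. X x (Z0, False)) s3_refls; r = list_ex (\<lambda>x. X (Z0, False) x) s3_refls
     in if l then if r then QF else QL
        else if r then QR
        else if list_ex (\<lambda>x. list_ex (X x) s3_refls) s3_refls then QD else Q1)"

text \<open>One generator per line of C_3 x C_3 is tested. The diagonal and the antidiagonal count
  as the same type because a reflection in one factor conjugates them into each other.\<close>

definition rot_of :: "srel \<Rightarrow> rot_type" where
  "rot_of X =
    (let l = X (Z1, False) (Z0, False); r = X (Z0, False) (Z1, False)
     in if l then if r then PF else PL
        else if r then PR
        else if X (Z1, False) (Z1, False) \<or> X (Z1, False) (Z2, False) then PD else P1)"

definition type_of :: "srel \<Rightarrow> sgn_type \<times> rot_type" where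
  "type_of X = (sgn_of X, rot_of X)"

lemma type_of_biconj_std_check:
  "list_all (\<lambda>i. list_all (\<lambda>g. list_all (\<lambda>h. type_of (srel_biconj g h (std_rel i)) = i) s3_list)
     s3_list) std_types"
  by code_simp

lemma type_of_biconj_std:
  assumes "i \<in> set std_types"
  shows "type_of (srel_biconj g h (std_rel i)) = i"
  using type_of_biconj_std_check assms by (simp add: list_all_iff set_s3_list del: split_paired_All)

text \<open>A subgroup of C_3 x C_3 is a subspace of the plane over F_3: zero, one of four lines, or
  everything. The antidiagonal is the only one that is not of standard form. Negation is doubling in
  C_3.\<close>

lemma rot_classification:
  fixes R :: "z3 \<Rightarrow> z3 \<Rightarrow> bool"
  assumes one: "R Z0 Z0"
    and add: "\<And>a b c d. R a b \<Longrightarrow> R c d \<Longrightarrow> R (add3 a c) (add3 b d)"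
  shows "(\<exists>p. R = in_rot p) \<or> R = (\<lambda>r r'. r' = neg3 r)"
proof -
  have dbl: "R (neg3 a) (neg3 b)" if "R a b" for a b
    using add[OF that that] by (cases a; cases b) simp_all
  have neg: "R (neg3 a) (neg3 b) = R a b" for a b using dbl[of a b] dbl[of "neg3 a" "neg3 b"]
    by auto
  have sym: "R Z2 Z0 = R Z1 Z0" "R Z0 Z2 = R Z0 Z1" "R Z2 Z2 = R Z1 Z1" "R Z2 Z1 = R Z1 Z2"
    using neg[of Z1 Z0] neg[of Z0 Z1] neg[of Z1 Z1] neg[of Z1 Z2] by simp_all
  \<comment> \<open>Two different lines span the plane; each entry derives membership of a further
    line.\<close>
  have two: "R Z1 Z0 \<Longrightarrow> R Z0 Z1 \<Longrightarrow> R Z1 Z1" "R Z1 Z0 \<Longrightarrow> R Z1 Z1 \<Longrightarrow> R Z0 Z1"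
    "R Z1 Z0 \<Longrightarrow> R Z1 Z2 \<Longrightarrow> R Z0 Z1" "R Z0 Z1 \<Longrightarrow> R Z1 Z1 \<Longrightarrow> R Z1 Z0"
    "R Z0 Z1 \<Longrightarrow> R Z1 Z2 \<Longrightarrow> R Z1 Z0" "R Z1 Z1 \<Longrightarrow> R Z1 Z2 \<Longrightarrow> R Z1 Z0"
    "R Z1 Z0 \<Longrightarrow> R Z0 Z1 \<Longrightarrow> R Z1 Z2"
    using add[of Z1 Z0 Z0 Z1] add[of Z2 Z0 Z1 Z1] add[of Z2 Z0 Z1 Z2] add[of Z1 Z1 Z0 Z2]
      add[of Z1 Z2 Z0 Z1] add[of Z1 Z1 Z1 Z2] add[of Z1 Z0 Z0 Z2] sym by auto
  have eqI: "R = S" if "R Z1 Z0 = S Z1 Z0" "R Z0 Z1 = S Z0 Z1" "R Z1 Z1 = S Z1 Z1" "R Z1 Z2 = S Z1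
    Z2"
    "S Z0 Z0" "S Z2 Z0 = S Z1 Z0" "S Z0 Z2 = S Z0 Z1" "S Z2 Z2 = S Z1 Z1" "S Z2 Z1 = S Z1 Z2" for S
  proof (intro ext)
    fix a b show "R a b = S a b" using that sym one by (cases a; cases b) simp_all
  qed
  consider "R Z1 Z0" "R Z0 Z1" | "R Z1 Z0" "\<not> R Z0 Z1" | "\<not> R Z1 Z0" "R Z0 Z1"
    | "\<not> R Z1 Z0" "\<not> R Z0 Z1" "R Z1 Z1" | "\<not> R Z1 Z0" "\<not> R Z0 Z1" "\<not> R Z1 Z1" "R Z1 Z2"
    | "\<not> R Z1 Z0" "\<not> R Z0 Z1" "\<not> R Z1 Z1" "\<not> R Z1 Z2" by blast
  then show ?thesis
  proof cases
    case 1
    have "R Z1 Z1" "R Z1 Z2" using two 1 by blast+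
    with 1 have "R = in_rot PF" by (intro eqI) simp_all
    then show ?thesis by blast
  next
    case 2
    have "\<not> R Z1 Z1" "\<not> R Z1 Z2" using two 2 by blast+
    with 2 have "R = in_rot PL" by (intro eqI) simp_all
    then show ?thesis by blast
  next
    case 3
    have "\<not> R Z1 Z1" "\<not> R Z1 Z2" using two 3 by blast+
    with 3 have "R = in_rot PR" by (intro eqI) simp_all
    then show ?thesis by blast
  next
    case 4
    have "\<not> R Z1 Z2" using two 4 by blast+
    with 4 have "R = in_rot PD" by (intro eqI) simp_all
    then show ?thesis by blast
  next
    case 5
    then have "R = (\<lambda>r r'. r' = neg3 r)" by (intro eqI) simp_all
    then show ?thesis by blast
  next
    case 6
    then have "R = in_rot P1" by (intro eqI) simp_all
    then show ?thesis by blast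
  qed
qed

lemma refl_conj: "\<exists>g. smul (sinv g) (smul (Z0, True) g) = (r, True)"
proof (cases r)
  case Z0 then show ?thesis by (intro exI[of _ "(Z0, False)"]) simp
next
  case Z1 then show ?thesis by (intro exI[of _ "(Z1, False)"]) simp
next
  case Z2 then show ?thesis by (intro exI[of _ "(Z2, False)"]) simp
qed

text \<open>The type \<open>q\<close> names the image of X in the group of sign pairs. A Sylow
  2-subgroup of X maps isomorphically onto that image and is conjugate into <t> x <t>; the
  conjugating pair is found directly, since all reflections of S_3 are conjugate.\<close>

lemma sgn_classification:
  assumes X: "subgroup_rel X"
  shows "\<exists>q g h. (\<forall>a b. srel_biconj g h X a b \<longrightarrow> in_sgn q (snd a) (snd b)) \<and>
    (\<forall>s s'. in_sgn q s s' \<longrightarrow> srel_biconj g h X (Z0, s) (Z0, s'))"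
proof -
  note D = subgroup_relD[OF X]
  \<comment> \<open>The cube of (reflection, rotation) is (reflection, 1).\<close>
  have L: "X (r, True) (Z0, False)" if "X (r, True) (r', False)" for r r'
    using D(2)[OF D(2)[OF that that] that] by (cases r; cases r') simp_all
  have R: "X (Z0, False) (r', True)" if "X (r, False) (r', True)" for r r'
    using D(2)[OF D(2)[OF that that] that] by (cases r; cases r') simp_all
  have snd_conj: "snd (smul (sinv g) (smul a g)) = snd a" for g a
    by (cases g; cases a) auto
  have one: "srel_biconj g h X (Z0, False) (Z0, False)" for g h
    using subgroup_relD(1)[OF subgroup_rel_biconj[OF X]] .
  have left: "srel_biconj g h X (Z0, True) (Z0, False) \<longleftrightarrow> X (smul (sinv g) (smul (Z0, True) g))
    (Z0, False)"
    and right: "srel_biconj g h X (Z0, False) (Z0, True) \<longleftrightarrow> X (Z0, False) (smul (sinv h) (smul (Z0,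
      True) h))"
    for g h
    by (simp_all only: srel_biconj_def s3_group_simps)
  let ?l = "\<exists>r r'. X (r, True) (r', False)" and ?r = "\<exists>r r'. X (r, False) (r', True)"
    and ?d = "\<exists>r r'. X (r, True) (r', True)"
  \<comment> \<open>Multiplying the sign patterns (-, +) and (-, -) gives (+, -), so a subgroup
    containing reflections in only one factor contains no pair of two reflections; \<open>rd\<close>
    is the mirror image.\<close>
  have ld: "?r" if l: "?l" and d: "?d"
  proof -
    obtain r r' x x' where A: "X (r, True) (r', False)" "X (x, True) (x', True)" using l d by blast
    show ?thesis using D(2)[OF A] by auto
  qed
  have rd: "?l" if r: "?r" and d: "?d"
  proof -
    obtain r r' x x' where A: "X (r, False) (r', True)" "X (x, True) (x', True)" using r d by blast
    show ?thesis using D(2)[OF A] by auto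
  qed
  have sgn: "\<exists>r r'. X (r, snd a) (r', snd b)" if "srel_biconj g h X a b" for g h a b
  proof -
    have "smul (sinv g) (smul a g) = (fst (smul (sinv g) (smul a g)), snd a)"
      "smul (sinv h) (smul b h) = (fst (smul (sinv h) (smul b h)), snd b)"
      by (simp_all only: prod_eq_iff fst_conv snd_conv snd_conj)
    then show ?thesis using that unfolding srel_biconj_def by metis
  qed
  have goalI: ?thesis if "\<And>a b. srel_biconj g h X a b \<Longrightarrow> in_sgn q (snd a) (snd b)"
    "\<And>s s'. in_sgn q s s' \<Longrightarrow> srel_biconj g h X (Z0, s) (Z0, s')" for q g h
    using that by blast
  consider "?l" "?r" | "?l" "\<not> ?r" | "\<not> ?l" "?r" | "\<not> ?l" "\<not> ?r" "?d" | "\<not> ?l" "\<not> ?r" "\<not> ?d"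
    by blast
  then show ?thesis
  proof cases
    case 1
    then obtain r r' where "X (r, True) (Z0, False)" "X (Z0, False) (r', True)" using L R by blast
    moreover obtain g h where "smul (sinv g) (smul (Z0, True) g) = (r, True)"
      "smul (sinv h) (smul (Z0, True) h) = (r', True)" using refl_conj by meson
    ultimately have l: "srel_biconj g h X (Z0, True) (Z0, False)"
      and r: "srel_biconj g h X (Z0, False) (Z0, True)" by (simp_all only: left right)
    have "srel_biconj g h X (Z0, True) (Z0, True)"
      using subgroup_relD(2)[OF subgroup_rel_biconj[OF X] l r] by simp
    then have "srel_biconj g h X (Z0, s) (Z0, s')" for s s'
      using l r one by (cases s; cases s') simp_all
    then show ?thesis by (intro goalI[of g h QF]) simp_all
  next
    case 2
    then obtain r where "X (r, True) (Z0, False)" using L by blast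
    moreover obtain g where "smul (sinv g) (smul (Z0, True) g) = (r, True)" using refl_conj by meson
    ultimately have l: "srel_biconj g (Z0, False) X (Z0, True) (Z0, False)" by (simp only: left)
    have "\<not> srel_biconj g (Z0, False) X a b" if "snd b" for a b
      using sgn[of g "(Z0, False)" a b] 2 ld that by (cases "snd a") auto
    moreover have "srel_biconj g (Z0, False) X (Z0, s) (Z0, s')" if "in_sgn QL s s'" for s s'
      using that one l by (cases s; cases s') simp_all
    ultimately show ?thesis by (intro goalI[of "g" "(Z0, False)" QL]) auto
  next
    case 3
    then obtain r where "X (Z0, False) (r, True)" using R by blast
    moreover obtain g where "smul (sinv g) (smul (Z0, True) g) = (r, True)" using refl_conj by meson
    ultimately have l: "srel_biconj (Z0, False) g X (Z0, False) (Z0, True)" by (simp only: right)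
    have "\<not> srel_biconj (Z0, False) g X a b" if "snd a" for a b
      using sgn[of "(Z0, False)" g a b] 3 rd that by (cases "snd b") auto
    moreover have "srel_biconj (Z0, False) g X (Z0, s) (Z0, s')" if "in_sgn QR s s'" for s s'
      using that one l by (cases s; cases s') simp_all
    ultimately show ?thesis by (intro goalI[of "(Z0, False)" "g" QR]) auto
  next
    case 4
    then obtain r r' where "X (r, True) (r', True)" by blast
    moreover obtain g h where "smul (sinv g) (smul (Z0, True) g) = (r, True)"
      "smul (sinv h) (smul (Z0, True) h) = (r', True)" using refl_conj by meson
    ultimately have l: "srel_biconj g h X (Z0, True) (Z0, True)" by (simp only: srel_biconj_def)
    have "snd a = snd b" if "srel_biconj g h X a b" for a b
      using sgn[OF that] 4 by (cases "snd a"; cases "snd b") auto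
    moreover have "srel_biconj g h X (Z0, s) (Z0, s')" if "in_sgn QD s s'" for s s'
      using that one l by (cases s; cases s') simp_all
    ultimately show ?thesis by (intro goalI[of "g" "h" QD]) auto
  next
    case 5
    have "\<not> snd a \<and> \<not> snd b" if "srel_biconj (Z0, False) (Z0, False) X a b" for a b
      using sgn[OF that] 5 by (cases "snd a"; cases "snd b") auto
    moreover have "srel_biconj (Z0, False) (Z0, False) X (Z0, s) (Z0, s')"
      if "in_sgn Q1 s s'" for s s'
      using that one by (cases s; cases s') simp_all
    ultimately show ?thesis by (intro goalI[of "(Z0, False)" "(Z0, False)" Q1]) auto
  qed
qed

text \<open>After a conjugation the subgroup contains a complement of sign pairs to its rotation
  part and is the semidirect product of the two. What remains is to see which rotation parts the
  complement normalises and to turn the antidiagonal into the diagonal.\<close>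

lemma subgroup_rel_classification:
  assumes X: "subgroup_rel X"
  shows "\<exists>i\<in>set std_types. \<exists>g h. X = srel_biconj g h (std_rel i)"
proof -
  obtain q g h where q: "\<And>a b. srel_biconj g h X a b \<Longrightarrow> in_sgn q (snd a) (snd b)"
    "\<And>s s'. in_sgn q s s' \<Longrightarrow> srel_biconj g h X (Z0, s) (Z0, s')"
    using sgn_classification[OF X] by metis
  define Y where "Y = srel_biconj g h X"
  have Y: "subgroup_rel Y" unfolding Y_def using subgroup_rel_biconj[OF X] .
  note D = subgroup_relD[OF Y]
  define R where "R r r' = Y (r, False) (r', False)" for r r'
  \<comment> \<open>Multiplication by the inverse of the pair of complement elements with the same
    signs leaves a pair of rotations.\<close>
  have split: "Y (r, s) (r', s') \<longleftrightarrow> in_sgn q s s' \<and> R r r'" for r s r' s'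
  proof
    assume A: "Y (r, s) (r', s')"
    then have s: "in_sgn q s s'" using q(1) by (fastforce simp: Y_def)
    from D(2)[OF A D(3)[OF q(2)[OF s, folded Y_def]]] have "R r r'"
      by (cases s; cases s') (simp_all add: R_def)
    with s show "in_sgn q s s' \<and> R r r'" ..
  next
    assume A: "in_sgn q s s' \<and> R r r'"
    then show "Y (r, s) (r', s')"
      using D(2)[of "(r, False)" "(r', False)" "(Z0, s)" "(Z0, s')"] q(2)[of s s']
      by (simp add: R_def Y_def)
  qed
  have R1: "R Z0 Z0" using D(1) by (simp add: R_def)
  have R2: "R (add3 a c) (add3 b d)" if "R a b" "R c d" for a b c d
    using D(2)[of "(a, False)" "(b, False)" "(c, False)" "(d, False)"] that by (simp add: R_def)
  have invl: "R (if s then neg3 r else r) (if s' then neg3 r' else r')"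
    if "in_sgn q s s'" "R r r'" for s s' r r'
  proof -
    have "Y (Z0, s) (Z0, s')" using q(2)[OF that(1)] by (simp add: Y_def)
    from D(2)[OF D(2)[OF this, of "(r, False)" "(r', False)"] D(3)[OF this]] that(2) show ?thesis
      by (auto simp: R_def split: if_splits)
  qed
  have XY: "X = srel_biconj (sinv g) (sinv h) Y"
    by (simp only: Y_def srel_biconj_biconj smul_sinv srel_biconj_one)
  \<comment> \<open>A reflection in one factor alone would put (-1, r) or (1, -r) into R besides (1,
    r). Adding gives (0, 2 r) or (2, 0), and either of them leads to (1, 0) in R.\<close>
  have nd: "q = Q1 \<or> q = QD" if "R Z1 r" "r \<noteq> Z0" "\<not> R Z1 Z0" for r
  proof (rule ccontr)
    assume "\<not> (q = Q1 \<or> q = QD)"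
    then have "in_sgn q True False \<or> in_sgn q False True" by (cases q) simp_all
    then have "R Z2 r \<or> R Z1 (neg3 r)" using invl[OF _ that(1)] by force
    then have "R Z0 (add3 r r) \<or> R Z2 Z0" using R2[OF that(1)] by force
    moreover have "R Z1 Z0" if "R Z2 Z0" using R2[OF that that] by simp
    moreover have "R Z1 Z0" if "R Z0 (add3 r r)" using R2[OF \<open>R Z1 r\<close> that] \<open>r \<noteq> Z0\<close>
      by (cases r) simp_all
    ultimately show False using that(3) by blast
  qed
  from rot_classification[of R, OF R1 R2] consider p where "R = in_rot p" | "R = (\<lambda>r r'. r' = neg3
    r)"
    by blast
  then show ?thesis
  proof cases
    case 1
    have "(q, p) \<in> set std_types"
      unfolding std_types_iff using nd[of Z1] 1 by (cases p) auto
    moreover have "Y = std_rel (q, p)" by (intro ext) (auto simp: split 1)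
    ultimately show ?thesis using XY by blast
  next
    case 2
    have "q = Q1 \<or> q = QD" using nd[of Z2] 2 by simp
    then have "(q, PD) \<in> set std_types" unfolding std_types_iff by simp
    \<comment> \<open>Conjugation by t in the second factor inverts the second rotation coordinate
      and fixes the sign pairs.\<close>
    moreover have "Y = srel_biconj (Z0, False) (Z0, True) (std_rel (q, PD))"
    proof (intro ext)
      fix a b :: s3
      obtain r s r' s' where ab: "a = (r, s)" "b = (r', s')" by (cases a; cases b)
      show "Y a b = srel_biconj (Z0, False) (Z0, True) (std_rel (q, PD)) a b"
        unfolding ab split 2 srel_biconj_def by (cases r; cases r') (auto split: if_splits)
    qed
    ultimately show ?thesis using XY srel_biconj_biconj by metis
  qed
qed


section \<open>The images of the transitive bisets\<close>

text \<open>
  \<open>coords i\<close> is the image in $A$ of the transitive biset whose stabiliser is the standard subgroup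
  of type \<open>i\<close>. Its entry $s_{i,j}$ is the multiplicity of $\chi_i \otimes \chi_j$ in the permutation
  character, where $\chi_1, \chi_2, \chi_3$ are the trivial, the sign and the two-dimensional
  character of $S_3$. The other coordinates solve the linear systems that express
  multiplicativity, scaled so as to give all of the localised order.
\<close>

fun coords :: "sgn_type \<times> rot_type \<Rightarrow> int tab" where
  "coords (Q1, P1) = Tab 1 1 2 1 1 2 2 2 4 1 1 2 0 0 0 6 6 12 0 0 6 0"
| "coords (Q1, PL) = Tab 1 1 2 1 1 2 0 0 0 1 1 0 0 0 0 0 0 0 0 0 0 0"
| "coords (Q1, PR) = Tab 1 1 0 1 1 0 2 2 0 0 0 0 0 0 0 6 6 0 0 0 0 0"
| "coords (Q1, PD) = Tab 1 1 0 1 1 0 0 0 2 0 0 1 0 0 2 0 0 6 0 0 3 0"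
| "coords (Q1, PF) = Tab 1 1 0 1 1 0 0 0 0 0 0 0 0 0 0 0 0 0 0 0 0 0"
| "coords (QL, P1) = Tab 1 1 2 0 0 0 1 1 2 1 0 1 0 0 0 0 0 0 0 0 0 0"
| "coords (QL, PL) = Tab 1 1 2 0 0 0 0 0 0 1 0 0 0 0 0 0 0 0 0 0 0 0"
| "coords (QL, PR) = Tab 1 1 0 0 0 0 1 1 0 0 0 0 0 0 0 0 0 0 0 0 0 0"
| "coords (QL, PF) = Tab 1 1 0 0 0 0 0 0 0 0 0 0 0 0 0 0 0 0 0 0 0 0"
| "coords (QR, P1) = Tab 1 0 1 1 0 1 2 0 2 0 0 0 0 0 0 6 0 6 0 0 0 0"
| "coords (QR, PL) = Tab 1 0 1 1 0 1 0 0 0 0 0 0 0 0 0 0 0 0 0 0 0 0"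
| "coords (QR, PR) = Tab 1 0 0 1 0 0 2 0 0 0 0 0 0 0 0 6 0 0 0 0 0 0"
| "coords (QR, PF) = Tab 1 0 0 1 0 0 0 0 0 0 0 0 0 0 0 0 0 0 0 0 0 0"
| "coords (QD, P1) = Tab 1 0 1 0 1 1 1 1 2 0 1 1 1 1 0 0 6 6 1 0 (-6) 1"
| "coords (QD, PL) = Tab 1 0 1 0 1 1 0 0 0 0 1 0 1 1 0 0 0 0 0 0 0 0"
| "coords (QD, PR) = Tab 1 0 0 0 1 0 1 1 0 0 0 0 1 0 0 0 6 0 1 0 0 0"
| "coords (QD, PD) = Tab 1 0 0 0 1 0 0 0 1 0 0 0 1 0 1 0 0 0 0 1 0 0"
| "coords (QD, PF) = Tab 1 0 0 0 1 0 0 0 0 0 0 0 1 0 0 0 0 0 0 0 0 0"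
| "coords (QF, P1) = Tab 1 0 1 0 0 0 1 0 1 0 0 0 0 0 0 0 0 0 0 0 0 0"
| "coords (QF, PL) = Tab 1 0 1 0 0 0 0 0 0 0 0 0 0 0 0 0 0 0 0 0 0 0"
| "coords (QF, PR) = Tab 1 0 0 0 0 0 1 0 0 0 0 0 0 0 0 0 0 0 0 0 0 0"
| "coords (QF, PF) = Tab 1 0 0 0 0 0 0 0 0 0 0 0 0 0 0 0 0 0 0 0 0 0"
| "coords _ = Tab 0 0 0 0 0 0 0 0 0 0 0 0 0 0 0 0 0 0 0 0 0 0"

fun sgn_size :: "sgn_type \<Rightarrow> int" where
  "sgn_size Q1 = 1" | "sgn_size QL = 2" | "sgn_size QR = 2" | "sgn_size QD = 2" | "sgn_size QF = 4"

fun rot_size :: "rot_type \<Rightarrow> int" where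
  "rot_size P1 = 1" | "rot_size PL = 3" | "rot_size PR = 3" | "rot_size PD = 3" | "rot_size PF = 9"

fun std_size :: "sgn_type \<times> rot_type \<Rightarrow> int" where
  "std_size (q, p) = sgn_size q * rot_size p"

definition arr_of_int_tab :: "int tab \<Rightarrow> arr" where
  "arr_of_int_tab T = arr_of_tab (map_tab of_int T)"

definition rep_arr :: "sgn_type \<times> rot_type \<Rightarrow> arr" where
  "rep_arr i = arr_of_int_tab (coords i)"

lemma arr_of_int_tab_simps:
  "arr_of_int_tab (tab_add S T) = arr_of_int_tab S + arr_of_int_tab T"
  "arr_of_int_tab (tab_mult S T) = arr_of_int_tab S * arr_of_int_tab T"
  "arr_of_int_tab (tab_scale k T) = arr_scale (of_int k) (arr_of_int_tab T)"
  "arr_of_int_tab (Tab 0 0 0 0 0 0 0 0 0 0 0 0 0 0 0 0 0 0 0 0 0 0) = 0"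
  unfolding arr_of_int_tab_def arr_tab by (cases S; cases T; simp)+

section \<open>The Mackey identity for the weights\<close>

definition kernel_size :: "srel \<Rightarrow> srel \<Rightarrow> int" where
  "kernel_size X Y =
    sum_list (map (\<lambda>h. if X (Z0, False) h then if Y h (Z0, False) then 1 else 0 else 0) s3_list)"

lemma kernel_size_eq_card: "kernel_size X Y = int (card {h. X (Z0, False) h \<and> Y h (Z0, False)})"
proof -
  have "kernel_size X Y = (\<Sum>h\<in>UNIV. if X (Z0, False) h \<and> Y h (Z0, False) then 1 else 0)"
    unfolding kernel_size_def sum_list_distinct_conv_sum_set[OF distinct_s3_list] set_s3_list
    by (intro sum.cong) simp_all
  also have "\<dots> = int (card {h. X (Z0, False) h \<and> Y h (Z0, False)})"
    by (subst sum.inter_filter[OF finite_UNIV_s3, symmetric]) simp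
  finally show ?thesis .
qed

text \<open>These are 36 times the weights, so that the Mackey identity can be checked on
  integers.\<close>

definition weighted_coords :: "sgn_type \<times> rot_type \<Rightarrow> int tab" where
  "weighted_coords i = tab_scale (std_size i) (coords i)"

definition mackey_term :: "srel \<Rightarrow> srel \<Rightarrow> int tab" where
  "mackey_term X Y = tab_scale (kernel_size X Y) (weighted_coords (type_of (srel_comp X Y)))"

definition mackey_sum :: "srel \<Rightarrow> srel \<Rightarrow> int tab" where
  "mackey_sum X Y =
    foldr (\<lambda>g. tab_add (mackey_term X (srel_conj g Y))) s3_list (Tab 0 0 0 0 0 0 0 0 0 0 0 0 0 0 0
      0 0 0 0 0 0 0)"

definition mackey_check :: "sgn_type \<times> rot_type \<Rightarrow> bool" where
  "mackey_check i \<longleftrightarrow> list_all (\<lambda>j.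
     mackey_sum (std_rel i) (std_rel j) = tab_mult (weighted_coords i) (weighted_coords j))
       std_types"

text \<open>The computational core: 22 x 22 pairs of standard subgroups with six conjugates each.
  After multiplication by 36 the factor 36 on the product side is absorbed into the two factors, so
  the check carries no constant.\<close>

lemma mackey_checks: "list_all mackey_check std_types"
  by code_simp

text \<open>A transitive biset whose stabilisers have order n has 36/n points. With this
  normalisation its value becomes \<open>rep_arr\<close>.\<close>

definition weight :: "srel \<Rightarrow> arr" where
  "weight X = arr_scale (of_int (std_size (type_of X)) / 36) (rep_arr (type_of X))"

lemma weight_eq: "weight X = arr_scale (1 / 36) (arr_of_int_tab (weighted_coords (type_of X)))"
  by (simp add: weight_def weighted_coords_def rep_arr_def arr_of_int_tab_simps arr_scale_scale)

text \<open>By the classification both sides are conjugates of one standard subgroup, where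
  invariance has been checked by evaluation.\<close>

lemma type_of_biconj:
  assumes "subgroup_rel X"
  shows "type_of (srel_biconj g h X) = type_of X"
proof -
  obtain i g' h' where i: "i \<in> set std_types" "X = srel_biconj g' h' (std_rel i)"
    using subgroup_rel_classification[OF assms] by blast
  show ?thesis unfolding i(2) srel_biconj_biconj type_of_biconj_std[OF i(1)] ..
qed

lemma weight_biconj: "subgroup_rel X \<Longrightarrow> weight (srel_biconj g h X) = weight X"
  by (simp add: weight_def type_of_biconj)

text \<open>The outer conjugations pass through the composite. Conjugating the middle variable by b
  merges the two inner ones into the single left conjugation by b^-1 c.\<close>

lemma srel_comp_biconj:
  "srel_comp (srel_biconj a b X) (srel_biconj c d Y)
    = srel_biconj a d (srel_comp X (srel_conj (smul (sinv b) c) Y))"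
proof (intro ext)
  fix u w
  have "(\<exists>v. X (smul (sinv a) (smul u a)) (smul (sinv b) (smul v b)) \<and>
      Y (smul (sinv c) (smul v c)) (smul (sinv d) (smul w d))) \<longleftrightarrow>
    (\<exists>v. X (smul (sinv a) (smul u a)) v \<and>
      Y (smul (sinv (smul (sinv b) c)) (smul v (smul (sinv b) c))) (smul (sinv d) (smul w d)))"
    (is "?L \<longleftrightarrow> ?R")
  proof
    assume ?L
    then obtain v where "X (smul (sinv a) (smul u a)) (smul (sinv b) (smul v b))"
      "Y (smul (sinv c) (smul v c)) (smul (sinv d) (smul w d))" by blast
    then show ?R
      by (intro exI[of _ "smul (sinv b) (smul v b)"]) (simp only: s3_group_simps simp_thms)
  next
    assume ?R
    then obtain v where "X (smul (sinv a) (smul u a)) v"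
      "Y (smul (sinv (smul (sinv b) c)) (smul v (smul (sinv b) c))) (smul (sinv d) (smul w d))"
        by blast
    then show ?L
      by (intro exI[of _ "smul b (smul v (sinv b))"]) (simp only: s3_group_simps simp_thms)
  qed
  then show "srel_comp (srel_biconj a b X) (srel_biconj c d Y) u w
      = srel_biconj a d (srel_comp X (srel_conj (smul (sinv b) c) Y)) u w"
    unfolding srel_comp_iff srel_biconj_def srel_conj_def .
qed

lemma kernel_size_biconj:
  "kernel_size (srel_biconj a b X) (srel_biconj c d Y) = kernel_size X (srel_conj (smul (sinv b)
    c) Y)"
proof -
  have "bij_betw (\<lambda>h. smul (sinv b) (smul h b))
    {h. srel_biconj a b X (Z0, False) h \<and> srel_biconj c d Y h (Z0, False)}
    {h. X (Z0, False) h \<and> srel_conj (smul (sinv b) c) Y h (Z0, False)}"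
  proof (rule bij_betwI[where g = "\<lambda>h. smul b (smul h (sinv b))"])
  qed (auto simp only: Pi_iff mem_Collect_eq srel_biconj_def srel_conj_def s3_group_simps)
  then show ?thesis unfolding kernel_size_eq_card by (simp add: bij_betw_same_card)
qed

lemma mackey_std:
  assumes "i \<in> set std_types" "j \<in> set std_types"
  shows "(\<Sum>g\<in>UNIV. arr_scale (of_int (kernel_size (std_rel i) (srel_conj g (std_rel j))))
      (weight (srel_comp (std_rel i) (srel_conj g (std_rel j)))))
    = arr_scale 36 (weight (std_rel i) * weight (std_rel j))"
proof -
  have e: "mackey_sum (std_rel i) (std_rel j) = tab_mult (weighted_coords i) (weighted_coords j)"
    using mackey_checks assms by (auto simp: list_all_iff mackey_check_def)
  have ty: "type_of (std_rel k) = k" if "k \<in> set std_types" for k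
    using type_of_biconj_std[OF that, of "(Z0, False)" "(Z0, False)"]
      by (simp only: srel_biconj_one)
  have foldr: "arr_of_int_tab (foldr (\<lambda>g. tab_add (f g)) xs (Tab 0 0 0 0 0 0 0 0 0 0 0 0 0 0 0 0 0
    0 0 0 0 0))
      = sum_list (map (\<lambda>g. arr_of_int_tab (f g)) xs)" for f :: "s3 \<Rightarrow> int tab" and xs
    by (induction xs) (simp_all add: arr_of_int_tab_simps)
  have "(\<Sum>g\<in>UNIV. arr_scale (of_int (kernel_size (std_rel i) (srel_conj g (std_rel j))))
      (weight (srel_comp (std_rel i) (srel_conj g (std_rel j)))))
    = arr_scale (1 / 36) (\<Sum>g\<in>UNIV. arr_of_int_tab (mackey_term (std_rel i) (srel_conj g (std_rel
      j))))"
    by (simp add: arr_scale_sum weight_eq mackey_term_def arr_of_int_tab_simps arr_scale_scale)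
  also have "\<dots> = arr_scale (1 / 36) (arr_of_int_tab (mackey_sum (std_rel i) (std_rel j)))"
    by (simp add: mackey_sum_def foldr sum_list_distinct_conv_sum_set[OF distinct_s3_list]
      set_s3_list)
  also have "\<dots> = arr_scale 36 (weight (std_rel i) * weight (std_rel j))"
    by (simp add: e arr_of_int_tab_simps weight_eq ty assms arr_scale_mult_left arr_scale_mult_right
      arr_scale_scale)
  finally show ?thesis .
qed

text \<open>Replacing the two subgroups by conjugates only reindexes the sum along g to b^-1 g c,
  because the outer conjugations do not affect the weights. This reduces the identity to standard
  subgroups.\<close>

lemma mackey:
  assumes X: "subgroup_rel X" and Y: "subgroup_rel Y"
  shows "(\<Sum>g\<in>UNIV. arr_scale (of_int (kernel_size X (srel_conj g Y)))
      (weight (srel_comp X (srel_conj g Y)))) = arr_scale 36 (weight X * weight Y)"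
proof -
  obtain i a b where i: "i \<in> set std_types" "X = srel_biconj a b (std_rel i)"
    using subgroup_rel_classification[OF X] by blast
  obtain j c d where j: "j \<in> set std_types" "Y = srel_biconj c d (std_rel j)"
    using subgroup_rel_classification[OF Y] by blast
  note si = subgroup_rel_std[OF i(1)] and sj = subgroup_rel_std[OF j(1)]
  let ?T = "\<lambda>g. arr_scale (of_int (kernel_size (std_rel i) (srel_conj g (std_rel j))))
      (weight (srel_comp (std_rel i) (srel_conj g (std_rel j))))"
  have *: "srel_conj g Y = srel_biconj (smul g c) d (std_rel j)" for g
    by (simp only: srel_conj_eq_biconj j(2) srel_biconj_biconj smul_one)
  have "subgroup_rel (srel_comp (std_rel i) (srel_conj g (std_rel j)))" for g
    unfolding srel_conj_eq_biconj by (intro subgroup_rel_comp si subgroup_rel_biconj sj)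
  then have "(\<Sum>g\<in>UNIV. arr_scale (of_int (kernel_size X (srel_conj g Y)))
      (weight (srel_comp X (srel_conj g Y)))) = (\<Sum>g\<in>UNIV. ?T (smul (sinv b) (smul g c)))"
    unfolding * i(2) srel_comp_biconj kernel_size_biconj by (simp only: weight_biconj)
  also have "\<dots> = (\<Sum>g\<in>UNIV. ?T g)"
  proof (rule sum.reindex_bij_betw)
    show "bij_betw (\<lambda>g. smul (sinv b) (smul g c)) UNIV UNIV"
      by (rule bij_betwI[where g = "\<lambda>g. smul b (smul g (sinv c))"])
        (simp_all only: s3_group_simps Pi_UNIV UNIV_I)
  qed
  also have "\<dots> = arr_scale 36 (weight X * weight Y)"
    unfolding mackey_std[OF i(1) j(1)] i(2) j(2) weight_biconj[OF si] weight_biconj[OF sj] ..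
  finally show ?thesis .
qed


subsection \<open>The symmetric group\<close>

definition three_cycle :: "nat \<Rightarrow> nat" where
  "three_cycle x = (if x = 1 then 2 else if x = 2 then 3 else if x = 3 then 1 else x)"

definition swap23 :: "nat \<Rightarrow> nat" where
  "swap23 x = (if x = 2 then 3 else if x = 3 then 2 else x)"

fun rot_perm :: "z3 \<Rightarrow> nat \<Rightarrow> nat" where
  "rot_perm Z0 x = x"
| "rot_perm Z1 x = three_cycle x"
| "rot_perm Z2 x = three_cycle (three_cycle x)"

fun s3_perm :: "s3 \<Rightarrow> nat \<Rightarrow> nat" where
  "s3_perm (r, s) = (\<lambda>x. rot_perm r (if s then swap23 x else x))"

abbreviation S3 :: "(nat \<Rightarrow> nat) monoid" where "S3 \<equiv> sym_group 3"

lemma s3_perm_smul: "s3_perm (smul a b) = s3_perm a \<circ> s3_perm b"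
proof -
  obtain r s r' s' where ab: "a = (r, s)" "b = (r', s')" by (cases a; cases b)
  \<comment> \<open>The relation t c^r = c^-r t, which is the multiplication rule of the
    model.\<close>
  have swap: "swap23 (swap23 x) = x" "swap23 (rot_perm r' x) = rot_perm (neg3 r') (swap23 x)" for x
    by (cases r'; simp add: swap23_def three_cycle_def)+
  have rot: "rot_perm (add3 u v) x = rot_perm u (rot_perm v x)" for u v x
    by (cases u; cases v; simp add: three_cycle_def)
  show ?thesis by (cases s; cases s') (simp_all add: ab fun_eq_iff swap rot)
qed

lemma s3_perm_one: "s3_perm (Z0, False) = id"
  by (simp add: fun_eq_iff)

lemma inj_s3_perm: "inj s3_perm"
proof (rule injI)
  fix a b assume e: "s3_perm a = s3_perm b"
  obtain r s r' s' where ab: "a = (r, s)" "b = (r', s')" by (cases a; cases b)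
  from fun_cong[OF e, of 1] fun_cong[OF e, of 2] show "a = b"
    by (cases r; cases r'; cases s; cases s')
      (simp_all add: ab swap23_def three_cycle_def)
qed

lemma card_UNIV_s3: "card (UNIV :: s3 set) = 6"
  unfolding set_s3_list[symmetric] distinct_card[OF distinct_s3_list] by (simp add: s3_list_def)

text \<open>By counting: the model has six elements, its image consists of permutations, and 3! =
  6.\<close>

lemma range_s3_perm: "range s3_perm = carrier S3"
proof (rule card_subset_eq)
  have carrier: "carrier S3 = {p. p permutes {1..3}}" by (simp add: sym_group_def)
  show "finite (carrier S3)" unfolding carrier by (rule finite_permutations) simp
  have "three_cycle permutes {1..3}"
    by (rule bij_imp_permutes[OF bij_betwI[where g = "three_cycle \<circ> three_cycle"]])
      (auto simp: three_cycle_def)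
  moreover have "swap23 permutes {1..3}"
    by (rule bij_imp_permutes[OF bij_betwI[where g = swap23]]) (auto simp: swap23_def)
  moreover have "s3_perm (r, s) = (case r of Z0 \<Rightarrow> id | Z1 \<Rightarrow> three_cycle | Z2 \<Rightarrow> three_cycle \<circ>
    three_cycle)
      \<circ> (if s then swap23 else id)" for r s
    by (cases r) (simp_all add: fun_eq_iff)
  ultimately have "s3_perm (r, s) permutes {1..3}" for r s
    by (auto intro!: permutes_compose permutes_id split: z3.split)
  then show "range s3_perm \<subseteq> carrier S3" unfolding carrier by auto
  have "card (carrier S3) = 6" unfolding carrier
    by (subst card_permutations[of _ 3]) (simp_all add: fact_numeral)
  then show "card (range s3_perm) = card (carrier S3)"
    by (simp only: card_image[OF inj_s3_perm] card_UNIV_s3)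
qed


declare s3_perm.simps [simp del]

lemma carrier_S3: "carrier S3 = range s3_perm"
  by (rule range_s3_perm[symmetric])

lemma s3_perm_mult: "s3_perm a \<otimes>\<^bsub>S3\<^esub> s3_perm b = s3_perm (smul a b)"
  by (simp add: sym_group_mult s3_perm_smul)

lemma s3_perm_one': "\<one>\<^bsub>S3\<^esub> = s3_perm (Z0, False)"
  by (simp only: sym_group_one s3_perm_one)

lemma s3_perm_inv: "inv\<^bsub>S3\<^esub> (s3_perm a) = s3_perm (sinv a)"
  by (rule group.inv_equality[OF sym_group_is_group])
    (simp_all only: s3_perm_mult smul_sinv s3_perm_one' carrier_S3 rangeI)

lemma finite_S3: "finite (carrier S3)" and order_S3: "order S3 = 6"
  by (simp_all only: order_def carrier_S3 card_image[OF inj_s3_perm] card_UNIV_s3 finite_imageI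
      finite_UNIV_s3)

lemma carrier_S3E:
  assumes "x \<in> carrier S3"
  obtains a where "x = s3_perm a"
  using assms unfolding carrier_S3 by (elim rangeE)

lemma carrier_S3_squareE:
  assumes "x \<in> carrier S3 \<times> carrier S3"
  obtains a b where "x = (s3_perm a, s3_perm b)"
  using assms by (elim SigmaE carrier_S3E) simp

section \<open>Translation between subgroups of permutation pairs and relations on the model\<close>

definition rel_of :: "((nat \<Rightarrow> nat) \<times> (nat \<Rightarrow> nat)) set \<Rightarrow> srel" where
  "rel_of U a b \<longleftrightarrow> (s3_perm a, s3_perm b) \<in> U"

lemma square_S3: "group (S3 \<times>\<times> S3)"
  by (rule DirProd_group) (rule sym_group_is_group)+

lemma subgroup_S3_subset: "subgroup U (S3 \<times>\<times> S3) \<Longrightarrow> U \<subseteq> carrier S3 \<times> carrier S3"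
  by (drule subgroup.subset) simp

lemma rel_of_inject:
  assumes "U \<subseteq> carrier S3 \<times> carrier S3" "V \<subseteq> carrier S3 \<times> carrier S3" "rel_of U = rel_of V"
  shows "U = V"
proof (rule Set.set_eqI)
  fix x
  show "x \<in> U \<longleftrightarrow> x \<in> V"
  proof (cases "x \<in> carrier S3 \<times> carrier S3")
    case True
    then obtain a b where "x = (s3_perm a, s3_perm b)" by (rule carrier_S3_squareE)
    then show ?thesis using fun_cong[OF fun_cong[OF assms(3), of a], of b] by (simp add: rel_of_def)
  qed (use assms(1,2) in blast)
qed

lemma subgroup_rel_of:
  assumes U: "subgroup U (S3 \<times>\<times> S3)"
  shows "subgroup_rel (rel_of U)"
proof -
  have "(s3_perm (Z0, False), s3_perm (Z0, False)) \<in> U"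
    using subgroup.one_closed[OF U] by (simp only: one_DirProd s3_perm_one')
  moreover have "(s3_perm (smul a c), s3_perm (smul b d)) \<in> U"
    if "(s3_perm a, s3_perm b) \<in> U" "(s3_perm c, s3_perm d) \<in> U" for a b c d
    using subgroup.m_closed[OF U that] by (simp only: mult_DirProd s3_perm_mult)
  moreover have "(s3_perm (sinv a), s3_perm (sinv b)) \<in> U"
    if "(s3_perm a, s3_perm b) \<in> U" for a b
    using subgroup.m_inv_closed[OF U that]
    by (simp only: inv_DirProd[OF sym_group_is_group sym_group_is_group] carrier_S3 rangeI
      s3_perm_inv)
  ultimately show ?thesis unfolding subgroup_rel_def rel_of_def by blast
qed

lemma rel_of_relcomp:
  assumes "U \<subseteq> carrier S3 \<times> carrier S3"
  shows "rel_of (U O V) = srel_comp (rel_of U) (rel_of V)"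
proof (intro ext)
  fix a d
  have "(s3_perm a, s3_perm d) \<in> U O V \<longleftrightarrow> (\<exists>y. (s3_perm a, y) \<in> U \<and> (y, s3_perm d) \<in> V)" by blast
  also have "\<dots> \<longleftrightarrow> (\<exists>b. (s3_perm a, s3_perm b) \<in> U \<and> (s3_perm b, s3_perm d) \<in> V)"
    using assms unfolding carrier_S3 by blast
  finally show "rel_of (U O V) a d = srel_comp (rel_of U) (rel_of V) a d"
    unfolding rel_of_def srel_comp_iff .
qed

lemma rel_of_left_conj: "rel_of (group.left_conj S3 (s3_perm g) V) = srel_conj g (rel_of V)"
  by (intro ext) (simp add: rel_of_def srel_conj_def group.left_conj_def[OF sym_group_is_group]
    s3_perm_inv s3_perm_mult carrier_S3 smul_assoc del: smul.simps sinv.simps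
      sym_group_inv_equality)

lemma rel_of_conj:
  assumes "x = (s3_perm a, s3_perm b)"
  shows "rel_of {z \<in> carrier (S3 \<times>\<times> S3). x \<otimes>\<^bsub>S3 \<times>\<times> S3\<^esub> z \<otimes>\<^bsub>S3 \<times>\<times> S3\<^esub> inv\<^bsub>S3 \<times>\<times> S3\<^esub> x \<in> U}
    = srel_biconj (sinv a) (sinv b) (rel_of U)"
  by (intro ext) (simp add: rel_of_def srel_biconj_def assms s3_perm_inv s3_perm_mult carrier_S3
    smul_assoc sinv_sinv inv_DirProd[OF sym_group_is_group sym_group_is_group]
    del: smul.simps sinv.simps sym_group_inv_equality)

lemma card_mid_kernel:
  "of_nat (card (mid_kernel S3 U V)) = (of_int (kernel_size (rel_of U) (rel_of V)) :: rat)"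
proof -
  have "mid_kernel S3 U V = s3_perm ` {h. rel_of U (Z0, False) h \<and> rel_of V h (Z0, False)}"
    unfolding mid_kernel_def rel_of_def carrier_S3 s3_perm_one' by blast
  then show ?thesis
    by (simp add: kernel_size_eq_card card_image inj_on_subset[OF inj_s3_perm])
qed

definition stab_weight :: "((nat \<Rightarrow> nat) \<times> (nat \<Rightarrow> nat)) set \<Rightarrow> arr" where
  "stab_weight U = weight (rel_of U)"

lemma stab_weight_mackey:
  assumes U: "subgroup U (S3 \<times>\<times> S3)" and V: "subgroup V (S3 \<times>\<times> S3)"
  shows "(\<Sum>g\<in>carrier S3. arr_scale (of_nat (card (mid_kernel S3 U (group.left_conj S3 g V))))
       (stab_weight (U O group.left_conj S3 g V)))
    = arr_scale (of_nat (order S3) ^ 2) (stab_weight U * stab_weight V)"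
proof -
  have "(\<Sum>g\<in>carrier S3. arr_scale (of_nat (card (mid_kernel S3 U (group.left_conj S3 g V))))
       (stab_weight (U O group.left_conj S3 g V)))
    = (\<Sum>g\<in>UNIV. arr_scale (of_int (kernel_size (rel_of U) (srel_conj g (rel_of V))))
       (weight (srel_comp (rel_of U) (srel_conj g (rel_of V)))))"
    unfolding carrier_S3 sum.reindex[OF inj_s3_perm] o_def stab_weight_def card_mid_kernel
      rel_of_left_conj rel_of_relcomp[OF subgroup_S3_subset[OF U]] ..
  also have "\<dots> = arr_scale (of_nat (order S3) ^ 2) (stab_weight U * stab_weight V)"
    by (simp add: mackey[OF subgroup_rel_of[OF U] subgroup_rel_of[OF V]] stab_weight_def order_S3)
  finally show ?thesis .
qed

lemma stab_weight_conj:
  assumes U: "subgroup U (S3 \<times>\<times> S3)" and x: "x \<in> carrier (S3 \<times>\<times> S3)"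
  shows "stab_weight {z \<in> carrier (S3 \<times>\<times> S3).
      x \<otimes>\<^bsub>S3 \<times>\<times> S3\<^esub> z \<otimes>\<^bsub>S3 \<times>\<times> S3\<^esub> inv\<^bsub>S3 \<times>\<times> S3\<^esub> x \<in> U} = stab_weight U"
proof -
  obtain a b where "x = (s3_perm a, s3_perm b)"
    using x by (metis carrier_S3_squareE carrier_DirProd)
  from rel_of_conj[OF this] show ?thesis
    unfolding stab_weight_def by (simp only: weight_biconj[OF subgroup_rel_of[OF U]])
qed

definition std_subgroup :: "sgn_type \<times> rot_type \<Rightarrow> ((nat \<Rightarrow> nat) \<times> (nat \<Rightarrow> nat)) set" where
  "std_subgroup i = {(s3_perm a, s3_perm b) | a b. std_rel i a b}"

lemma inj_map_s3_perm: "inj (\<lambda>(a, b). (s3_perm a, s3_perm b))"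
  using inj_s3_perm by (auto simp: inj_def)

lemma rel_of_std_subgroup: "rel_of (std_subgroup i) = std_rel i"
  by (intro ext) (auto simp: rel_of_def std_subgroup_def inj_eq[OF inj_s3_perm])

lemma std_size_check:
  "list_all (\<lambda>i. length (filter (\<lambda>(a, b). std_rel i a b) (List.product s3_list s3_list))
     = nat (std_size i)) std_types"
  by code_simp

lemma std_size_pos: "i \<in> set std_types \<Longrightarrow> std_size i > 0"
  by (auto simp: std_types_def)

lemma card_std_subgroup:
  assumes "i \<in> set std_types"
  shows "of_nat (card (std_subgroup i)) = (of_int (std_size i) :: rat)"
proof -
  have "std_subgroup i = (\<lambda>(a, b). (s3_perm a, s3_perm b)) ` {(a, b). std_rel i a b}"
    unfolding std_subgroup_def by (auto simp del: split_paired_Ex)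
  then have "card (std_subgroup i) = card {(a, b). std_rel i a b}"
    by (simp only: card_image[OF inj_on_subset[OF inj_map_s3_perm subset_UNIV]])
  also have "{(a, b). std_rel i a b} = set (filter (\<lambda>(a, b). std_rel i a b) (List.product s3_list
    s3_list))"
    by (auto simp: set_s3_list)
  also have "card \<dots> = length (filter (\<lambda>(a, b). std_rel i a b) (List.product s3_list s3_list))"
    by (intro distinct_card distinct_filter distinct_product distinct_s3_list)
  also have "\<dots> = nat (std_size i)" using std_size_check assms by (simp add: list_all_iff)
  finally show ?thesis using std_size_pos[OF assms] by simp
qed

lemma subgroup_std_subgroup:
  assumes i: "i \<in> set std_types"
  shows "subgroup (std_subgroup i) (S3 \<times>\<times> S3)"
proof (rule group.subgroupI[OF square_S3])
  note D = subgroup_relD[OF subgroup_rel_std[OF i]]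
  show "std_subgroup i \<subseteq> carrier (S3 \<times>\<times> S3)"
    by (auto simp: std_subgroup_def carrier_S3)
  show "std_subgroup i \<noteq> {}" using D(1) unfolding std_subgroup_def by blast
  show "inv\<^bsub>S3 \<times>\<times> S3\<^esub> x \<in> std_subgroup i" if x: "x \<in> std_subgroup i" for x
  proof -
    obtain a b where ab: "x = (s3_perm a, s3_perm b)" "std_rel i a b"
      using x unfolding std_subgroup_def by blast
    have "inv\<^bsub>S3 \<times>\<times> S3\<^esub> x = (s3_perm (sinv a), s3_perm (sinv b))" unfolding ab
      by (simp only: inv_DirProd[OF sym_group_is_group sym_group_is_group] carrier_S3 rangeI
        s3_perm_inv)
    then show ?thesis unfolding std_subgroup_def using D(3)[OF ab(2)] by blast
  qed
  show "x \<otimes>\<^bsub>S3 \<times>\<times> S3\<^esub> y \<in> std_subgroup i"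
    if x: "x \<in> std_subgroup i" and y: "y \<in> std_subgroup i" for x y
  proof -
    obtain a b where ab: "x = (s3_perm a, s3_perm b)" "std_rel i a b"
      using x unfolding std_subgroup_def by blast
    obtain c d where cd: "y = (s3_perm c, s3_perm d)" "std_rel i c d"
      using y unfolding std_subgroup_def by blast
    have "x \<otimes>\<^bsub>S3 \<times>\<times> S3\<^esub> y = (s3_perm (smul a c), s3_perm (smul b d))" unfolding ab cd
      by (simp only: mult_DirProd s3_perm_mult)
    then show ?thesis unfolding std_subgroup_def using D(2)[OF ab(2) cd(2)] by blast
  qed
qed

lemma type_of_std: "i \<in> set std_types \<Longrightarrow> type_of (std_rel i) = i"
  using type_of_biconj_std[of i "(Z0, False)" "(Z0, False)"] by (simp only: srel_biconj_one)

text \<open>The number of cosets, 36/|U|, cancels the normalisation |U|/36 of the weight.\<close>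

lemma stab_sum_std:
  assumes i: "i \<in> set std_types"
  shows "stab_sum S3 stab_weight (coset_biset S3 (std_subgroup i)) = rep_arr i"
proof -
  note U = subgroup_std_subgroup[OF i]
  have "stab_sum S3 stab_weight (coset_biset S3 (std_subgroup i))
      = arr_scale (of_nat (order S3) ^ 2 / of_nat (card (std_subgroup i))) (stab_weight
        (std_subgroup i))"
    by (rule group.stab_sum_coset_biset[OF sym_group_is_group finite_S3 U stab_weight_conj[OF U]])
  also have "\<dots> = arr_scale (36 / of_int (std_size i)) (arr_scale (of_int (std_size i) / 36)
    (rep_arr i))"
    by (simp add: card_std_subgroup[OF i] order_S3 stab_weight_def rel_of_std_subgroup weight_def
        type_of_std[OF i])
  finally show ?thesis using std_size_pos[OF i] by (simp add: arr_scale_scale arr_scale_one)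
qed

text \<open>The diagonal is the standard subgroup of type \<open>(QD, PD)\<close> and order 6, and
  the coordinates of this type are those of the identity of A. Thus the unit goes to the
  unit.\<close>

lemma stab_sum_regular_S3: "stab_sum S3 stab_weight (regular_biset S3) = 1"
proof -
  have mem: "(QD, PD) \<in> set std_types" by (simp add: std_types_iff)
  have rel: "rel_of (Id_on (carrier S3)) = std_rel (QD, PD)"
    by (intro ext) (auto simp: rel_of_def Id_on_def carrier_S3 inj_eq[OF inj_s3_perm])
  have w: "weight (srel_conj a (std_rel (QD, PD))) = arr_scale (1 / 6) 1" for a
    unfolding srel_conj_eq_biconj weight_biconj[OF subgroup_rel_std[OF mem]]
    by (simp add: weight_def type_of_std[OF mem] rep_arr_def arr_of_int_tab_def one_arr_def
      arr_one_tab
        arr_scale_scale)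
  have *: "stab_weight (group.left_conj S3 x (Id_on (carrier S3))) = arr_scale (1 / 6) 1"
    if mem: "x \<in> carrier S3" for x
  proof -
    obtain a where x: "x = s3_perm a" using mem by (rule carrier_S3E)
    show ?thesis unfolding stab_weight_def x rel_of_left_conj rel w ..
  qed
  have **: "stab_weight (Id_on (carrier S3)) = arr_scale (1 / 6) 1"
    using w[of "(Z0, False)"]
    by (simp only: stab_weight_def rel srel_conj_eq_biconj srel_biconj_one)
  show ?thesis
    using group.stab_sum_regular[OF sym_group_is_group finite_S3, of stab_weight]
    by (simp add: * ** order_S3 arr_scale_scale arr_scale_one)
qed

lemma stab_sum_tensor_S3:
  assumes "finite_biset S3 M" "finite_biset S3 N"
  shows "stab_sum S3 stab_weight (biset_tensor S3 M N)
    = stab_sum S3 stab_weight M * stab_sum S3 stab_weight N"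
proof -
  interpret biset_pair S3 M N
    using assms finite_S3 by (intro biset_pair.intro sym_group_is_group biset_pair_axioms.intro)
  show ?thesis by (rule stab_sum_tensor) (rule stab_weight_mackey)
qed

lemma subgroup_S3_classification:
  assumes U: "subgroup U (S3 \<times>\<times> S3)"
  shows "\<exists>i\<in>set std_types. biset_iso S3 (coset_biset S3 U) (coset_biset S3 (std_subgroup i))"
proof -
  obtain i g h where i: "i \<in> set std_types" and r: "rel_of U = srel_biconj g h (std_rel i)"
    using subgroup_rel_classification[OF subgroup_rel_of[OF U]] by blast
  \<comment> \<open>Inverses are taken because \<open>rel_of_conj\<close> inverts the conjugating
    pair.\<close>
  let ?x = "(s3_perm (sinv g), s3_perm (sinv h))"
  let ?V = "{z \<in> carrier (S3 \<times>\<times> S3).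
    ?x \<otimes>\<^bsub>S3 \<times>\<times> S3\<^esub> z \<otimes>\<^bsub>S3 \<times>\<times> S3\<^esub> inv\<^bsub>S3 \<times>\<times> S3\<^esub> ?x \<in> std_subgroup i}"
  have "rel_of ?V = rel_of U"
    using rel_of_conj[OF refl, of "sinv g" "sinv h" "std_subgroup i"]
    by (simp only: r rel_of_std_subgroup sinv_sinv)
  then have "?V = U" by (rule rel_of_inject[rotated 2]) (use subgroup_S3_subset[OF U] in auto)
  moreover have "?x \<in> carrier (S3 \<times>\<times> S3)" by (simp add: carrier_S3)
  ultimately show ?thesis
    using group.coset_biset_conj_iso[OF sym_group_is_group finite_S3 subgroup_std_subgroup[OF i],
      of ?x] i
    by auto
qed


section \<open>The localised integers\<close>

lemma Z_loc_setI: "\<not> int p dvd b \<Longrightarrow> of_int a / of_int b \<in> Z_loc_set p"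
  unfolding Z_loc_set_def by blast

context
  fixes p :: nat
  assumes p: "prime p"
begin

lemma Z_loc_set_Ints: "x \<in> \<int> \<Longrightarrow> x \<in> Z_loc_set p"
  using Z_loc_setI[of p 1] p by (auto simp: Ints_def prime_nat_iff)

lemma Z_loc_set_add:
  assumes "x \<in> Z_loc_set p" "y \<in> Z_loc_set p"
  shows "x + y \<in> Z_loc_set p"
proof -
  obtain a b c d where x: "x = of_int a / of_int b" "\<not> int p dvd b"
    and y: "y = of_int c / of_int d" "\<not> int p dvd d" using assms unfolding Z_loc_set_def by blast
  have "b \<noteq> 0" "d \<noteq> 0" using x(2) y(2) by auto
  then have "x + y = of_int (a * d + c * b) / of_int (b * d)" by (simp add: x y field_simps)
  moreover have "\<not> int p dvd b * d" using x(2) y(2) p by (simp add: prime_dvd_mult_iff)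
  ultimately show ?thesis using Z_loc_setI by metis
qed

lemma Z_loc_set_mult:
  assumes "x \<in> Z_loc_set p" "y \<in> Z_loc_set p"
  shows "x * y \<in> Z_loc_set p"
proof -
  obtain a b c d where x: "x = of_int a / of_int b" "\<not> int p dvd b"
    and y: "y = of_int c / of_int d" "\<not> int p dvd d" using assms unfolding Z_loc_set_def by blast
  have "x * y = of_int (a * c) / of_int (b * d)" by (simp add: x y)
  moreover have "\<not> int p dvd b * d" using x(2) y(2) p by (simp add: prime_dvd_mult_iff)
  ultimately show ?thesis using Z_loc_setI by metis
qed

lemma Z_loc_set_uminus: "x \<in> Z_loc_set p \<Longrightarrow> - x \<in> Z_loc_set p"
  using Z_loc_set_mult[OF Z_loc_set_Ints[of "- 1"]] by simp

lemma Z_loc_set_diff: "x \<in> Z_loc_set p \<Longrightarrow> y \<in> Z_loc_set p \<Longrightarrow> x - y \<in> Z_loc_set p"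
  using Z_loc_set_add[OF _ Z_loc_set_uminus] by (simp only: diff_conv_add_uminus)

lemma Z_loc_set_divide: "x \<in> Z_loc_set p \<Longrightarrow> \<not> int p dvd b \<Longrightarrow> x / of_int b \<in> Z_loc_set p"
  using Z_loc_set_mult[OF _ Z_loc_setI[of p b 1]] by simp

lemma Z_loc_set_sum: "(\<And>x. x \<in> A \<Longrightarrow> f x \<in> Z_loc_set p) \<Longrightarrow> sum f A \<in> Z_loc_set p"
  by (induction A rule: infinite_finite_induct) (auto intro: Z_loc_set_add Z_loc_set_Ints)

lemma cring_Z_loc: "cring (Z_loc p)"
proof (rule cringI)
  show "abelian_group (Z_loc p)"
  proof (rule abelian_groupI)
    fix x assume "x \<in> carrier (Z_loc p)"
    then show "\<exists>y\<in>carrier (Z_loc p). y \<oplus>\<^bsub>Z_loc p\<^esub> x = \<zero>\<^bsub>Z_loc p\<^esub>"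
      by (intro bexI[of _ "- x"]) (auto simp: Z_loc_def intro: Z_loc_set_uminus)
  qed (auto simp: Z_loc_def intro: Z_loc_set_add Z_loc_set_Ints)
  show "comm_monoid (Z_loc p)"
    by (rule comm_monoidI) (auto simp: Z_loc_def intro: Z_loc_set_mult Z_loc_set_Ints)
qed (auto simp: Z_loc_def algebra_simps)

lemma finsum_Z_loc:
  assumes "\<And>x. x \<in> A \<Longrightarrow> f x \<in> Z_loc_set p"
  shows "finsum (Z_loc p) f A = sum f A"
proof -
  interpret cring "Z_loc p" by (rule cring_Z_loc)
  show ?thesis using assms
  proof (induction A rule: infinite_finite_induct)
    case (insert x A)
    then have "finsum (Z_loc p) f (insert x A) = f x \<oplus>\<^bsub>Z_loc p\<^esub> finsum (Z_loc p) f A"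
      by (intro finsum_insert) (auto simp: Z_loc_def)
    then show ?case using insert by (simp add: Z_loc_def)
  next
    case empty
    show ?case using finsum_empty[of f] by (simp add: Z_loc_def)
  next
    case (infinite A)
    then show ?case using finsum_infinite[of A f] by (simp add: Z_loc_def)
  qed
qed

text \<open>The product of the denominators works, since p is prime. It is used to multiply a whole
  array into the integers.\<close>

lemma common_denominator:
  assumes "finite S" "S \<subseteq> Z_loc_set p"
  shows "\<exists>d. \<not> int p dvd d \<and> (\<forall>x\<in>S. of_int d * x \<in> \<int>)"
  using assms
proof (induction S rule: finite_induct)
  case empty
  have "\<not> int p dvd 1" using p by (simp add: prime_nat_iff)
  then show ?case by blast
next
  case (insert x S)
  then obtain d where d: "\<not> int p dvd d" "\<forall>x\<in>S. of_int d * x \<in> \<int>" by auto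
  obtain a b where x: "x = of_int a / of_int b" "\<not> int p dvd b"
    using insert.prems unfolding Z_loc_set_def by blast
  have b: "b \<noteq> 0" using x(2) by auto
  have "\<not> int p dvd b * d" using x(2) d(1) p by (simp add: prime_dvd_mult_iff)
  moreover have "of_int (b * d) * y \<in> \<int>" if "y \<in> insert x S" for y
  proof (cases "y = x")
    case True
    have "of_int (b * d) * y = (of_int (d * a) :: rat)" using b by (simp add: True x(1))
    then show ?thesis by (metis Ints_of_int)
  next
    case False
    then have "of_int d * y \<in> \<int>" using that d(2) by blast
    from Ints_mult[OF Ints_of_int this, of b] show ?thesis by (simp add: algebra_simps)
  qed
  ultimately show ?case by blast
qed

end


section \<open>The order $\Lambda_{(3)}$\<close>

abbreviation (input) "R3 \<equiv> Z_loc_set 3"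

lemma prime_3: "prime (3::nat)" by simp

lemmas R3_closed = Z_loc_set_add[OF prime_3] Z_loc_set_mult[OF prime_3] Z_loc_set_uminus[OF prime_3]
  Z_loc_set_diff[OF prime_3]

lemma R3_Ints: "x \<in> \<int> \<Longrightarrow> x \<in> R3"
  using Z_loc_set_Ints[OF prime_3] .

lemma R3_numeral: "0 \<in> R3" "1 \<in> R3" "numeral k \<in> R3"
  by (simp_all add: R3_Ints)

lemma R3_half: "x \<in> R3 \<Longrightarrow> x / 2 \<in> R3" "x \<in> R3 \<Longrightarrow> x / 4 \<in> R3"
  using Z_loc_set_divide[OF prime_3, of x 2] Z_loc_set_divide[OF prime_3, of x 4] by simp_all

definition Lambda3 :: "arr set" where
  "Lambda3 = {Arr s t u v w x y (qelt z1 z2 z3) | s t u v w x y z1 z2 z3.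
     Arr s t u v w x y (qelt z1 z2 z3) \<in> A_over R3 \<and>
     (\<forall>i. cong_in R3 3 (x $ i) 0) \<and> cong_in R3 3 z2 0}"

lemma A_over_iff:
  "Arr s t u v w x y (qelt z1 z2 z3) \<in> A_over R \<longleftrightarrow>
     (\<forall>i j. s $ i $ j \<in> R) \<and> (\<forall>i. t $ i \<in> R) \<and> u \<in> R \<and> v \<in> R \<and> w \<in> R \<and>
     (\<forall>i. x $ i \<in> R) \<and> y \<in> R \<and> z1 \<in> R \<and> z2 \<in> R \<and> z3 \<in> R"
  unfolding A_over_def mem_Collect_eq arr.inject qelt_eq_iff by blast

lemma A_over_arr_of_tab:
  "arr_of_tab (Tab a0 a1 a2 a3 a4 a5 a6 a7 a8 a9 a10 a11 a12 a13 a14 a15 a16 a17 a18 a19 a20 a21)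
    \<in> A_over R \<longleftrightarrow>
   {a0, a1, a2, a3, a4, a5, a6, a7, a8, a9, a10, a11, a12, a13, a14, a15, a16, a17, a18, a19, a20,
     a21} \<subseteq> R"
  by (simp add: A_over_iff forall_3)

lemma Lambda3_tab:
  "arr_of_tab (Tab a0 a1 a2 a3 a4 a5 a6 a7 a8 a9 a10 a11 a12 a13 a14 a15 a16 a17 a18 a19 a20 a21)
    \<in> Lambda3 \<longleftrightarrow>
   {a0, a1, a2, a3, a4, a5, a6, a7, a8, a9, a10, a11, a12, a13, a14, a15, a16, a17, a18, a19, a20,
     a21} \<subseteq> R3 \<and>
   (\<exists>k\<in>R3. a15 = 3 * k) \<and> (\<exists>k\<in>R3. a16 = 3 * k) \<and> (\<exists>k\<in>R3. a17 = 3 * k) \<and> (\<exists>k\<in>R3. a20 = 3 * k)"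
proof -
  have "arr_of_tab (Tab a0 a1 a2 a3 a4 a5 a6 a7 a8 a9 a10 a11 a12 a13 a14 a15 a16 a17 a18 a19 a20
    a21) \<in> Lambda3 \<longleftrightarrow>
    arr_of_tab (Tab a0 a1 a2 a3 a4 a5 a6 a7 a8 a9 a10 a11 a12 a13 a14 a15 a16 a17 a18 a19 a20 a21)
      \<in> A_over R3 \<and>
    (\<forall>i. cong_in R3 3 ((vector [a15, a16, a17] :: rat ^ 3) $ i) 0) \<and> cong_in R3 3 a20 0"
    unfolding Lambda3_def mem_Collect_eq arr_of_tab.simps arr.inject qelt_eq_iff by blast
  then show ?thesis unfolding A_over_arr_of_tab by (simp add: forall_3 cong_in_def)
qed

text \<open>Pulling the factor 3 out of x_1, x_2, x_3 and z_2 replaces the congruences by a free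
  parametrisation over R.\<close>

lemma Lambda3E:
  assumes "a \<in> Lambda3"
  obtains a0 a1 a2 a3 a4 a5 a6 a7 a8 a9 a10 a11 a12 a13 a14 a15 a16 a17 a18 a19 a20 a21 where
    "{a0, a1, a2, a3, a4, a5, a6, a7, a8, a9, a10, a11, a12, a13, a14, a15, a16, a17, a18, a19,
      a20, a21} \<subseteq> R3"
    "a = arr_of_tab (Tab a0 a1 a2 a3 a4 a5 a6 a7 a8 a9 a10 a11 a12 a13 a14 (3 * a15) (3 * a16)
      (3 * a17) a18 a19 (3 * a20) a21)"
proof -
  obtain T where T: "a = arr_of_tab T" using arr_of_tab_surj by blast
  obtain a0 a1 a2 a3 a4 a5 a6 a7 a8 a9 a10 a11 a12 a13 a14 a15 a16 a17 a18 a19 a20 a21 where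
    T': "T = Tab a0 a1 a2 a3 a4 a5 a6 a7 a8 a9 a10 a11 a12 a13 a14 a15 a16 a17 a18 a19 a20 a21"
      by (cases T)
  obtain k15 k16 k17 k20 where k: "k15 \<in> R3" "k16 \<in> R3" "k17 \<in> R3" "k20 \<in> R3"
    "a15 = 3 * k15" "a16 = 3 * k16" "a17 = 3 * k17" "a20 = 3 * k20"
    using assms unfolding T T' Lambda3_tab by blast
  have "{a0, a1, a2, a3, a4, a5, a6, a7, a8, a9, a10, a11, a12, a13, a14, k15, k16, k17, a18, a19,
    k20, a21} \<subseteq> R3"
    using assms k unfolding T T' Lambda3_tab by blast
  then show thesis by (rule that) (simp only: T T' k(5-8))
qed

lemma Lambda3I:
  assumes "{a0, a1, a2, a3, a4, a5, a6, a7, a8, a9, a10, a11, a12, a13, a14, a15, a16, a17, a18,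
    a19, a20, a21} \<subseteq> R3"
  shows "arr_of_tab (Tab a0 a1 a2 a3 a4 a5 a6 a7 a8 a9 a10 a11 a12 a13 a14 (3 * a15) (3 * a16)
    (3 * a17) a18 a19 (3 * a20) a21) \<in> Lambda3"
  using assms unfolding Lambda3_tab by (auto intro: R3_closed R3_numeral)

lemma Lambda3_add:
  assumes "a \<in> Lambda3" "b \<in> Lambda3"
  shows "a + b \<in> Lambda3"
proof -
  obtain a0 a1 a2 a3 a4 a5 a6 a7 a8 a9 a10 a11 a12 a13 a14 a15 a16 a17 a18 a19 a20 a21 where
    a: "{a0, a1, a2, a3, a4, a5, a6, a7, a8, a9, a10, a11, a12, a13, a14, a15, a16, a17, a18, a19,
      a20, a21} \<subseteq> R3"
    "a = arr_of_tab (Tab a0 a1 a2 a3 a4 a5 a6 a7 a8 a9 a10 a11 a12 a13 a14 (3 * a15) (3 * a16)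
      (3 * a17) a18 a19 (3 * a20) a21)" by (rule Lambda3E[OF assms(1)])
  obtain b0 b1 b2 b3 b4 b5 b6 b7 b8 b9 b10 b11 b12 b13 b14 b15 b16 b17 b18 b19 b20 b21 where
    b: "{b0, b1, b2, b3, b4, b5, b6, b7, b8, b9, b10, b11, b12, b13, b14, b15, b16, b17, b18, b19,
      b20, b21} \<subseteq> R3"
    "b = arr_of_tab (Tab b0 b1 b2 b3 b4 b5 b6 b7 b8 b9 b10 b11 b12 b13 b14 (3 * b15) (3 * b16)
      (3 * b17) b18 b19 (3 * b20) b21)" by (rule Lambda3E[OF assms(2)])
  have "{a0 + b0, a1 + b1, a2 + b2, a3 + b3, a4 + b4, a5 + b5, a6 + b6, a7 + b7, a8 + b8, a9 + b9,
    a10 + b10, a11 + b11, a12 + b12, a13 + b13, a14 + b14, a15 + b15, a16 + b16, a17 + b17, a18 +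
    b18, a19 + b19, a20 + b20, a21 + b21} \<subseteq> R3"
    using a(1) b(1) by (auto intro: R3_closed)
  from Lambda3I[OF this] show ?thesis by (simp only: a(2) b(2) arr_tab tab_add.simps distrib_left)
qed

lemma Lambda3_scale:
  assumes "k \<in> R3" "a \<in> Lambda3"
  shows "arr_scale k a \<in> Lambda3"
proof -
  obtain a0 a1 a2 a3 a4 a5 a6 a7 a8 a9 a10 a11 a12 a13 a14 a15 a16 a17 a18 a19 a20 a21 where
    a: "{a0, a1, a2, a3, a4, a5, a6, a7, a8, a9, a10, a11, a12, a13, a14, a15, a16, a17, a18, a19,
      a20, a21} \<subseteq> R3"
    "a = arr_of_tab (Tab a0 a1 a2 a3 a4 a5 a6 a7 a8 a9 a10 a11 a12 a13 a14 (3 * a15) (3 * a16)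
      (3 * a17) a18 a19 (3 * a20) a21)" by (rule Lambda3E[OF assms(2)])
  have "{k * a0, k * a1, k * a2, k * a3, k * a4, k * a5, k * a6, k * a7, k * a8, k * a9, k * a10,
    k * a11, k * a12, k * a13, k * a14, k * a15, k * a16, k * a17, k * a18, k * a19, k * a20, k *
    a21} \<subseteq> R3"
    using a(1) assms(1) by (auto intro: R3_closed)
  from Lambda3I[OF this] show ?thesis
    by (simp only: a(2) arr_tab tab_scale.simps mult.left_commute[of 3])
qed

text \<open>Every term of the new x-entries contains an x-entry of one of the factors. Every term of
  the new z_2 contains an x-entry or a z_2, apart from the one with coefficient 12, which is itself
  divisible by 3.\<close>

lemma Lambda3_mult:
  assumes "a \<in> Lambda3" "b \<in> Lambda3"
  shows "a * b \<in> Lambda3"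
proof -
  obtain a0 a1 a2 a3 a4 a5 a6 a7 a8 a9 a10 a11 a12 a13 a14 a15 a16 a17 a18 a19 a20 a21 where
    a: "{a0, a1, a2, a3, a4, a5, a6, a7, a8, a9, a10, a11, a12, a13, a14, a15, a16, a17, a18, a19,
      a20, a21} \<subseteq> R3"
    "a = arr_of_tab (Tab a0 a1 a2 a3 a4 a5 a6 a7 a8 a9 a10 a11 a12 a13 a14 (3 * a15) (3 * a16)
      (3 * a17) a18 a19 (3 * a20) a21)" by (rule Lambda3E[OF assms(1)])
  obtain b0 b1 b2 b3 b4 b5 b6 b7 b8 b9 b10 b11 b12 b13 b14 b15 b16 b17 b18 b19 b20 b21 where
    b: "{b0, b1, b2, b3, b4, b5, b6, b7, b8, b9, b10, b11, b12, b13, b14, b15, b16, b17, b18, b19,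
      b20, b21} \<subseteq> R3"
    "b = arr_of_tab (Tab b0 b1 b2 b3 b4 b5 b6 b7 b8 b9 b10 b11 b12 b13 b14 (3 * b15) (3 * b16)
      (3 * b17) b18 b19 (3 * b20) b21)" by (rule Lambda3E[OF assms(2)])
  let ?x = "\<lambda>u v w b. a15 * u + a16 * v + a17 * w + a19 * b"
  have x: "3 * a15 * u + 3 * a16 * v + 3 * a17 * w + a19 * (3 * b) = 3 * ?x u v w b" for u v w b
    by (simp add: algebra_simps)
  have z: "3 * a15 * b9 + 3 * a16 * b10 + 3 * a17 * b11 - 12 * (a18 * b13) + a19 * (3 * b20) + 3 *
    a20 * b19
     = 3 * (a15 * b9 + a16 * b10 + a17 * b11 - 4 * (a18 * b13) + a19 * b20 + a20 * b19)"
    by (simp add: algebra_simps)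
  show ?thesis unfolding a(2) b(2) times_arr_def arr_mult_tab tab_mult.simps x z
    by (rule Lambda3I) (use a(1) b(1) in \<open>auto intro!: R3_closed R3_numeral\<close>)
qed

lemma Lambda3_zero: "0 \<in> Lambda3" and Lambda3_one: "1 \<in> Lambda3"
  unfolding zero_arr_def one_arr_def arr_zero_tab arr_one_tab Lambda3_tab
  by (auto intro: R3_numeral exI[of _ 0] bexI[of _ 0])

lemma Lambda3_sum: "(\<And>x. x \<in> A \<Longrightarrow> f x \<in> Lambda3) \<Longrightarrow> sum f A \<in> Lambda3"
  by (induction A rule: infinite_finite_induct) (auto intro: Lambda3_add Lambda3_zero)

section \<open>Subalgebras of A over the localised integers\<close>

lemma A_alg_simps [simp]:
  "carrier A_alg = UNIV" "mult A_alg = (*)" "one A_alg = 1" "zero A_alg = 0" "add A_alg = (+)"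
  "smult A_alg = arr_scale"
  by (simp_all add: A_alg_def fun_eq_iff times_arr_def plus_arr_def one_arr_def zero_arr_def)

lemma Z_loc_simps [simp]:
  "carrier (Z_loc p) = Z_loc_set p" "mult (Z_loc p) = (*)" "one (Z_loc p) = 1" "zero (Z_loc p) = 0"
  "add (Z_loc p) = (+)"
  by (simp_all add: Z_loc_def)

lemma is_algebra_A_alg_restrict:
  assumes p: "prime p" and S: "1 \<in> S" "0 \<in> S"
    and add: "\<And>a b. a \<in> S \<Longrightarrow> b \<in> S \<Longrightarrow> a + b \<in> S"
    and mult: "\<And>a b. a \<in> S \<Longrightarrow> b \<in> S \<Longrightarrow> a * b \<in> S"
    and scale: "\<And>k a. k \<in> Z_loc_set p \<Longrightarrow> a \<in> S \<Longrightarrow> arr_scale k a \<in> S"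
  shows "is_algebra (Z_loc p) (A_alg\<lparr>carrier := S\<rparr>)"
proof -
  have ag: "abelian_group (A_alg\<lparr>carrier := S\<rparr>)"
  proof (rule abelian_groupI)
    fix x assume "x \<in> carrier (A_alg\<lparr>carrier := S\<rparr>)"
    then have "arr_scale (- 1) x \<in> S" using scale[of "- 1" x] Z_loc_set_Ints[OF p, of "- 1"] by simp
    moreover have "arr_scale (- 1) x + x = 0" by (simp flip: uminus_arr_def)
    ultimately show "\<exists>y\<in>carrier (A_alg\<lparr>carrier := S\<rparr>).
        y \<oplus>\<^bsub>A_alg\<lparr>carrier := S\<rparr>\<^esub> x = \<zero>\<^bsub>A_alg\<lparr>carrier := S\<rparr>\<^esub>" by auto
  qed (use S add in \<open>auto simp: algebra_simps\<close>)
  have "Ring.ring (A_alg\<lparr>carrier := S\<rparr>)"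
    by (rule ringI[OF ag]) (use S mult in \<open>auto intro!: monoidI simp: algebra_simps\<close>)
  moreover have "Module.module (Z_loc p) (A_alg\<lparr>carrier := S\<rparr>)"
    by (rule moduleI[OF cring_Z_loc[OF p] ag])
      (use scale in \<open>auto simp: arr_scale_add_left arr_scale_add_right arr_scale_scale
        arr_scale_one\<close>)
  ultimately show ?thesis
    by (simp add: is_algebra_def arr_scale_mult_left arr_scale_mult_right)
qed

lemma is_algebra_Lambda3: "is_algebra (Z_loc 3) (A_alg\<lparr>carrier := Lambda3\<rparr>)"
  by (rule is_algebra_A_alg_restrict)
    (auto intro: Lambda3_zero Lambda3_one Lambda3_add Lambda3_mult Lambda3_scale)

lemma module_A_alg: "Module.module (Z_loc 3) A_alg"
proof -
  have "A_alg\<lparr>carrier := UNIV\<rparr> = A_alg" by (simp add: A_alg_def)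
  with is_algebra_A_alg_restrict[OF prime_3, of UNIV] show ?thesis by (simp add: is_algebra_def)
qed

text \<open>The inclusion of X in the carrier makes the family of submodules to be intersected
  nonempty.\<close>

lemma (in module) generated_submodule_is_submodule:
  assumes "X \<subseteq> carrier M"
  shows "submodule (generated_submodule R M X) R M"
proof (rule submoduleI)
  let ?S = "{N. submodule N R M \<and> X \<subseteq> N}"
  have "carrier M \<in> ?S" using carrier_is_submodule assms by simp
  then show "generated_submodule R M X \<subseteq> carrier M" unfolding generated_submodule_def by blast
  show "\<zero>\<^bsub>M\<^esub> \<in> generated_submodule R M X"
    unfolding generated_submodule_def using subgroup.one_closed[OF submodule.axioms(1)] by fastforce
qed (use submoduleE in \<open>auto simp: generated_submodule_def\<close>)

section \<open>Comparison of Lambda with its localisation at 3\<close>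

lemma Lambda_subset_Lambda3: "Lambda \<subseteq> Lambda3"
proof
  fix a assume a: "a \<in> Lambda"
  have "A_over \<int> \<subseteq> A_over R3"
    unfolding A_over_def using R3_Ints by blast
  moreover have "cong_in R3 m x y" if "cong_in \<int> m x y" for m x y
    using that R3_Ints unfolding cong_in_def by blast
  ultimately show "a \<in> Lambda3" using a unfolding Lambda_def Lambda3_def by blast
qed

text \<open>The 2-power moduli in the definition of Lambda are 2, 4 and 8, so multiplication by 8
  satisfies all these congruences at once. The conditions modulo 3 are built into the form of the
  array.\<close>

lemma Lambda_tabI:
  assumes "{a0, a1, a2, a3, a4, a5, a6, a7, a8, a9, a10, a11, a12, a13, a14, a15, a16, a17, a18,
    a19, a20, a21} \<subseteq> \<int>"
  shows "arr_scale 8 (arr_of_tab (Tab a0 a1 a2 a3 a4 a5 a6 a7 a8 a9 a10 a11 a12 a13 a14 (3 * a15)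
    (3 * a16) (3 * a17) a18 a19 (3 * a20) a21)) \<in> Lambda"
proof -
  let ?T = "Tab (8 * a0) (8 * a1) (8 * a2) (8 * a3) (8 * a4) (8 * a5) (8 * a6) (8 * a7) (8 * a8)
    (8 * a9) (8 * a10) (8 * a11) (8 * a12) (8 * a13) (8 * a14) (8 * (3 * a15)) (8 * (3 * a16))
    (8 * (3 * a17)) (8 * a18) (8 * a19) (8 * (3 * a20)) (8 * a21)"
  have 1: "arr_of_tab ?T \<in> A_over \<int>"
    unfolding A_over_arr_of_tab using assms by (auto intro: Ints_mult)
  have z: "cong_in \<int> 8 (8 * x) 0" "cong_in \<int> 4 (8 * x) 0" "cong_in \<int> 2 (8 * x) 0"
    if x: "x \<in> \<int>" for x
  proof -
    have "cong_in \<int> m (8 * x) 0" if "8 * x = m * (k * x)" "k \<in> \<int>" for m k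
      using that x unfolding cong_in_def by (intro bexI[of _ "k * x"]) simp_all
    from this[of 8 1] this[of 4 2] this[of 2 4]
    show "cong_in \<int> 8 (8 * x) 0" "cong_in \<int> 4 (8 * x) 0" "cong_in \<int> 2 (8 * x) 0" by simp_all
  qed
  have z24: "cong_in \<int> 8 (24 * x) 0" "cong_in \<int> 4 (24 * x) 0" "cong_in \<int> 2 (24 * x) 0"
    "cong_in \<int> 3 (24 * x) 0" if x: "x \<in> \<int>" for x
  proof -
    have "cong_in \<int> m (24 * x) 0" if "24 * x = m * (k * x)" "k \<in> \<int>" for m k
      using that x unfolding cong_in_def by (intro bexI[of _ "k * x"]) simp_all
    from this[of 8 3] this[of 4 6] this[of 2 12] this[of 3 8]
    show "cong_in \<int> 8 (24 * x) 0" "cong_in \<int> 4 (24 * x) 0" "cong_in \<int> 2 (24 * x) 0"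
      "cong_in \<int> 3 (24 * x) 0" by simp_all
  qed
  have c: "cong_in \<int> m x y" if "cong_in \<int> m (x - y) 0" for m x y
    using that unfolding cong_in_def by simp
  have "arr_of_tab ?T \<in> Lambda"
    unfolding Lambda_def mem_Collect_eq
  proof (intro exI conjI)
    show "arr_of_tab ?T = Arr (vector [vector [8 * a0, 8 * a1, 8 * a2], vector [8 * a3, 8 * a4, 8
      * a5],
        vector [8 * a6, 8 * a7, 8 * a8]]) (vector [8 * a9, 8 * a10, 8 * a11]) (8 * a12) (8 * a13)
        (8 * a14) (vector [8 * (3 * a15), 8 * (3 * a16), 8 * (3 * a17)]) (8 * a18)
        (qelt (8 * a19) (8 * (3 * a20)) (8 * a21))" by simp
    show "Arr (vector [vector [8 * a0, 8 * a1, 8 * a2], vector [8 * a3, 8 * a4, 8 * a5],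
        vector [8 * a6, 8 * a7, 8 * a8]]) (vector [8 * a9, 8 * a10, 8 * a11]) (8 * a12) (8 * a13)
        (8 * a14) (vector [8 * (3 * a15), 8 * (3 * a16), 8 * (3 * a17)]) (8 * a18)
        (qelt (8 * a19) (8 * (3 * a20)) (8 * a21)) \<in> A_over \<int>" using 1 by simp
    have "cong_in \<int> 8 (8 * (2 * a14 - 2 * a19 - 3 * a20)) 0"
      using assms by (intro z) (auto intro!: Ints_mult Ints_diff)
    moreover have "8 * (2 * a14 - 2 * a19 - 3 * a20) = 2 * (8 * a14) - 2 * (8 * a19) - 8 * (3 *
      a20)"
      by simp
    ultimately show "cong_in \<int> 8 (2 * (8 * a14) - 2 * (8 * a19)) (8 * (3 * a20))"
      using c by (simp only:)
    have "cong_in \<int> 4 (8 * (3 * a20 - a21)) 0"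
      using assms by (intro z) (auto intro!: Ints_mult Ints_diff)
    moreover have "8 * (3 * a20 - a21) = 8 * (3 * a20) - 8 * a21" by simp
    ultimately show "cong_in \<int> 4 (8 * (3 * a20)) (8 * a21)" using c by (simp only:)
  qed (use assms in \<open>simp_all add: forall_3 z z24\<close>)
  then show ?thesis by (simp add: arr_scale_tab del: arr_of_tab.simps)
qed

text \<open>For the harder inclusion, let d clear the denominators of an array a. Then 8 d a lies in
  Lambda, and 8 d is a unit of Z_(3) because 3 does not divide d.\<close>

lemma Lambda_loc_3: "Lambda_loc 3 = Lambda3"
proof
  interpret M: module "Z_loc 3" A_alg by (rule module_A_alg)
  have neg: "\<ominus>\<^bsub>A_alg\<^esub> a = arr_scale (- 1) a" for a
  proof -
    have "arr_scale (- 1) a + a = 0" by (simp flip: uminus_arr_def)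
    then show ?thesis using M.M.minus_equality[of "arr_scale (- 1) a" a] by simp
  qed
  have "submodule Lambda3 (Z_loc 3) A_alg"
    by (rule M.submoduleI)
      (auto simp: neg intro: Lambda3_zero Lambda3_add Lambda3_scale R3_closed(3) R3_numeral)
  then show "Lambda_loc 3 \<subseteq> Lambda3"
    unfolding Lambda_loc_def generated_submodule_def using Lambda_subset_Lambda3 by blast
  show "Lambda3 \<subseteq> Lambda_loc 3"
    unfolding Lambda_loc_def generated_submodule_def
  proof (intro subsetI InterI, unfold mem_Collect_eq, elim conjE)
    fix a N assume a: "a \<in> Lambda3" and N: "submodule N (Z_loc 3) A_alg" and sub: "Lambda \<subseteq> N"
    obtain a0 a1 a2 a3 a4 a5 a6 a7 a8 a9 a10 a11 a12 a13 a14 a15 a16 a17 a18 a19 a20 a21 where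
      mem: "{a0, a1, a2, a3, a4, a5, a6, a7, a8, a9, a10, a11, a12, a13, a14, a15, a16, a17, a18,
        a19, a20, a21} \<subseteq> R3" and
      a: "a = arr_of_tab (Tab a0 a1 a2 a3 a4 a5 a6 a7 a8 a9 a10 a11 a12 a13 a14 (3 * a15) (3 *
        a16) (3 * a17) a18 a19 (3 * a20) a21)" by (rule Lambda3E[OF a])
    obtain d where d: "\<not> int 3 dvd d" and
      i: "\<forall>x\<in>{a0, a1, a2, a3, a4, a5, a6, a7, a8, a9, a10, a11, a12, a13, a14, a15, a16, a17, a18,
        a19, a20, a21}. of_int d * x \<in> \<int>"
      using common_denominator[OF prime_3 _ mem] by auto
    have "arr_scale 8 (arr_of_tab (Tab (of_int d * a0) (of_int d * a1) (of_int d * a2) (of_int d *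
      a3) (of_int d * a4) (of_int d * a5) (of_int d * a6) (of_int d * a7) (of_int d * a8) (of_int
      d * a9) (of_int d * a10) (of_int d * a11) (of_int d * a12) (of_int d * a13) (of_int d * a14)
      (3 * (of_int d * a15)) (3 * (of_int d * a16)) (3 * (of_int d * a17)) (of_int d * a18)
      (of_int d * a19) (3 * (of_int d * a20)) (of_int d * a21))) \<in> N"
      by (rule subsetD[OF sub Lambda_tabI]) (use i in auto)
    also have "arr_of_tab (Tab (of_int d * a0) (of_int d * a1) (of_int d * a2) (of_int d * a3)
      (of_int d * a4) (of_int d * a5) (of_int d * a6) (of_int d * a7) (of_int d * a8) (of_int d *
      a9) (of_int d * a10) (of_int d * a11) (of_int d * a12) (of_int d * a13) (of_int d * a14)
      (3 * (of_int d * a15)) (3 * (of_int d * a16)) (3 * (of_int d * a17)) (of_int d * a18)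
      (of_int d * a19) (3 * (of_int d * a20)) (of_int d * a21)) = arr_scale (of_int d) a"
      unfolding a arr_scale_tab by (simp add: algebra_simps)
    finally have "arr_scale (1 / of_int (8 * d)) (arr_scale 8 (arr_scale (of_int d) a)) \<in> N"
      using M.submoduleE(4)[OF N, of "1 / of_int (8 * d)"] d Z_loc_setI[of 3 "8 * d" 1]
        prime_dvd_mult_iff[of "3::int" 8 d] by (simp del: of_int_mult)
    moreover have "d \<noteq> 0" using d by auto
    ultimately show "a \<in> N" by (simp add: arr_scale_scale arr_scale_one)
  qed
qed


subsection \<open>The images form a basis\<close>

text \<open>The base change from the 22 images to coordinates, one row for each coordinate.
  Independence and spanning are both read off from this system.\<close>

lemma rep_arr_combination:
  "(\<Sum>i\<in>set std_types. arr_scale (n i) (rep_arr i)) = arr_of_tab (Tab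
    (n (Q1, P1) + n (Q1, PL) + n (Q1, PR) + n (Q1, PD) + n (Q1, PF) + n (QL, P1) + n (QL, PL) + n
      (QL, PR) + n (QL, PF) + n (QR, P1) + n (QR, PL) + n (QR, PR) + n (QR, PF) + n (QD, P1) + n
      (QD, PL) + n (QD, PR) + n (QD, PD) + n (QD, PF) + n (QF, P1) + n (QF, PL) + n (QF, PR) + n
      (QF, PF))
    (n (Q1, P1) + n (Q1, PL) + n (Q1, PR) + n (Q1, PD) + n (Q1, PF) + n (QL, P1) + n (QL, PL) + n
      (QL, PR) + n (QL, PF))
    (2 * n (Q1, P1) + 2 * n (Q1, PL) + 2 * n (QL, P1) + 2 * n (QL, PL) + n (QR, P1) + n (QR, PL) +
      n (QD, P1) + n (QD, PL) + n (QF, P1) + n (QF, PL))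
    (n (Q1, P1) + n (Q1, PL) + n (Q1, PR) + n (Q1, PD) + n (Q1, PF) + n (QR, P1) + n (QR, PL) + n
      (QR, PR) + n (QR, PF))
    (n (Q1, P1) + n (Q1, PL) + n (Q1, PR) + n (Q1, PD) + n (Q1, PF) + n (QD, P1) + n (QD, PL) + n
      (QD, PR) + n (QD, PD) + n (QD, PF))
    (2 * n (Q1, P1) + 2 * n (Q1, PL) + n (QR, P1) + n (QR, PL) + n (QD, P1) + n (QD, PL))
    (2 * n (Q1, P1) + 2 * n (Q1, PR) + n (QL, P1) + n (QL, PR) + 2 * n (QR, P1) + 2 * n (QR, PR) +
      n (QD, P1) + n (QD, PR) + n (QF, P1) + n (QF, PR))
    (2 * n (Q1, P1) + 2 * n (Q1, PR) + n (QL, P1) + n (QL, PR) + n (QD, P1) + n (QD, PR))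
    (4 * n (Q1, P1) + 2 * n (Q1, PD) + 2 * n (QL, P1) + 2 * n (QR, P1) + 2 * n (QD, P1) + n (QD,
      PD) + n (QF, P1))
    (n (Q1, P1) + n (Q1, PL) + n (QL, P1) + n (QL, PL))
    (n (Q1, P1) + n (Q1, PL) + n (QD, P1) + n (QD, PL))
    (2 * n (Q1, P1) + n (Q1, PD) + n (QL, P1) + n (QD, P1))
    (n (QD, P1) + n (QD, PL) + n (QD, PR) + n (QD, PD) + n (QD, PF))
    (n (QD, P1) + n (QD, PL))
    (2 * n (Q1, PD) + n (QD, PD))
    (6 * n (Q1, P1) + 6 * n (Q1, PR) + 6 * n (QR, P1) + 6 * n (QR, PR))
    (6 * n (Q1, P1) + 6 * n (Q1, PR) + 6 * n (QD, P1) + 6 * n (QD, PR))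
    (12 * n (Q1, P1) + 6 * n (Q1, PD) + 6 * n (QR, P1) + 6 * n (QD, P1))
    (n (QD, P1) + n (QD, PR))
    (n (QD, PD))
    (6 * n (Q1, P1) + 3 * n (Q1, PD) - 6 * n (QD, P1))
    (n (QD, P1)))"
proof -
  have "(\<Sum>i\<in>set std_types. arr_scale (n i) (rep_arr i))
      = sum_list (map (\<lambda>i. arr_scale (n i) (rep_arr i)) std_types)"
    by (rule sum.distinct_set_conv_list) (simp add: std_types_def)
  also have "\<dots> = arr_of_tab (Tab
    (n (Q1, P1) + n (Q1, PL) + n (Q1, PR) + n (Q1, PD) + n (Q1, PF) + n (QL, P1) + n (QL, PL) + n
      (QL, PR) + n (QL, PF) + n (QR, P1) + n (QR, PL) + n (QR, PR) + n (QR, PF) + n (QD, P1) + n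
      (QD, PL) + n (QD, PR) + n (QD, PD) + n (QD, PF) + n (QF, P1) + n (QF, PL) + n (QF, PR) + n
      (QF, PF))
    (n (Q1, P1) + n (Q1, PL) + n (Q1, PR) + n (Q1, PD) + n (Q1, PF) + n (QL, P1) + n (QL, PL) + n
      (QL, PR) + n (QL, PF))
    (2 * n (Q1, P1) + 2 * n (Q1, PL) + 2 * n (QL, P1) + 2 * n (QL, PL) + n (QR, P1) + n (QR, PL) +
      n (QD, P1) + n (QD, PL) + n (QF, P1) + n (QF, PL))
    (n (Q1, P1) + n (Q1, PL) + n (Q1, PR) + n (Q1, PD) + n (Q1, PF) + n (QR, P1) + n (QR, PL) + n
      (QR, PR) + n (QR, PF))
    (n (Q1, P1) + n (Q1, PL) + n (Q1, PR) + n (Q1, PD) + n (Q1, PF) + n (QD, P1) + n (QD, PL) + n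
      (QD, PR) + n (QD, PD) + n (QD, PF))
    (2 * n (Q1, P1) + 2 * n (Q1, PL) + n (QR, P1) + n (QR, PL) + n (QD, P1) + n (QD, PL))
    (2 * n (Q1, P1) + 2 * n (Q1, PR) + n (QL, P1) + n (QL, PR) + 2 * n (QR, P1) + 2 * n (QR, PR) +
      n (QD, P1) + n (QD, PR) + n (QF, P1) + n (QF, PR))
    (2 * n (Q1, P1) + 2 * n (Q1, PR) + n (QL, P1) + n (QL, PR) + n (QD, P1) + n (QD, PR))
    (4 * n (Q1, P1) + 2 * n (Q1, PD) + 2 * n (QL, P1) + 2 * n (QR, P1) + 2 * n (QD, P1) + n (QD,
      PD) + n (QF, P1))
    (n (Q1, P1) + n (Q1, PL) + n (QL, P1) + n (QL, PL))
    (n (Q1, P1) + n (Q1, PL) + n (QD, P1) + n (QD, PL))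
    (2 * n (Q1, P1) + n (Q1, PD) + n (QL, P1) + n (QD, P1))
    (n (QD, P1) + n (QD, PL) + n (QD, PR) + n (QD, PD) + n (QD, PF))
    (n (QD, P1) + n (QD, PL))
    (2 * n (Q1, PD) + n (QD, PD))
    (6 * n (Q1, P1) + 6 * n (Q1, PR) + 6 * n (QR, P1) + 6 * n (QR, PR))
    (6 * n (Q1, P1) + 6 * n (Q1, PR) + 6 * n (QD, P1) + 6 * n (QD, PR))
    (12 * n (Q1, P1) + 6 * n (Q1, PD) + 6 * n (QR, P1) + 6 * n (QD, P1))
    (n (QD, P1) + n (QD, PR))
    (n (QD, PD))
    (6 * n (Q1, P1) + 3 * n (Q1, PD) - 6 * n (QD, P1))
    (n (QD, P1)))"
    apply (simp only: std_types_def list.map sum_list.Cons sum_list.Nil rep_arr_def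
      arr_of_int_tab_def
        coords.simps tab.map arr_scale_tab tab_scale.simps)
    apply (simp only: plus_arr_def arr_add_tab tab_add.simps zero_arr_def arr_zero_tab)
    apply (simp only: arr_of_tab_inject tab.inject of_int_0 of_int_1 of_int_numeral
      of_int_neg_numeral
        mult_zero_right mult_1_right add_0_left add_0_right)
    apply (intro conjI; linarith)
    done
  finally show ?thesis .
qed

lemma rep_arr_independent:
  assumes "(\<Sum>i\<in>set std_types. arr_scale (n i) (rep_arr i)) = 0" "i \<in> set std_types"
  shows "n i = 0"
proof -
  note e = assms(1)[unfolded rep_arr_combination arr_tab tab.inject]
  have "n (Q1, P1) = 0" "n (Q1, PL) = 0" "n (Q1, PR) = 0" "n (Q1, PD) = 0" "n (Q1, PF) = 0" "n
    (QL, P1) = 0" "n (QL, PL) = 0" "n (QL, PR) = 0" "n (QL, PF) = 0" "n (QR, P1) = 0" "n (QR, PL)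
    = 0" "n (QR, PR) = 0" "n (QR, PF) = 0" "n (QD, P1) = 0" "n (QD, PL) = 0" "n (QD, PR) = 0" "n
    (QD, PD) = 0" "n (QD, PF) = 0" "n (QF, P1) = 0" "n (QF, PL) = 0" "n (QF, PR) = 0" "n (QF, PF)
    = 0"
    using e by linarith+
  then show ?thesis using assms(2) by (auto simp: std_types_def)
qed

lemma rep_arr_in_Lambda3: "i \<in> set std_types \<Longrightarrow> rep_arr i \<in> Lambda3"
proof -
  have "\<exists>k\<in>R3. (3 * of_int m :: rat) = 3 * k" for m
    by (intro bexI[of _ "of_int m"]) (simp_all add: R3_Ints)
  \<comment> \<open>These multiples of 3 are all the values that x_1, x_2, x_3 and z_2 take on the
    22 images.\<close>
  from this[of 0] this[of 1] this[of 2] this[of 4] this[of "- 2"]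
  have m: "\<exists>k\<in>R3. 0 = 3 * k" "\<exists>k\<in>R3. 3 = 3 * k" "\<exists>k\<in>R3. 6 = 3 * k" "\<exists>k\<in>R3. 12 = 3 * k"
    "\<exists>k\<in>R3. - 6 = 3 * k" by simp_all
  assume "i \<in> set std_types"
  then show ?thesis
    by (auto simp only: std_types_def list.set insert_iff empty_iff rep_arr_def arr_of_int_tab_def
      coords.simps tab.map
      Lambda3_tab of_int_0 of_int_1 of_int_numeral of_int_neg_numeral intro!: m R3_numeral
        R3_closed)
qed

text \<open>The linear system is solved explicitly. The coefficients 3, 6 and 12 in the x-rows and
  in z_2 lose their factor 3 against the factor 3 of the right-hand side, so only 2 and 4 remain as
  denominators.\<close>

lemma Lambda3_spanned:
  assumes "a \<in> Lambda3"
  shows "\<exists>n. (\<forall>i. n i \<in> R3) \<and> a = (\<Sum>i\<in>set std_types. arr_scale (n i) (rep_arr i))"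
proof -
  obtain a0 a1 a2 a3 a4 a5 a6 a7 a8 a9 a10 a11 a12 a13 a14 a15 a16 a17 a18 a19 a20 a21 where
    mem: "{a0, a1, a2, a3, a4, a5, a6, a7, a8, a9, a10, a11, a12, a13, a14, a15, a16, a17, a18,
      a19, a20, a21} \<subseteq> R3" and
    a: "a = arr_of_tab (Tab a0 a1 a2 a3 a4 a5 a6 a7 a8 a9 a10 a11 a12 a13 a14 (3 * a15) (3 * a16)
      (3 * a17) a18 a19 (3 * a20) a21)" by (rule Lambda3E[OF assms])
  \<comment> \<open>Back substitution: z_3, z_1, v, y and u determine the coefficients of the
    \<open>QD\<close> types, w then gives \<open>(Q1, PD)\<close>, and z_2 gives
    \<open>(Q1, P1)\<close>, the source of the denominator 4. The rows t and x and finally the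
    entries s yield the others.\<close>
  define n where "n = (\<lambda>_. 0)(
    (Q1, P1) := - a14 / 4 + a19 / 4 + a20 / 2 + a21,
    (Q1, PL) := a10 - a13 + a14 / 4 - a19 / 4 - a20 / 2 - a21,
    (Q1, PR) := a14 / 4 + a16 / 2 - a18 - a19 / 4 - a20 / 2 - a21,
    (Q1, PD) := a14 / 2 - a19 / 2,
    (Q1, PF) := a4 - a10 - a12 + a13 - 3 * a14 / 4 - a16 / 2 + a18 + 3 * a19 / 4 + a20 / 2 + a21,
    (QL, P1) := a11 - a20 - 3 * a21,
    (QL, PL) := a9 - a10 - a11 + a13 + a20 + 3 * a21,
    (QL, PR) := a7 - a11 - a16 + a18 + a20 + 3 * a21,
    (QL, PF) := a1 - a4 - a7 - a9 + a10 + a11 + a12 - a13 + a16 - a18 - a20 - 3 * a21,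
    (QR, P1) := a17 / 2 - a20 - 3 * a21,
    (QR, PL) := a5 - 2 * a10 + a13 - a17 / 2 + a20 + 3 * a21,
    (QR, PR) := a15 / 2 - a16 / 2 - a17 / 2 + a18 + a20 + 3 * a21,
    (QR, PF) := a3 - a4 - a5 + 2 * a10 + a12 - a13 - a15 / 2 + a16 / 2 + a17 / 2 - a18 - a20 - 3 *
      a21,
    (QD, P1) := a21,
    (QD, PL) := a13 - a21,
    (QD, PR) := a18 - a21,
    (QD, PD) := a19,
    (QD, PF) := a12 - a13 - a18 - a19 + a21,
    (QF, P1) := a8 - 2 * a11 - a17 - a19 + 2 * a20 + 6 * a21,
    (QF, PL) := a2 - a5 - a8 - 2 * a9 + 2 * a10 + 2 * a11 - 2 * a13 + a17 + a19 - 2 * a20 - 6 * a21,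
    (QF, PR) := a6 - a7 - a8 + 2 * a11 - a15 + a16 + a17 - 2 * a18 + a19 - 2 * a20 - 6 * a21,
    (QF, PF) := a0 - a1 - a2 - a3 + a4 + a5 - a6 + a7 + a8 + 2 * a9 - 2 * a10 - 2 * a11 - 2 * a12
      + 2 * a13 + a15 - a16 - a17 + 2 * a18 - a19 + 2 * a20 + 6 * a21)"
  have n: "n (Q1, P1) = - a14 / 4 + a19 / 4 + a20 / 2 + a21" "n (Q1, PL) = a10 - a13 + a14 / 4 -
    a19 / 4 - a20 / 2 - a21" "n (Q1, PR) = a14 / 4 + a16 / 2 - a18 - a19 / 4 - a20 / 2 - a21" "n
    (Q1, PD) = a14 / 2 - a19 / 2" "n (Q1, PF) = a4 - a10 - a12 + a13 - 3 * a14 / 4 - a16 / 2 + a18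
    + 3 * a19 / 4 + a20 / 2 + a21" "n (QL, P1) = a11 - a20 - 3 * a21" "n (QL, PL) = a9 - a10 - a11
    + a13 + a20 + 3 * a21" "n (QL, PR) = a7 - a11 - a16 + a18 + a20 + 3 * a21" "n (QL, PF) = a1 -
    a4 - a7 - a9 + a10 + a11 + a12 - a13 + a16 - a18 - a20 - 3 * a21" "n (QR, P1) = a17 / 2 - a20
    - 3 * a21" "n (QR, PL) = a5 - 2 * a10 + a13 - a17 / 2 + a20 + 3 * a21" "n (QR, PR) = a15 / 2 -
    a16 / 2 - a17 / 2 + a18 + a20 + 3 * a21" "n (QR, PF) = a3 - a4 - a5 + 2 * a10 + a12 - a13 -
    a15 / 2 + a16 / 2 + a17 / 2 - a18 - a20 - 3 * a21" "n (QD, P1) = a21" "n (QD, PL) = a13 - a21"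
    "n (QD, PR) = a18 - a21" "n (QD, PD) = a19" "n (QD, PF) = a12 - a13 - a18 - a19 + a21" "n (QF,
    P1) = a8 - 2 * a11 - a17 - a19 + 2 * a20 + 6 * a21" "n (QF, PL) = a2 - a5 - a8 - 2 * a9 + 2 *
    a10 + 2 * a11 - 2 * a13 + a17 + a19 - 2 * a20 - 6 * a21" "n (QF, PR) = a6 - a7 - a8 + 2 * a11
    - a15 + a16 + a17 - 2 * a18 + a19 - 2 * a20 - 6 * a21" "n (QF, PF) = a0 - a1 - a2 - a3 + a4 +
    a5 - a6 + a7 + a8 + 2 * a9 - 2 * a10 - 2 * a11 - 2 * a12 + 2 * a13 + a15 - a16 - a17 + 2 * a18
    - a19 + 2 * a20 + 6 * a21"
    by (simp_all add: n_def)
  have "n i \<in> R3" for i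
    using mem unfolding n_def by (auto intro!: R3_closed R3_half R3_numeral)
  moreover have "a = (\<Sum>i\<in>set std_types. arr_scale (n i) (rep_arr i))"
    unfolding rep_arr_combination a arr_of_tab_inject tab.inject n by (simp add: field_simps)
  ultimately show ?thesis by blast
qed


section \<open>The free algebra on biset classes\<close>

abbreviation biset_free :: "(rat, (nat \<Rightarrow> nat) biset_class \<Rightarrow> rat) module" where
  "biset_free \<equiv> free_biset_algebra (Z_loc 3) S3"

lemma biset_free_carrier:
  "f \<in> carrier biset_free \<longleftrightarrow>
    (\<forall>c. f c \<in> R3) \<and> finite {c. f c \<noteq> 0} \<and> {c. f c \<noteq> 0} \<subseteq> biset_classes S3"
  by (simp add: free_biset_algebra_def)

lemma biset_free_simps [simp]:
  "zero biset_free = (\<lambda>c. 0)" "add biset_free = (\<lambda>f g c. f c + g c)"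
  "smult biset_free = (\<lambda>r f c. r * f c)"
  "one biset_free = basis_vector (Z_loc 3) (biset_class S3 (regular_biset S3))"
  by (simp_all add: free_biset_algebra_def)

lemma basis_vector_simp: "basis_vector (Z_loc 3) c = (\<lambda>d. if d = c then 1 else 0)"
  by (simp add: basis_vector_def fun_eq_iff)

lemma basis_vector_closed: "c \<in> biset_classes S3 \<Longrightarrow> basis_vector (Z_loc 3) c \<in> carrier biset_free"
  by (auto simp: biset_free_carrier basis_vector_simp R3_numeral)

lemma biset_free_carrierI:
  assumes "finite S" "S \<subseteq> biset_classes S3" "{c. f c \<noteq> 0} \<subseteq> S" "\<And>c. f c \<in> R3"
  shows "f \<in> carrier biset_free"
  unfolding biset_free_carrier using assms finite_subset[OF assms(3,1)] by blast

lemma biset_free_add_closed: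
  assumes "f \<in> carrier biset_free" "g \<in> carrier biset_free"
  shows "(\<lambda>c. f c + g c) \<in> carrier biset_free"
  by (rule biset_free_carrierI[where S = "{c. f c \<noteq> 0} \<union> {c. g c \<noteq> 0}"])
    (use assms in \<open>auto simp: biset_free_carrier R3_closed\<close>)

lemma biset_free_scale_closed:
  assumes "r \<in> R3" "f \<in> carrier biset_free"
  shows "(\<lambda>c. r * f c) \<in> carrier biset_free"
  by (rule biset_free_carrierI[where S = "{c. f c \<noteq> 0}"])
    (use assms in \<open>auto simp: biset_free_carrier R3_closed\<close>)

lemma biset_free_zero_closed: "(\<lambda>c. 0) \<in> carrier biset_free"
  by (simp add: biset_free_carrier R3_numeral)

lemma biset_free_diff_closed:
  assumes "f \<in> carrier biset_free" "g \<in> carrier biset_free"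
  shows "(\<lambda>c. f c - g c) \<in> carrier biset_free"
  using biset_free_add_closed[OF assms(1) biset_free_scale_closed[OF _ assms(2), of "- 1"]]
  by (simp add: R3_closed R3_numeral)

lemma abelian_group_biset_free: "abelian_group biset_free"
proof (rule abelian_groupI)
  fix f g h :: "(nat \<Rightarrow> nat) biset_class \<Rightarrow> rat"
  show "f \<oplus>\<^bsub>biset_free\<^esub> g \<in> carrier biset_free"
    if "f \<in> carrier biset_free" "g \<in> carrier biset_free"
    using biset_free_add_closed[OF that] by simp
  show "\<zero>\<^bsub>biset_free\<^esub> \<in> carrier biset_free" using biset_free_zero_closed by simp
  show "f \<oplus>\<^bsub>biset_free\<^esub> g \<oplus>\<^bsub>biset_free\<^esub> h = f \<oplus>\<^bsub>biset_free\<^esub> (g \<oplus>\<^bsub>biset_free\<^esub> h)"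
    by (simp add: add.assoc)
  show "f \<oplus>\<^bsub>biset_free\<^esub> g = g \<oplus>\<^bsub>biset_free\<^esub> f" by (simp add: add.commute)
  show "\<zero>\<^bsub>biset_free\<^esub> \<oplus>\<^bsub>biset_free\<^esub> f = f" by simp
  assume "f \<in> carrier biset_free"
  from biset_free_diff_closed[OF biset_free_zero_closed this]
  show "\<exists>g\<in>carrier biset_free. g \<oplus>\<^bsub>biset_free\<^esub> f = \<zero>\<^bsub>biset_free\<^esub>"
    by (rule rev_bexI) simp
qed

lemma module_biset_free: "Module.module (Z_loc 3) biset_free"
proof (rule moduleI[OF cring_Z_loc[OF prime_3] abelian_group_biset_free])
  fix r f assume "r \<in> carrier (Z_loc 3)" "f \<in> carrier biset_free"
  then show "r \<odot>\<^bsub>biset_free\<^esub> f \<in> carrier biset_free"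
    using biset_free_scale_closed[of r f] by simp
qed (simp_all add: distrib_left distrib_right mult.assoc)

interpretation biset_free: module "Z_loc 3" biset_free
  by (rule module_biset_free)

lemma biset_free_neg:
  assumes "f \<in> carrier biset_free"
  shows "\<ominus>\<^bsub>biset_free\<^esub> f = (\<lambda>c. - f c)"
proof -
  have "(\<lambda>c. - f c) \<in> carrier biset_free"
    using biset_free_diff_closed[OF biset_free_zero_closed assms] by simp
  then show ?thesis using assms by (intro biset_free.M.minus_equality) auto
qed

section \<open>Extension of the stabiliser sum to the free module\<close>

definition class_value :: "(nat \<Rightarrow> nat) biset_class \<Rightarrow> arr" where
  "class_value c = stab_sum S3 stab_weight (SOME M :: (nat \<Rightarrow> nat, nat) biset. finite_biset S3 M \<and>
    c = biset_class S3 M)"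

text \<open>The chosen representative \<open>N\<close> belongs to its own class, so equality of
  classes gives an isomorphism from \<open>M\<close> to \<open>N\<close>, and stabiliser sums are
  isomorphism invariant. The points of \<open>M\<close> may have any type, as tensor products and
  coset bisets require.\<close>

lemma class_value_class:
  assumes M: "finite_biset S3 M"
  shows "class_value (biset_class S3 M) = stab_sum S3 stab_weight M"
proof -
  define N :: "(nat \<Rightarrow> nat, nat) biset" where
    "N = (SOME N. finite_biset S3 N \<and> biset_class S3 M = biset_class S3 N)"
  obtain N' :: "(nat \<Rightarrow> nat, nat) biset" where "finite_biset S3 N'" "biset_iso S3 M N'"
    using exists_nat_copy[OF M] by blast
  then have "\<exists>N :: (nat \<Rightarrow> nat, nat) biset. finite_biset S3 N \<and> biset_class S3 M = biset_class S3 N"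
    using biset_class_eqI[OF M] by blast
  then have N: "finite_biset S3 N" "biset_class S3 M = biset_class S3 N"
    unfolding N_def by (metis (mono_tags, lifting) someI_ex)+
  have "N \<in> biset_class S3 M" using N by (simp add: biset_class_def biset_iso_refl)
  then have "biset_iso S3 M N" by (simp add: biset_class_def)
  from stab_sum_iso[OF M this, of stab_weight] show ?thesis by (simp add: class_value_def N_def)
qed

lemma class_value_tensor:
  assumes "a \<in> biset_classes S3" "b \<in> biset_classes S3"
  shows "class_value (class_tensor S3 a b) = class_value a * class_value b"
proof -
  obtain M N :: "(nat \<Rightarrow> nat, nat) biset" where MN: "finite_biset S3 M" "a = biset_class S3 M"
    "finite_biset S3 N" "b = biset_class S3 N" using assms by (elim biset_classesE) blast
  interpret biset_pair S3 M N
    using MN finite_S3 by (intro biset_pair.intro sym_group_is_group biset_pair_axioms.intro)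
  show ?thesis
    by (simp add: MN class_tensor_class[OF finite_S3 MN(1,3)] class_value_class finite_biset_T
      stab_sum_tensor_S3)
qed

definition free_value :: "((nat \<Rightarrow> nat) biset_class \<Rightarrow> rat) \<Rightarrow> arr" where
  "free_value f = (\<Sum>c\<in>{c. f c \<noteq> 0}. arr_scale (f c) (class_value c))"

lemma free_value_superset:
  assumes "finite S" "{c. f c \<noteq> 0} \<subseteq> S"
  shows "free_value f = (\<Sum>c\<in>S. arr_scale (f c) (class_value c))"
  unfolding free_value_def
  by (rule sum.mono_neutral_left[OF assms]) (auto simp: arr_scale_zero_left)

lemma free_value_add:
  assumes "f \<in> carrier biset_free" "g \<in> carrier biset_free"
  shows "free_value (\<lambda>c. f c + g c) = free_value f + free_value g"
proof -
  let ?S = "{c. f c \<noteq> 0} \<union> {c. g c \<noteq> 0}"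
  have S: "finite ?S" using assms by (simp add: biset_free_carrier)
  have "free_value (\<lambda>c. f c + g c) = (\<Sum>c\<in>?S. arr_scale (f c + g c) (class_value c))"
    by (rule free_value_superset[OF S]) auto
  also have "\<dots> = (\<Sum>c\<in>?S. arr_scale (f c) (class_value c)) + (\<Sum>c\<in>?S. arr_scale (g c) (class_value
    c))"
    by (simp add: arr_scale_add_left sum.distrib)
  also have "\<dots> = free_value f + free_value g"
    by (intro arg_cong2[of _ _ _ _ "(+)"] free_value_superset[OF S, symmetric]) auto
  finally show ?thesis .
qed

lemma free_value_scale:
  assumes "f \<in> carrier biset_free"
  shows "free_value (\<lambda>c. r * f c) = arr_scale r (free_value f)"
proof -
  have S: "finite {c. f c \<noteq> 0}" using assms by (simp add: biset_free_carrier)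
  have "free_value (\<lambda>c. r * f c) = (\<Sum>c\<in>{c. f c \<noteq> 0}. arr_scale (r * f c) (class_value c))"
    by (rule free_value_superset[OF S]) auto
  then show ?thesis by (simp add: free_value_def arr_scale_sum arr_scale_scale)
qed

lemma free_value_diff:
  assumes "f \<in> carrier biset_free" "g \<in> carrier biset_free"
  shows "free_value (\<lambda>c. f c - g c) = free_value f - free_value g"
  using free_value_add[OF biset_free_diff_closed[OF assms] assms(2)] by simp

lemma free_value_zero: "free_value (\<lambda>c. 0) = 0"
  by (simp add: free_value_def)

lemma free_value_basis: "free_value (basis_vector (Z_loc 3) c) = class_value c"
proof -
  have "{d. (if d = c then 1 else (0::rat)) \<noteq> 0} = {c}" by auto
  then show ?thesis by (simp add: free_value_def basis_vector_simp arr_scale_one)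
qed

lemma biset_free_mult:
  assumes f: "f \<in> carrier biset_free" and g: "g \<in> carrier biset_free"
  shows "(f \<otimes>\<^bsub>biset_free\<^esub> g) c =
    (\<Sum>p\<in>{p \<in> {a. f a \<noteq> 0} \<times> {b. g b \<noteq> 0}. class_tensor S3 (fst p) (snd p) = c}. f (fst p) * g (snd
      p))"
proof -
  have "{(a, b). f a \<noteq> 0 \<and> g b \<noteq> 0 \<and> class_tensor S3 a b = c}
      = {p \<in> {a. f a \<noteq> 0} \<times> {b. g b \<noteq> 0}. class_tensor S3 (fst p) (snd p) = c}" by auto
  moreover have "f (fst p) * g (snd p) \<in> R3" for p
    using f g by (simp add: biset_free_carrier R3_closed)
  ultimately show ?thesis
    by (simp add: free_biset_algebra_def finsum_Z_loc[OF prime_3])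
qed

text \<open>Pairs of classes from the two supports are grouped by the class of their tensor product.
  Summing over the groups turns multiplicativity on classes into multiplicativity on the free
  module.\<close>

lemma biset_free_mult_closed_value:
  assumes f: "f \<in> carrier biset_free" and g: "g \<in> carrier biset_free"
  shows "f \<otimes>\<^bsub>biset_free\<^esub> g \<in> carrier biset_free" (is ?A)
    and "free_value (f \<otimes>\<^bsub>biset_free\<^esub> g) = free_value f * free_value g" (is ?B)
proof -
  let ?S = "{a. f a \<noteq> 0} \<times> {b. g b \<noteq> 0}" and ?t = "\<lambda>p. class_tensor S3 (fst p) (snd p)"
  have S: "finite ?S" "{a. f a \<noteq> 0} \<subseteq> biset_classes S3" "{b. g b \<noteq> 0} \<subseteq> biset_classes S3"
    using f g by (auto simp: biset_free_carrier)
  have supp: "{c. (f \<otimes>\<^bsub>biset_free\<^esub> g) c \<noteq> 0} \<subseteq> ?t ` ?S"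
  proof
    fix c assume "c \<in> {c. (f \<otimes>\<^bsub>biset_free\<^esub> g) c \<noteq> 0}"
    then have "{p \<in> ?S. ?t p = c} \<noteq> {}" unfolding biset_free_mult[OF f g] by force
    then show "c \<in> ?t ` ?S" by blast
  qed
  have "?t ` ?S \<subseteq> biset_classes S3"
    by (intro image_subsetI group.class_tensor_closed[OF sym_group_is_group finite_S3])
      (use S(2,3) in auto)
  moreover have "(f \<otimes>\<^bsub>biset_free\<^esub> g) c \<in> R3" for c
    unfolding biset_free_mult[OF f g] using f g
    by (intro Z_loc_set_sum[OF prime_3] R3_closed) (simp_all add: biset_free_carrier)
  ultimately show ?A
    by (intro biset_free_carrierI[OF finite_imageI[OF S(1)] _ supp])
  have "free_value (f \<otimes>\<^bsub>biset_free\<^esub> g)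
      = (\<Sum>c\<in>?t ` ?S. arr_scale ((f \<otimes>\<^bsub>biset_free\<^esub> g) c) (class_value c))"
    by (rule free_value_superset[OF finite_imageI[OF S(1)] supp])
  also have "\<dots> = (\<Sum>c\<in>?t ` ?S. \<Sum>p\<in>{p \<in> ?S. ?t p = c}.
      arr_scale (f (fst p) * g (snd p)) (class_value (?t p)))"
  proof (rule sum.cong[OF refl])
    fix c
    have "arr_scale (sum h P) a = (\<Sum>p\<in>P. arr_scale (h p) a)" for h :: "_ \<Rightarrow> rat" and P a
      by (induction P rule: infinite_finite_induct) (simp_all add: arr_scale_zero_left
        arr_scale_add_left)
    then show "arr_scale ((f \<otimes>\<^bsub>biset_free\<^esub> g) c) (class_value c) = (\<Sum>p\<in>{p \<in> ?S. ?t p = c}.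
      arr_scale (f (fst p) * g (snd p)) (class_value (?t p)))"
      unfolding biset_free_mult[OF f g] by (auto intro: sum.cong)
  qed
  also have "\<dots> = (\<Sum>p\<in>?S. arr_scale (f (fst p) * g (snd p)) (class_value (?t p)))"
    by (rule sum.image_gen[OF S(1), symmetric])
  also have "\<dots> = (\<Sum>p\<in>?S. arr_scale (f (fst p)) (class_value (fst p))
      * arr_scale (g (snd p)) (class_value (snd p)))"
    by (rule sum.cong[OF refl])
      (use S(2,3) in \<open>auto simp: class_value_tensor arr_scale_mult_left arr_scale_mult_right
        arr_scale_scale subset_iff mult.commute\<close>)
  also have "\<dots> = free_value f * free_value g"
    by (simp add: free_value_def sum_product sum.cartesian_product split_def)
  finally show ?B .
qed


subsection \<open>The kernel\<close>

abbreviation biset_relations :: "((nat \<Rightarrow> nat) biset_class \<Rightarrow> rat) set" where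
  "biset_relations \<equiv> burnside_relations (Z_loc 3) S3"

definition relation_module :: "((nat \<Rightarrow> nat) biset_class \<Rightarrow> rat) set" where
  "relation_module = generated_submodule (Z_loc 3) biset_free biset_relations"

lemma basis_class_closed:
  "finite_biset S3 M \<Longrightarrow> basis_vector (Z_loc 3) (biset_class S3 M) \<in> carrier biset_free"
  by (intro basis_vector_closed biset_class_in_classes)

lemma relation_eq:
  assumes "finite_biset S3 M" "finite_biset S3 N"
  shows "basis_vector (Z_loc 3) (biset_class S3 (biset_sum M N)) \<ominus>\<^bsub>biset_free\<^esub>
      (basis_vector (Z_loc 3) (biset_class S3 M) \<oplus>\<^bsub>biset_free\<^esub> basis_vector (Z_loc 3) (biset_class
        S3 N))
    = (\<lambda>c. basis_vector (Z_loc 3) (biset_class S3 (biset_sum M N)) c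
        - (basis_vector (Z_loc 3) (biset_class S3 M) c + basis_vector (Z_loc 3) (biset_class S3 N)
          c))"
  using biset_free_neg[OF biset_free_add_closed[OF basis_class_closed[OF assms(1)]
    basis_class_closed[OF assms(2)]]]
  by (simp add: a_minus_def fun_eq_iff)

lemma relations_in_kernel:
  assumes "f \<in> biset_relations"
  shows "f \<in> carrier biset_free" "free_value f = 0"
proof -
  obtain M N :: "(nat \<Rightarrow> nat, nat) biset" where MN: "finite_biset S3 M" "finite_biset S3 N"
    and f: "f = (\<lambda>c. basis_vector (Z_loc 3) (biset_class S3 (biset_sum M N)) c
        - (basis_vector (Z_loc 3) (biset_class S3 M) c + basis_vector (Z_loc 3) (biset_class S3 N)
          c))"
    using assms relation_eq unfolding burnside_relations_def by fastforce
  note c = basis_class_closed[OF finite_biset_sum[OF MN]] basis_class_closed[OF MN(1)]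
    basis_class_closed[OF MN(2)]
  show "f \<in> carrier biset_free"
    unfolding f by (intro biset_free_diff_closed biset_free_add_closed c)
  show "free_value f = 0"
    unfolding f free_value_diff[OF c(1) biset_free_add_closed[OF c(2,3)]] free_value_add[OF c(2,3)]
      free_value_basis class_value_class[OF MN(1)] class_value_class[OF MN(2)]
      class_value_class[OF finite_biset_sum[OF MN]] stab_sum_biset_sum[OF MN] by simp
qed

lemma submodule_relation_module: "submodule relation_module (Z_loc 3) biset_free"
  unfolding relation_module_def
  using relations_in_kernel(1) by (intro biset_free.generated_submodule_is_submodule) blast

lemma relation_module_closed:
  "(\<lambda>c. 0) \<in> relation_module"
  "f \<in> relation_module \<Longrightarrow> g \<in> relation_module \<Longrightarrow> (\<lambda>c. f c + g c) \<in> relation_module"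
  "r \<in> R3 \<Longrightarrow> f \<in> relation_module \<Longrightarrow> (\<lambda>c. r * f c) \<in> relation_module"
  using biset_free.submoduleE(4,5)[OF submodule_relation_module]
    subgroup.one_closed[OF submodule.axioms(1)[OF submodule_relation_module]] by simp_all

lemma relation_module_diff:
  assumes "f \<in> relation_module" "g \<in> relation_module"
  shows "(\<lambda>c. f c - g c) \<in> relation_module"
  using relation_module_closed(2)[OF assms(1) relation_module_closed(3)[OF _ assms(2), of "- 1"]]
  by (simp add: R3_closed R3_numeral)

text \<open>The kernel is a submodule, and it contains the generating relations because stabiliser
  sums are additive.\<close>

lemma relation_module_subset_kernel:
  assumes "f \<in> relation_module"
  shows "f \<in> carrier biset_free" "free_value f = 0"
proof -
  have "submodule {f \<in> carrier biset_free. free_value f = 0} (Z_loc 3) biset_free"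
  proof (rule biset_free.submoduleI)
    fix f assume "f \<in> {f \<in> carrier biset_free. free_value f = 0}"
    then have f: "f \<in> carrier biset_free" "free_value f = 0" by auto
    have "(\<lambda>c. - f c) \<in> carrier biset_free" "free_value (\<lambda>c. - f c) = 0"
      using biset_free_diff_closed[OF biset_free_zero_closed f(1)]
        free_value_diff[OF biset_free_zero_closed f(1)] f(2) free_value_zero by simp_all
    then show "\<ominus>\<^bsub>biset_free\<^esub> f \<in> {f \<in> carrier biset_free. free_value f = 0}"
      by (simp add: biset_free_neg[OF f(1)])
  qed (auto simp: free_value_zero free_value_add free_value_scale arr_scale_zero_right
    intro: biset_free_zero_closed biset_free_add_closed biset_free_scale_closed)
  moreover have "biset_relations \<subseteq> {f \<in> carrier biset_free. free_value f = 0}"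
    using relations_in_kernel by blast
  ultimately have "relation_module \<subseteq> {f \<in> carrier biset_free. free_value f = 0}"
    unfolding relation_module_def generated_submodule_def by blast
  then show "f \<in> carrier biset_free" "free_value f = 0" using assms by auto
qed

section \<open>Reduction to standard bisets modulo the relations\<close>

lemma sum_relation:
  fixes M N :: "(nat \<Rightarrow> nat, nat) biset"
  assumes "finite_biset S3 M" "finite_biset S3 N"
  shows "(\<lambda>c. basis_vector (Z_loc 3) (biset_class S3 (biset_sum M N)) c
        - (basis_vector (Z_loc 3) (biset_class S3 M) c + basis_vector (Z_loc 3) (biset_class S3 N)
          c))
    \<in> relation_module"
  unfolding relation_module_def generated_submodule_def relation_eq[OF assms, symmetric]
  using assms unfolding burnside_relations_def by blast

definition std_basis :: "sgn_type \<times> rot_type \<Rightarrow> (nat \<Rightarrow> nat) biset_class \<Rightarrow> rat" where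
  "std_basis i = basis_vector (Z_loc 3) (biset_class S3 (coset_biset S3 (std_subgroup i)))"

definition std_combination ::
  "(sgn_type \<times> rot_type \<Rightarrow> rat) \<Rightarrow> (nat \<Rightarrow> nat) biset_class \<Rightarrow> rat" where
  "std_combination n = (\<lambda>c. \<Sum>i\<in>set std_types. n i * std_basis i c)"

lemma finite_coset_biset_std:
  "i \<in> set std_types \<Longrightarrow> finite_biset S3 (coset_biset S3 (std_subgroup i))"
  by (intro group.finite_coset_biset[OF sym_group_is_group finite_S3] subgroup_std_subgroup)

lemma std_combination_closed_value:
  assumes n: "\<And>i. n i \<in> R3"
  shows "std_combination n \<in> carrier biset_free"
    and "free_value (std_combination n) = (\<Sum>i\<in>set std_types. arr_scale (n i) (rep_arr i))"
proof -
  have "(\<lambda>c. \<Sum>i\<in>T. n i * std_basis i c) \<in> carrier biset_free \<and>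
    free_value (\<lambda>c. \<Sum>i\<in>T. n i * std_basis i c) = (\<Sum>i\<in>T. arr_scale (n i) (rep_arr i))"
    if "T \<subseteq> set std_types" for T
    using finite_subset[OF that List.finite_set] that
  proof (induction T rule: finite_induct)
    case empty
    then show ?case by (simp add: biset_free_zero_closed free_value_zero)
  next
    case (insert i T)
    have i: "std_basis i \<in> carrier biset_free"
      unfolding std_basis_def using insert.prems
        by (intro basis_class_closed finite_coset_biset_std) simp
    have v: "free_value (std_basis i) = rep_arr i"
      using insert.prems
      by (simp add: std_basis_def free_value_basis class_value_class finite_coset_biset_std
        stab_sum_std)
    note s = biset_free_scale_closed[OF n i]
    show ?case using insert biset_free_add_closed[OF s] free_value_add[OF s]
      by (simp add: free_value_scale[OF i] v)
  qed
  then show "std_combination n \<in> carrier biset_free"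
    "free_value (std_combination n) = (\<Sum>i\<in>set std_types. arr_scale (n i) (rep_arr i))"
    unfolding std_combination_def by blast+
qed

text \<open>Induction on the number of points: the orbit of a point is isomorphic to a standard
  coset biset, and the relation for the disjoint union leaves the complement, which is
  smaller.\<close>

lemma basis_reduction:
  fixes M :: "(nat \<Rightarrow> nat, nat) biset"
  assumes "finite_biset S3 M"
  shows "\<exists>n. (\<forall>i. n i \<in> R3) \<and>
    (\<lambda>c. basis_vector (Z_loc 3) (biset_class S3 M) c - std_combination n c) \<in> relation_module"
  using assms
proof (induction "card (pts M)" arbitrary: M rule: less_induct)
  case (less M)
  note fin = finite_bisetD(1)[OF less.prems]
  show ?case
  proof (cases "pts M = {}")
    case True
    \<comment> \<open>The class of the empty biset is not zero in the free module. Since its union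
      with itself is empty again, the relation for this union is minus its basis vector.\<close>
    have "biset_iso S3 (biset_sum M M) M"
      using True by (intro biset_isoI[where f = "case_sum id id"]) (auto simp: biset_sum_def
        bij_betw_def Plus_def)
    then have "biset_class S3 (biset_sum M M) = biset_class S3 M"
      by (rule biset_class_eqI[OF finite_biset_sum[OF less.prems less.prems]])
    with relation_module_diff[OF relation_module_closed(1) sum_relation[OF less.prems less.prems]]
    have "basis_vector (Z_loc 3) (biset_class S3 M) \<in> relation_module" by simp
    then show ?thesis by (intro exI[of _ "\<lambda>_. 0"]) (simp add: std_combination_def R3_numeral)
  next
    case False
    then obtain m where m: "m \<in> pts M" by blast
    let ?O = "two_sided_orbit S3 M m"
    let ?M1 = "M\<lparr>pts := ?O\<rparr>" and ?M2 = "M\<lparr>pts := pts M - ?O\<rparr>"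
    note O = group.two_sided_orbit_subset[OF sym_group_is_group less.prems m]
    note act = group.two_sided_orbit_act[OF sym_group_is_group less.prems]
    note D = finite_bisetD[OF less.prems]
    have M1: "finite_biset S3 ?M1"
      by (rule finite_biset_restrict[OF less.prems O(1)]) (use act m in blast)
    have M2: "finite_biset S3 ?M2"
    \<comment> \<open>If g n or n g were in the orbit, acting by the inverse of g would put n there
      as well.\<close>
    proof (rule finite_biset_restrict[OF less.prems])
      fix g n assume g: "g \<in> carrier S3" and n: "n \<in> pts M - ?O"
      have ig: "inv\<^bsub>S3\<^esub> g \<in> carrier S3" using group.inv_closed[OF sym_group_is_group g] .
      have "lact M g n \<notin> ?O" "ract M n g \<notin> ?O"
        using act[OF m ig] n group.lact_inv_lact(1)[OF sym_group_is_group less.prems g]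
          group.ract_inv_ract(1)[OF sym_group_is_group less.prems g] by (metis DiffD1 DiffD2)+
      then show "lact M g n \<in> pts M - ?O \<and> ract M n g \<in> pts M - ?O" using D(4,5) g n by blast
    qed blast
    have "card (pts ?M2) < card (pts M)"
      using O m fin by (auto intro: psubset_card_mono)
    from less.hyps[OF this M2] obtain n where n: "\<And>i. n i \<in> R3"
      "(\<lambda>c. basis_vector (Z_loc 3) (biset_class S3 ?M2) c - std_combination n c) \<in> relation_module"
      by blast
    let ?U = "point_stab S3 M m"
    note U = group.subgroup_point_stab[OF sym_group_is_group less.prems m]
    obtain i where i: "i \<in> set std_types"
      "biset_iso S3 (coset_biset S3 ?U) (coset_biset S3 (std_subgroup i))"
      using subgroup_S3_classification[OF U] by blast
    note cU = group.finite_coset_biset[OF sym_group_is_group finite_S3 U]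
    have M1_class: "biset_class S3 ?M1 = biset_class S3 (coset_biset S3 (std_subgroup i))"
      using biset_class_eqI[OF cU i(2)]
        biset_class_eqI[OF cU group.coset_biset_iso_orbit[OF sym_group_is_group less.prems m]]
          by simp
    have M_class: "biset_class S3 (biset_sum ?M1 ?M2) = biset_class S3 M"
      by (rule biset_class_eqI[OF finite_biset_sum[OF M1 M2] biset_iso_sum_restrict[OF O(1)]])
    have upd: "std_combination (n(i := n i + 1)) c = std_basis i c + std_combination n c" for c
    proof -
      have "std_combination (n(i := n i + 1)) c
          = (\<Sum>j\<in>set std_types. (if j = i then std_basis i c else 0) + n j * std_basis j c)"
        unfolding std_combination_def by (rule sum.cong) (auto simp: algebra_simps)
      then show ?thesis using i(1) by (simp add: sum.distrib std_combination_def)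
    qed
    have "(\<lambda>c. (basis_vector (Z_loc 3) (biset_class S3 M) c
        - (std_basis i c + basis_vector (Z_loc 3) (biset_class S3 ?M2) c))
        + (basis_vector (Z_loc 3) (biset_class S3 ?M2) c - std_combination n c)) \<in> relation_module"
      using relation_module_closed(2)[OF sum_relation[OF M1 M2] n(2)]
      by (simp only: M_class M1_class std_basis_def)
    also have "(\<lambda>c. (basis_vector (Z_loc 3) (biset_class S3 M) c
        - (std_basis i c + basis_vector (Z_loc 3) (biset_class S3 ?M2) c))
        + (basis_vector (Z_loc 3) (biset_class S3 ?M2) c - std_combination n c))
      = (\<lambda>c. basis_vector (Z_loc 3) (biset_class S3 M) c - std_combination (n(i := n i + 1)) c)"
      unfolding upd by (rule ext) linarith
    finally have "(\<lambda>c. basis_vector (Z_loc 3) (biset_class S3 M) c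
        - std_combination (n(i := n i + 1)) c) \<in> relation_module" .
    moreover have "(n(i := n i + 1)) j \<in> R3" for j
      using R3_closed(1)[OF n(1)[of i] R3_numeral(2)] n(1)[of j] by simp
    ultimately show ?thesis by blast
  qed
qed

lemma std_combination_linear:
  "std_combination (\<lambda>i. m i + n i) c = std_combination m c + std_combination n c"
  "std_combination (\<lambda>i. r * n i) c = r * std_combination n c"
  by (simp_all add: std_combination_def algebra_simps sum.distrib sum_distrib_left)

text \<open>Linear extension of the reduction of basis vectors. The induction runs over a finite set
  containing the support, so that deleting one coefficient leaves a function to which the hypothesis
  applies.\<close>

lemma free_reduction:
  assumes "f \<in> carrier biset_free"
  shows "\<exists>n. (\<forall>i. n i \<in> R3) \<and> (\<lambda>c. f c - std_combination n c) \<in> relation_module"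
proof -
  have "\<exists>n. (\<forall>i. n i \<in> R3) \<and> (\<lambda>c. f c - std_combination n c) \<in> relation_module"
    if "finite S" "S \<subseteq> biset_classes S3" "{c. f c \<noteq> 0} \<subseteq> S" "\<And>c. f c \<in> R3" for S f
    using that
  proof (induction S arbitrary: f rule: finite_induct)
    case empty
    then have "f = (\<lambda>c. 0)" by (auto simp: fun_eq_iff)
    then show ?case
      by (intro exI[of _ "\<lambda>_. 0"]) (simp add: std_combination_def R3_numeral
        relation_module_closed(1))
  next
    case (insert d S)
    let ?g = "f(d := 0)"
    have "\<exists>n. (\<forall>i. n i \<in> R3) \<and> (\<lambda>c. ?g c - std_combination n c) \<in> relation_module"
      by (rule insert.IH) (use insert.prems in \<open>auto simp: R3_numeral\<close>)
    then obtain n where n: "\<And>i. n i \<in> R3" "(\<lambda>c. ?g c - std_combination n c) \<in> relation_module"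
      by blast
    obtain M :: "(nat \<Rightarrow> nat, nat) biset" where M: "finite_biset S3 M" "d = biset_class S3 M"
      using insert.prems(1) by (auto elim: biset_classesE)
    obtain m where m: "\<And>i. m i \<in> R3"
      "(\<lambda>c. basis_vector (Z_loc 3) d c - std_combination m c) \<in> relation_module"
      using basis_reduction[OF M(1)] M(2) by blast
    have "(\<lambda>c. (?g c - std_combination n c) + f d * (basis_vector (Z_loc 3) d c - std_combination
      m c))
        \<in> relation_module"
      by (rule relation_module_closed(2)[OF n(2) relation_module_closed(3)[OF insert.prems(3)
        m(2)]])
    also have "(\<lambda>c. (?g c - std_combination n c) + f d * (basis_vector (Z_loc 3) d c -
      std_combination m c))
      = (\<lambda>c. f c - std_combination (\<lambda>i. n i + f d * m i) c)"
      by (auto simp: fun_eq_iff std_combination_linear basis_vector_simp algebra_simps)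
    finally have "(\<lambda>c. f c - std_combination (\<lambda>i. n i + f d * m i) c) \<in> relation_module" .
    moreover have "n i + f d * m i \<in> R3" for i
      by (intro R3_closed n(1) m(1) insert.prems(3))
    ultimately show ?case by (intro exI[of _ "\<lambda>i. n i + f d * m i"]) simp
  qed
  from this[of "{c. f c \<noteq> 0}" f] show ?thesis using assms by (simp add: biset_free_carrier)
qed

text \<open>Modulo relations an element of the kernel is a combination of standard bisets. Its value
  is zero, so independence of the images kills all coefficients and the element itself is a
  relation.\<close>

lemma relation_module_eq_kernel:
  "relation_module = {f \<in> carrier biset_free. free_value f = 0}"
proof (intro equalityI subsetI)
  fix f assume "f \<in> {f \<in> carrier biset_free. free_value f = 0}"
  then have f: "f \<in> carrier biset_free" "free_value f = 0" by auto
  obtain n where n: "\<And>i. n i \<in> R3" "(\<lambda>c. f c - std_combination n c) \<in> relation_module"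
    using free_reduction[OF f(1)] by blast
  note s = std_combination_closed_value[of n, OF n(1)]
  have "(\<Sum>i\<in>set std_types. arr_scale (n i) (rep_arr i)) = 0"
    using relation_module_subset_kernel(2)[OF n(2)] free_value_diff[OF f(1) s(1)] f(2) s(2) by simp
  then have "n i = 0" if "i \<in> set std_types" for i using rep_arr_independent that by blast
  then have "std_combination n = (\<lambda>c. 0)" by (simp add: std_combination_def)
  then show "f \<in> relation_module" using n(2) by simp
qed (use relation_module_subset_kernel in blast)

text \<open>Reduction to standard bisets gives one inclusion, since their images lie in Lambda_(3);
  spanning gives the other.\<close>

lemma free_value_image: "free_value ` carrier biset_free = Lambda3"
proof (intro equalityI subsetI)
  fix a assume "a \<in> free_value ` carrier biset_free"
  then obtain f where f: "f \<in> carrier biset_free" "a = free_value f" by blast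
  obtain n where n: "\<And>i. n i \<in> R3" "(\<lambda>c. f c - std_combination n c) \<in> relation_module"
    using free_reduction[OF f(1)] by blast
  note s = std_combination_closed_value[of n, OF n(1)]
  have "a = (\<Sum>i\<in>set std_types. arr_scale (n i) (rep_arr i))"
    using relation_module_subset_kernel(2)[OF n(2)] free_value_diff[OF f(1) s(1)] f(2) s(2) by simp
  then show "a \<in> Lambda3" using n(1) by (auto intro!: Lambda3_sum Lambda3_scale rep_arr_in_Lambda3)
next
  fix a assume "a \<in> Lambda3"
  then obtain n where n: "\<And>i. n i \<in> R3" "a = (\<Sum>i\<in>set std_types. arr_scale (n i) (rep_arr i))"
    using Lambda3_spanned by blast
  from std_combination_closed_value[of n, OF n(1)] n(2) show "a \<in> free_value ` carrier biset_free"
    by (metis image_eqI)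
qed


section \<open>The isomorphism\<close>

abbreviation burnside_S3 :: "(rat, ((nat \<Rightarrow> nat) biset_class \<Rightarrow> rat) set) module" where
  "burnside_S3 \<equiv> double_burnside (Z_loc 3) S3"

text \<open>
  The cosets of the relation module are the fibres of \<open>free_value\<close>, so the ring axioms for the
    double
  Burnside algebra can be transported from the order.
\<close>

definition value_fibre :: "arr \<Rightarrow> ((nat \<Rightarrow> nat) biset_class \<Rightarrow> rat) set" where
  "value_fibre a = {f \<in> carrier biset_free. free_value f = a}"

text \<open>Because the relations are the whole kernel, two elements have the same value exactly if
  they differ by a relation.\<close>

lemma coset_eq_fibre:
  assumes "f \<in> carrier biset_free"
  shows "relation_module +>\<^bsub>biset_free\<^esub> f = value_fibre (free_value f)"
proof -
  have "g \<in> relation_module +>\<^bsub>biset_free\<^esub> f" if g: "g \<in> value_fibre (free_value f)" for g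
  proof -
    have "(\<lambda>c. g c - f c) \<in> relation_module"
      using g assms by (simp add: relation_module_eq_kernel value_fibre_def biset_free_diff_closed
        free_value_diff)
    then have "(\<lambda>c. g c - f c) \<oplus>\<^bsub>biset_free\<^esub> f \<in> relation_module +>\<^bsub>biset_free\<^esub> f"
      unfolding a_r_coset_def' by blast
    then show ?thesis by simp
  qed
  moreover have "g \<in> value_fibre (free_value f)" if "g \<in> relation_module +>\<^bsub>biset_free\<^esub> f" for g
    using that assms unfolding a_r_coset_def' relation_module_eq_kernel
    by (auto simp: value_fibre_def free_value_add biset_free_add_closed)
  ultimately show ?thesis by blast
qed

lemma value_fibre_nonempty: "a \<in> Lambda3 \<Longrightarrow> value_fibre a \<noteq> {}"
  unfolding free_value_image[symmetric] value_fibre_def by blast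

lemma value_fibre_inject:
  assumes "a \<in> Lambda3" "value_fibre a = value_fibre b"
  shows "a = b"
proof -
  obtain f where "f \<in> value_fibre a" using value_fibre_nonempty[OF assms(1)] by blast
  then show ?thesis using assms(2) by (auto simp: value_fibre_def)
qed

lemma burnside_S3_carrier: "carrier burnside_S3 = value_fibre ` Lambda3"
proof -
  have "carrier burnside_S3 = (\<lambda>f. relation_module +>\<^bsub>biset_free\<^esub> f) ` carrier biset_free"
    by (auto simp: double_burnside_def Let_def FactRing_def A_RCOSETS_def' relation_module_def)
  also have "\<dots> = (\<lambda>f. value_fibre (free_value f)) ` carrier biset_free"
    using coset_eq_fibre by (rule image_cong[OF refl])
  finally show ?thesis unfolding free_value_image[symmetric] image_image .
qed

text \<open>The product of cosets is a union over representatives in which every member is the same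
  fibre. Nonemptiness of the two fibres keeps the union from being empty.\<close>

lemma burnside_S3_mult:
  assumes "a \<in> Lambda3" "b \<in> Lambda3"
  shows "value_fibre a \<otimes>\<^bsub>burnside_S3\<^esub> value_fibre b = value_fibre (a * b)"
proof -
  have "value_fibre a \<otimes>\<^bsub>burnside_S3\<^esub> value_fibre b
      = (\<Union>f\<in>value_fibre a. \<Union>g\<in>value_fibre b. relation_module +>\<^bsub>biset_free\<^esub> (f \<otimes>\<^bsub>biset_free\<^esub> g))"
    by (simp add: double_burnside_def Let_def FactRing_def rcoset_mult_def relation_module_def)
  also have "\<dots> = (\<Union>f\<in>value_fibre a. \<Union>g\<in>value_fibre b. value_fibre (a * b))"
    by (intro SUP_cong refl)
      (auto simp: value_fibre_def[of a] value_fibre_def[of b] coset_eq_fibre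
        biset_free_mult_closed_value)
  also have "\<dots> = value_fibre (a * b)"
    using value_fibre_nonempty[OF assms(1)] value_fibre_nonempty[OF assms(2)] by blast
  finally show ?thesis .
qed

lemma burnside_S3_add:
  assumes "a \<in> Lambda3" "b \<in> Lambda3"
  shows "value_fibre a \<oplus>\<^bsub>burnside_S3\<^esub> value_fibre b = value_fibre (a + b)"
proof -
  have "value_fibre a \<oplus>\<^bsub>burnside_S3\<^esub> value_fibre b
      = (\<Union>f\<in>value_fibre a. \<Union>g\<in>value_fibre b. {\<lambda>c. f c + g c})"
    by (simp add: double_burnside_def Let_def FactRing_def set_add_def')
  also have "\<dots> = value_fibre (a + b)"
  proof (intro equalityI subsetI)
    fix h assume "h \<in> (\<Union>f\<in>value_fibre a. \<Union>g\<in>value_fibre b. {\<lambda>c. f c + g c})"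
    then show "h \<in> value_fibre (a + b)"
      by (auto simp: value_fibre_def free_value_add biset_free_add_closed)
  next
    fix h assume h: "h \<in> value_fibre (a + b)"
    obtain f where f: "f \<in> value_fibre a" using value_fibre_nonempty[OF assms(1)] by blast
    have "(\<lambda>c. h c - f c) \<in> value_fibre b"
      using h f by (auto simp: value_fibre_def free_value_diff biset_free_diff_closed)
    moreover have "h = (\<lambda>c. f c + (h c - f c))" by simp
    ultimately show "h \<in> (\<Union>f\<in>value_fibre a. \<Union>g\<in>value_fibre b. {\<lambda>c. f c + g c})"
      using f by blast
  qed
  finally show ?thesis .
qed

lemma burnside_S3_zero: "\<zero>\<^bsub>burnside_S3\<^esub> = value_fibre 0"
proof -
  have "\<zero>\<^bsub>burnside_S3\<^esub> = relation_module"
    by (simp add: double_burnside_def Let_def FactRing_def flip: relation_module_def)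
  then show ?thesis unfolding relation_module_eq_kernel value_fibre_def .
qed

lemma burnside_S3_one: "\<one>\<^bsub>burnside_S3\<^esub> = value_fibre 1"
proof -
  note fin = group.finite_regular_biset[OF sym_group_is_group finite_S3]
  have "\<one>\<^bsub>burnside_S3\<^esub> = relation_module +>\<^bsub>biset_free\<^esub> \<one>\<^bsub>biset_free\<^esub>"
    by (simp add: double_burnside_def Let_def FactRing_def flip: relation_module_def)
  then show ?thesis
    by (simp add: coset_eq_fibre basis_class_closed[OF fin] free_value_basis class_value_class[OF
      fin]
      stab_sum_regular_S3)
qed

lemma burnside_S3_smult:
  assumes "r \<in> R3" "a \<in> Lambda3"
  shows "r \<odot>\<^bsub>burnside_S3\<^esub> value_fibre a = value_fibre (arr_scale r a)"
proof -
  have "r \<odot>\<^bsub>burnside_S3\<^esub> value_fibre a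
      = (\<Union>f\<in>value_fibre a. relation_module +>\<^bsub>biset_free\<^esub> (r \<odot>\<^bsub>biset_free\<^esub> f))"
    by (simp add: double_burnside_def Let_def flip: relation_module_def)
  also have "\<dots> = (\<Union>f\<in>value_fibre a. value_fibre (arr_scale r a))"
    by (intro SUP_cong refl)
      (use assms(1) in \<open>auto simp: value_fibre_def[of a] coset_eq_fibre biset_free_scale_closed
        free_value_scale\<close>)
  also have "\<dots> = value_fibre (arr_scale r a)" using value_fibre_nonempty[OF assms(2)] by blast
  finally show ?thesis .
qed

text \<open>\<open>value_fibre\<close> respects the operations and is onto, and a homomorphic image
  of a ring is a ring. Thus associativity and distributivity come from A instead of from
  bisets.\<close>

lemma is_algebra_burnside_S3: "is_algebra (Z_loc 3) burnside_S3"
proof -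
  let ?L = "A_alg\<lparr>carrier := Lambda3\<rparr>"
  have L: "Module.module (Z_loc 3) ?L" "Ring.ring ?L"
    using is_algebra_Lambda3 by (simp_all add: is_algebra_def)
  have "value_fibre \<in> ring_hom ?L burnside_S3"
    by (rule ring_hom_memI)
      (auto simp: burnside_S3_carrier burnside_S3_mult burnside_S3_add burnside_S3_one)
  from ring.ring_hom_imp_img_ring[OF L(2) this]
  have "Ring.ring (burnside_S3\<lparr>carrier := carrier burnside_S3, zero := \<zero>\<^bsub>burnside_S3\<^esub>\<rparr>)"
    by (simp only: burnside_S3_carrier burnside_S3_zero) simp
  then have ring: "Ring.ring burnside_S3" by simp
  have "Module.module (Z_loc 3) burnside_S3"
    by (rule moduleI[OF cring_Z_loc[OF prime_3] ring.is_abelian_group[OF ring]])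
      (auto simp: burnside_S3_carrier burnside_S3_smult burnside_S3_add Lambda3_scale Lambda3_add
        R3_closed
        arr_scale_add_left arr_scale_add_right arr_scale_scale arr_scale_one R3_numeral)
  then show ?thesis using ring
    by (auto simp: is_algebra_def burnside_S3_carrier burnside_S3_smult burnside_S3_mult
      Lambda3_scale
        Lambda3_mult arr_scale_mult_left arr_scale_mult_right)
qed

lemma burnside_S3_isomorphic:
  "algebras_isomorphic (Z_loc 3) burnside_S3 (A_alg\<lparr>carrier := Lambda3\<rparr>)"
proof -
  let ?L = "A_alg\<lparr>carrier := Lambda3\<rparr>"
  define h where "h = the_inv_into Lambda3 value_fibre"
  have inj: "inj_on value_fibre Lambda3" by (rule inj_onI) (rule value_fibre_inject)
  have h: "h (value_fibre a) = a" if "a \<in> Lambda3" for a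
    unfolding h_def using the_inv_into_f_f[OF inj that] .
  have "h \<in> ring_hom burnside_S3 ?L"
    by (rule ring_hom_memI)
      (auto simp: burnside_S3_carrier burnside_S3_mult burnside_S3_add burnside_S3_one h
        Lambda3_mult
        Lambda3_add Lambda3_one)
  moreover have "bij_betw h (carrier burnside_S3) (carrier ?L)"
    unfolding h_def burnside_S3_carrier
    using bij_betw_the_inv_into[of value_fibre Lambda3 "value_fibre ` Lambda3"] inj
    by (simp add: bij_betw_def)
  moreover have "h (r \<odot>\<^bsub>burnside_S3\<^esub> x) = r \<odot>\<^bsub>?L\<^esub> h x"
    if "r \<in> carrier (Z_loc 3)" "x \<in> carrier burnside_S3" for r x
    using that by (auto simp: burnside_S3_carrier burnside_S3_smult h Lambda3_scale)
  ultimately show ?thesis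
    unfolding algebras_isomorphic_def ring_iso_def
    using is_algebra_burnside_S3 is_algebra_Lambda3 by blast
qed

theorem corollary13:
  fixes R :: "rat set"
  assumes "R = Z_loc_set 3"
  shows "Lambda_loc 3 =
           {Arr s t u v w x y (qelt z1 z2 z3) | s t u v w x y z1 z2 z3.
              Arr s t u v w x y (qelt z1 z2 z3) \<in> A_over R \<and>
              (\<forall>i. cong_in R 3 (x $ i) 0) \<and> cong_in R 3 z2 0}
         \<and> algebras_isomorphic (Z_loc 3)
             (double_burnside (Z_loc 3) (sym_group 3))
             (A_alg\<lparr>carrier := Lambda_loc 3\<rparr>)"
proof
  show "Lambda_loc 3 =
           {Arr s t u v w x y (qelt z1 z2 z3) | s t u v w x y z1 z2 z3.
              Arr s t u v w x y (qelt z1 z2 z3) \<in> A_over R \<and>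
              (\<forall>i. cong_in R 3 (x $ i) 0) \<and> cong_in R 3 z2 0}"
    unfolding assms Lambda_loc_3 Lambda3_def ..
  show "algebras_isomorphic (Z_loc 3) (double_burnside (Z_loc 3) (sym_group 3))
      (A_alg\<lparr>carrier := Lambda_loc 3\<rparr>)"
    unfolding Lambda_loc_3 by (rule burnside_S3_isomorphic)
qed

end
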